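(* Let $\lambda>0$, $\ell>0$, $C_{\lambda,\ell}:=\mathcal{E}_\lambda[\gamma_{\rm loop}^{\lambda,\ell,1}]$, and let $\gamma_0\in A_\ell$ be a smooth curve with $\kappa_0(0)=\kappa_0(1)=0$, where $\kappa_0$ is the curvature vector of $\gamma_0$. If $\mathcal{E}_\lambda[\gamma_0]<C_{\lambda,\ell}$, then there exists $t_0>0$ such that the $\lambda$-elastic flow $\gamma$ with initial datum $\gamma_0$ is embedded (i.e. $\gamma(\cdot,t)$ is injective on $[0,1]$) for all $t\ge t_0$.
   Context: Elliptic functions: for $q\in[0,1)$, $x\in\mathbb{R}$, $\mathrm{F}(x,q)=\int_0^x(1-q^2\sin^2\theta)^{-1/2}\,d\theta$, $\mathrm{E}(x,q)=\int_0^x(1-q^2\sin^2\theta)^{1/2}\,d\theta$, $\mathrm{K}(q)=\mathrm{F}(\pi/2,q)$, $\mathrm{E}(q)=\mathrm{E}(\pi/2,q)$; $\mathrm{am}(\cdot,q)$ is the inverse of $x\mapsto\mathrm{F}(x,q)$, $\mathrm{cn}(x,q)=\cos\mathrm{am}(x,q)$. The function $q\mapsto2\mathrm{E}(q)-\mathrm{K}(q)$ is strictly decreasing on $[0,1)$ with unique zero $q_*\in(0,1)$; the function $g(q)=8(2\mathrm{E}(q)-\mathrm{K}(q))^2(2q^2-1)$ is strictly increasing on $[q_*,1)$ from $0$ to $\infty$; for $c>0$ let $q_3(c)$ be the unique solution of $g(q)=c$ in $(q_*,1)$. Setting: $A_\ell=\{\gamma\in W^{2,2}(0,1;\mathbb{R}^2):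 |\gamma'|\neq0$ on $[0,1]$, $\gamma(0)=(0,0),\ \gamma(1)=(\ell,0)\}$; $\mathcal{E}_\lambda[\gamma]=\int_\gamma k^2\,ds+\lambda L[\gamma]$ with $k$ signed curvature, $s$ arclength, $L$ length. $\gamma_{\rm loop}^{\lambda,\ell,1}:[0,2\mathrm{K}(q)/\alpha]\to\mathbb{R}^2$ is $\gamma(s)=\frac1\alpha\big(-2\mathrm{E}(\mathrm{am}(\alpha s-\mathrm{K}(q),q),q)-2\mathrm{E}(q)+\alpha s,\ 2q\,\mathrm{cn}(\alpha s-\mathrm{K}(q),q)\big)$ with $q=q_3(\lambda\ell^2)$, $\alpha=\frac{2}{\ell}(\mathrm{K}(q)-2\mathrm{E}(q))$. $\lambda$-elastic flow: a smooth family of immersed curves $\gamma:[0,1]\times[0,\infty)\to\mathbb{R}^2$ with $\partial_t\gamma=-2\nabla_s^2\kappa-|\kappa|^2\kappa+\lambda\kappa$ in $[0,1]\times(0,\infty)$, $\gamma(0,t)=(0,0)$, $\gamma(1,t)=(\ell,0)$, $\kappa(0,t)=\kappa(1,t)=0$ for $t>0$, and $\gamma(\cdot,0)=\gamma_0$; here $\kappa=\partial_s^2\gamma$ is the curvature vector, $\partial_s$ the arclength derivative, and $\nabla_s\psi=\partial_s\psi-(\partial_s\psi\cdot\partial_s\gamma)\partial_s\gamma$. For initial data as in the claim, a unique global-in-time smooth solution exists. *)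

theory Defs
  imports "HOL-Analysis.Analysis"
begin

definition sint0 :: "(real \<Rightarrow> real) \<Rightarrow> real \<Rightarrow> real" where
  "sint0 f x = (if 0 \<le> x then integral {0..x} f else - integral {x..0} f)"

definition EllF :: "real \<Rightarrow> real \<Rightarrow> real" where
  "EllF x q = sint0 (\<lambda>\<theta>. 1 / sqrt (1 - q\<^sup>2 * (sin \<theta>)\<^sup>2)) x"

definition EllEi :: "real \<Rightarrow> real \<Rightarrow> real" where
  "EllEi x q = sint0 (\<lambda>\<theta>. sqrt (1 - q\<^sup>2 * (sin \<theta>)\<^sup>2)) x"

definition EllK :: "real \<Rightarrow> real" where
  "EllK q = EllF (pi/2) q"

definition EllE :: "real \<Rightarrow> real" where
  "EllE q = EllEi (pi/2) q"

definition am :: "real \<Rightarrow> real \<Rightarrow> real" where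
  "am u q = (THE x. EllF x q = u)"

definition cn :: "real \<Rightarrow> real \<Rightarrow> real" where
  "cn u q = cos (am u q)"

definition q_star :: real where
  "q_star = (THE q. 0 < q \<and> q < 1 \<and> 2 * EllE q - EllK q = 0)"

definition g_fun :: "real \<Rightarrow> real" where
  "g_fun q = 8 * (2 * EllE q - EllK q)\<^sup>2 * (2 * q\<^sup>2 - 1)"

definition q3 :: "real \<Rightarrow> real" where
  "q3 c = (THE q. q_star < q \<and> q < 1 \<and> g_fun q = c)"

definition loop_q :: "real \<Rightarrow> real \<Rightarrow> real" where
  "loop_q lam l = q3 (lam * l\<^sup>2)"

definition loop_alpha :: "real \<Rightarrow> real \<Rightarrow> real" where
  "loop_alpha lam l = (let q = loop_q lam l in 2 / l * (EllK q - 2 * EllE q))"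

definition loop_len :: "real \<Rightarrow> real \<Rightarrow> real" where
  "loop_len lam l = 2 * EllK (loop_q lam l) / loop_alpha lam l"

definition gamma_loop :: "real \<Rightarrow> real \<Rightarrow> real \<Rightarrow> real \<times> real" where
  "gamma_loop lam l s =
     (let q = loop_q lam l; \<alpha> = loop_alpha lam l in
       ((1/\<alpha>) * (- 2 * EllEi (am (\<alpha> * s - EllK q) q) q - 2 * EllE q + \<alpha> * s),
        (1/\<alpha>) * (2 * q * cn (\<alpha> * s - EllK q) q)))"

definition d1 :: "real set \<Rightarrow> (real \<Rightarrow> real \<times> real) \<Rightarrow> real \<Rightarrow> real \<times> real" where
  "d1 I c u = vector_derivative c (at u within I)"

definition d2 :: "real set \<Rightarrow> (real \<Rightarrow> real \<times> real) \<Rightarrow> real \<Rightarrow> real \<times> real" where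
  "d2 I c u = vector_derivative (\<lambda>v. vector_derivative c (at v within I)) (at u within I)"

definition signed_curv :: "real set \<Rightarrow> (real \<Rightarrow> real \<times> real) \<Rightarrow> real \<Rightarrow> real" where
  "signed_curv I c u =
     (fst (d1 I c u) * snd (d2 I c u) - snd (d1 I c u) * fst (d2 I c u)) / norm (d1 I c u) ^ 3"

definition curve_length :: "real \<Rightarrow> real \<Rightarrow> (real \<Rightarrow> real \<times> real) \<Rightarrow> real" where
  "curve_length a b c = integral {a..b} (\<lambda>u. norm (d1 {a..b} c u))"

definition elastic_energy :: "real \<Rightarrow> real \<Rightarrow> real \<Rightarrow> (real \<Rightarrow> real \<times> real) \<Rightarrow> real" where
  "elastic_energy lam a b c =
     integral {a..b} (\<lambda>u. (signed_curv {a..b} c u)\<^sup>2 * norm (d1 {a..b} c u))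
     + lam * curve_length a b c"

definition ds :: "real set \<Rightarrow> (real \<Rightarrow> real \<times> real) \<Rightarrow> (real \<Rightarrow> real \<times> real) \<Rightarrow> real \<Rightarrow> real \<times> real" where
  "ds I c \<psi> u = (1 / norm (d1 I c u)) *\<^sub>R vector_derivative \<psi> (at u within I)"

definition tangent :: "real set \<Rightarrow> (real \<Rightarrow> real \<times> real) \<Rightarrow> real \<Rightarrow> real \<times> real" where
  "tangent I c = ds I c c"

definition curv_vec :: "real set \<Rightarrow> (real \<Rightarrow> real \<times> real) \<Rightarrow> real \<Rightarrow> real \<times> real" where
  "curv_vec I c = ds I c (tangent I c)"

definition nabla_s :: "real set \<Rightarrow> (real \<Rightarrow> real \<times> real) \<Rightarrow> (real \<Rightarrow> real \<times> real) \<Rightarrow> real \<Rightarrow> real \<times> real" where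
  "nabla_s I c \<psi> u = ds I c \<psi> u - (ds I c \<psi> u \<bullet> tangent I c u) *\<^sub>R tangent I c u"

definition smooth_curve_on :: "real \<Rightarrow> real \<Rightarrow> (real \<Rightarrow> real \<times> real) \<Rightarrow> bool" where
  "smooth_curve_on a b c \<longleftrightarrow>
     (\<exists>D :: nat \<Rightarrow> real \<Rightarrow> real \<times> real.
        (\<forall>u\<in>{a..b}. D 0 u = c u) \<and>
        (\<forall>n. \<forall>u\<in>{a..b}. (D n has_vector_derivative D (Suc n) u) (at u within {a..b})))"

text \<open>The admissible class A_l restricted to smooth curves (smooth implies W^{2,2}).\<close>
definition in_A :: "real \<Rightarrow> (real \<Rightarrow> real \<times> real) \<Rightarrow> bool" where
  "in_A l c \<longleftrightarrow>
     (\<forall>u\<in>{0..1}. c differentiable (at u within {0..1}) \<and> d1 {0..1} c u \<noteq> 0) \<and>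
     c 0 = (0, 0) \<and> c 1 = (l, 0)"

definition smooth_family_on :: "(real \<times> real) set \<Rightarrow> (real \<Rightarrow> real \<Rightarrow> real \<times> real) \<Rightarrow> bool" where
  "smooth_family_on S \<gamma> \<longleftrightarrow>
     (\<exists>D :: nat \<Rightarrow> nat \<Rightarrow> real \<Rightarrow> real \<Rightarrow> real \<times> real.
        (\<forall>(u,t)\<in>S. D 0 0 u t = \<gamma> u t) \<and>
        (\<forall>i j. continuous_on S (\<lambda>(u,t). D i j u t)) \<and>
        (\<forall>i j. \<forall>(u,t)\<in>S.
            ((\<lambda>v. D i j v t) has_vector_derivative D (Suc i) j u t) (at u within {v. (v,t) \<in> S}) \<and>
            ((\<lambda>\<tau>. D i j u \<tau>) has_vector_derivative D i (Suc j) u t) (at t within {\<tau>. (u,\<tau>) \<in> S})))"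

definition elastic_flow :: "real \<Rightarrow> real \<Rightarrow> (real \<Rightarrow> real \<times> real) \<Rightarrow> (real \<Rightarrow> real \<Rightarrow> real \<times> real) \<Rightarrow> bool" where
  "elastic_flow lam l \<gamma>0 \<gamma> \<longleftrightarrow>
     smooth_family_on ({0..1} \<times> {0..}) \<gamma> \<and>
     (\<forall>u\<in>{0..1}. \<forall>t\<ge>0. d1 {0..1} (\<lambda>v. \<gamma> v t) u \<noteq> 0) \<and>
     (\<forall>u\<in>{0..1}. \<forall>t>0.
        (let c = (\<lambda>v. \<gamma> v t); \<kappa> = curv_vec {0..1} c in
          ((\<lambda>\<tau>. \<gamma> u \<tau>) has_vector_derivative
             (- 2 *\<^sub>R nabla_s {0..1} c (nabla_s {0..1} c \<kappa>) u
              - (norm (\<kappa> u))\<^sup>2 *\<^sub>R \<kappa> u + lam *\<^sub>R \<kappa> u)) (at t))) \<and>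
     (\<forall>t>0. \<gamma> 0 t = (0, 0) \<and> \<gamma> 1 t = (l, 0) \<and>
            curv_vec {0..1} (\<lambda>v. \<gamma> v t) 0 = 0 \<and> curv_vec {0..1} (\<lambda>v. \<gamma> v t) 1 = 0) \<and>
     (\<forall>u\<in>{0..1}. \<gamma> u 0 = \<gamma>0 u)"

end

(*
The energy decreases along the flow with rate the squared L2 norm of the normal velocity v, so there
are times close to any sequence t_n -> infinity at which v is small in L2. At these times the curves,
parametrized with constant speed, subconverge to a pinned elastica whose energy is below that of the
loop.

Such an elastica is a segment or consists of n congruent arches k = 2 alpha q cn(alpha s - K, q). If
n >= 2, its energy is at least lam l + 2 pi n sqrt lam, whereas the loop has energy at most
lam l + 4 pi sqrt lam. If n = 1 and 2 E(q) < K(q), it is the loop itself. So n = 1 and 2 E(q) > K(q),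
and this arch is embedded.

Nothing forces v to be small at t_n itself. The curves at t_n are bounded in W^{2,2} and so converge
in C^1. The integrals of test functions against arclength change little between t_n and the nearby
good time; hence the limit at t_n has the same length as the embedded elastica and is contained in it.
Since both have the same end points, the limits agree, and the curves at t_n, being C^1 close to an
embedded curve, are embedded.
*)

theory Submission
  imports Defs "HOL-Complex_Analysis.Great_Picard"
begin

section \<open>Elliptic integrals\<close>

text \<open>Uniform bounds on all derivatives of the curvature, the usual way to make a curvature
  flow subconverge, are never established. Only integrals of C^1 functions F against arclength are
  followed in time. Their time derivative is the integral of (grad F . N - F k) v against arclength,
  with normal N: it is linear in v and contains no derivative of the curvature k. The energy bounds
  the integrals of 1 and k^2, and the time integral of the squared L2 norm of v over a unit window
  is the drop of the energy there, which tends to zero.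

  The limit at t_n is not known to solve any equation, so its identification is metric: a curve of
  speed at most L that stays on an embedded arc of length L and joins its ends in unit time must
  follow the arc at full speed.

  Points move in the normal direction, so nothing prevents the given parametrization from
  degenerating as t grows. Curves are therefore encoded by a length and a tangent angle on the unit
  interval, and the limits are limits of these data.\<close>

lemma sint0_has_real_derivative:
  assumes f: "continuous_on UNIV f"
  shows "(sint0 f has_real_derivative f x) (at x)"
proof -
  define R where "R = \<bar>x\<bar> + 1"
  have int: "f integrable_on {a..b}" for a b
    by (rule integrable_continuous_real) (rule continuous_on_subset[OF f], simp)
  have eq: "sint0 f y = integral {-R..y} f - integral {-R..0} f" if "y \<in> {-R<..<R}" for y
  proof (cases "0 \<le> y")
    case True
    have "integral {-R..0} f + integral {0..y} f = integral {-R..y} f"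
      by (rule Henstock_Kurzweil_Integration.integral_combine) (use True R_def int in auto)
    then show ?thesis using True by (simp add: sint0_def)
  next
    case False
    have "integral {-R..y} f + integral {y..0} f = integral {-R..0} f"
      by (rule Henstock_Kurzweil_Integration.integral_combine) (use False that int in auto)
    then show ?thesis using False by (simp add: sint0_def)
  qed
  have "((\<lambda>y. integral {-R..y} f) has_real_derivative f x) (at x within {-R..R})"
    by (rule integral_has_real_derivative) (auto intro: continuous_on_subset[OF f] simp: R_def)
  then have "((\<lambda>y. integral {-R..y} f) has_real_derivative f x) (at x)"
    by (subst (asm) at_within_Icc_at) (auto simp: R_def)
  then have "((\<lambda>y. integral {-R..y} f - integral {-R..0} f) has_real_derivative f x) (at x)"
    by (auto intro!: derivative_eq_intros)
  then show ?thesis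
    by (rule DERIV_cong_ev[THEN iffD1, rotated -1])
      (auto simp: R_def eq eventually_nhds intro!: exI[of _ "{-R<..<R}"])
qed

lemma sint0_0: "sint0 f 0 = 0"
  by (simp add: sint0_def)

lemma sint0_minus:
  assumes f: "continuous_on UNIV f" and even: "\<And>x. f (- x) = f x"
  shows "sint0 f (- x) = - sint0 f x"
proof -
  have "((\<lambda>x. sint0 f (- x) + sint0 f x) has_real_derivative 0) (at y)" for y
    by (auto intro!: derivative_eq_intros DERIV_chain2[where f="sint0 f" and g="uminus"]
        sint0_has_real_derivative[OF f] simp: even)
  then have "sint0 f (- x) + sint0 f x = sint0 f (- 0) + sint0 f 0"
    by (rule DERIV_isconst_all[rule_format]) 
  then show ?thesis by (simp add: sint0_0)
qed

lemma sint0_add_pi: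
  assumes f: "continuous_on UNIV f" and even: "\<And>x. f (- x) = f x"
    and per: "\<And>x. f (x + pi) = f x"
  shows "sint0 f (x + pi) = sint0 f x + 2 * sint0 f (pi/2)"
proof -
  have "((\<lambda>x. sint0 f (x + pi) - sint0 f x) has_real_derivative 0) (at y)" for y
    by (auto intro!: derivative_eq_intros DERIV_chain2[where f="sint0 f" and g="\<lambda>x. x + pi"]
        sint0_has_real_derivative[OF f] simp: per)
  then have "sint0 f (x + pi) - sint0 f x = sint0 f (-(pi/2) + pi) - sint0 f (-(pi/2))"
    by (rule DERIV_isconst_all[rule_format]) 
  then show ?thesis by (simp add: sint0_minus[OF f even] del: minus_divide_left)
qed

text \<open>An arch starts at amplitude -pi/2, and its curvature vanishes again where the cosine of
  the amplitude does. Hence these are the only values of the incomplete integrals that enter the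
  length, the end point distance and the energy of n arches.\<close>

lemma sint0_odd_multiple:
  assumes f: "continuous_on UNIV f" and even: "\<And>x. f (- x) = f x"
    and per: "\<And>x. f (x + pi) = f x"
  shows "sint0 f (real n * pi - pi/2) = (2 * real n - 1) * sint0 f (pi/2)"
proof (induction n)
  case 0
  show ?case using sint0_minus[OF f even, of "pi/2"] by simp
next
  case (Suc n)
  have "real (Suc n) * pi - pi/2 = (real n * pi - pi/2) + pi" by (simp add: algebra_simps)
  then show ?case by (simp only: sint0_add_pi[OF f even per] Suc) (simp add: algebra_simps)
qed

section \<open>Incomplete elliptic integrals and the amplitude\<close>

definition Delta :: "real \<Rightarrow> real \<Rightarrow> real" where
  "Delta q x = sqrt (1 - q\<^sup>2 * (sin x)\<^sup>2)"

context
  fixes q :: real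
  assumes q: "0 \<le> q" "q < 1"
begin

lemma q2_less_1: "q\<^sup>2 < 1"
  using q by (simp add: power_less_one_iff abs_square_less_1)

lemma Delta_arg_pos: "0 < 1 - q\<^sup>2 * (sin x)\<^sup>2"
proof -
  have "q\<^sup>2 * (sin x)\<^sup>2 \<le> q\<^sup>2 * 1" by (rule mult_left_mono) (auto simp: abs_square_le_1)
  then show ?thesis using q2_less_1 by simp
qed

lemma Delta_pos: "0 < Delta q x"
  using Delta_arg_pos by (simp add: Delta_def)

lemma Delta_square: "(Delta q x)\<^sup>2 = 1 - q\<^sup>2 * (sin x)\<^sup>2"
  using Delta_arg_pos[of x] by (simp add: Delta_def)

lemma Delta_le_1: "Delta q x \<le> 1"
  by (simp add: Delta_def)

lemma continuous_on_Delta: "continuous_on S (Delta q)"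
  unfolding Delta_def by (intro continuous_intros)

lemma continuous_on_inverse_Delta: "continuous_on S (\<lambda>x. 1 / Delta q x)"
  using Delta_pos by (intro continuous_intros continuous_on_Delta) (metis less_irrefl)

lemma Delta_minus: "Delta q (- x) = Delta q x" and Delta_add_pi: "Delta q (x + pi) = Delta q x"
  by (simp_all add: Delta_def)

lemma has_real_derivative_Delta:
  "(Delta q has_real_derivative - q\<^sup>2 * sin x * cos x / Delta q x) (at x)"
  unfolding Delta_def using Delta_arg_pos[of x]
  by (auto intro!: derivative_eq_intros simp: field_simps)

lemma EllF_eq: "EllF x q = sint0 (\<lambda>x. 1 / Delta q x) x"
  and EllEi_eq: "EllEi x q = sint0 (Delta q) x"
  unfolding EllF_def EllEi_def Delta_def[abs_def] by simp_all

lemma has_real_derivative_EllF: "((\<lambda>x. EllF x q) has_real_derivative 1 / Delta q x) (at x)"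
  unfolding EllF_eq by (rule sint0_has_real_derivative[OF continuous_on_inverse_Delta])

lemma has_real_derivative_EllEi: "((\<lambda>x. EllEi x q) has_real_derivative Delta q x) (at x)"
  unfolding EllEi_eq by (rule sint0_has_real_derivative[OF continuous_on_Delta])

lemma EllF_0: "EllF 0 q = 0" and EllEi_0: "EllEi 0 q = 0"
  by (simp_all add: EllF_eq EllEi_eq sint0_0)

lemma EllF_minus: "EllF (- x) q = - EllF x q"
  unfolding EllF_eq by (rule sint0_minus[OF continuous_on_inverse_Delta]) (simp add: Delta_minus)

lemma EllEi_minus: "EllEi (- x) q = - EllEi x q"
  unfolding EllEi_eq by (rule sint0_minus[OF continuous_on_Delta]) (simp add: Delta_minus)

lemma EllF_odd_multiple: "EllF (real n * pi - pi/2) q = (2 * real n - 1) * EllK q"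
  unfolding EllF_eq EllK_def
  by (rule sint0_odd_multiple[OF continuous_on_inverse_Delta]) (simp_all add: Delta_minus Delta_add_pi)

lemma EllEi_odd_multiple: "EllEi (real n * pi - pi/2) q = (2 * real n - 1) * EllE q"
  unfolding EllEi_eq EllE_def
  by (rule sint0_odd_multiple[OF continuous_on_Delta]) (simp_all add: Delta_minus Delta_add_pi)

text \<open>The integrand is at least 1. This expansion makes the integral injective and unbounded
  in both directions, so that the description in \<open>am\<close> has exactly one
  candidate.\<close>

lemma EllF_diff_ge: "x \<le> y \<Longrightarrow> y - x \<le> EllF y q - EllF x q"
proof -
  assume "x \<le> y"
  then have "EllF x q - x \<le> EllF y q - y"
  proof (rule DERIV_nonneg_imp_nondecreasing)
    fix z
    show "\<exists>d. ((\<lambda>x. EllF x q - x) has_real_derivative d) (at z) \<and> 0 \<le> d"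
      by (rule exI[of _ "1 / Delta q z - 1"])
        (use Delta_pos[of z] Delta_le_1[of z] in
          \<open>auto intro!: derivative_eq_intros has_real_derivative_EllF simp: field_simps\<close>)
  qed
  then show ?thesis by simp
qed

lemma EllF_less_iff: "EllF x q < EllF y q \<longleftrightarrow> x < y"
  using EllF_diff_ge[of x y] EllF_diff_ge[of y x] by (cases x y rule: linorder_cases) auto

lemma EllF_eq_iff: "EllF x q = EllF y q \<longleftrightarrow> x = y"
  using EllF_less_iff[of x y] EllF_less_iff[of y x] by (cases x y rule: linorder_cases) auto

lemma isCont_EllF: "isCont (\<lambda>x. EllF x q) x"
  using has_real_derivative_EllF DERIV_isCont by blast

lemma EllF_surj: "\<exists>x. EllF x q = u"
proof -
  have "\<exists>x\<ge>- \<bar>u\<bar>. x \<le> \<bar>u\<bar> \<and> EllF x q = u"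
  proof (rule IVT)
    show "EllF (- \<bar>u\<bar>) q \<le> u" "u \<le> EllF \<bar>u\<bar> q"
      using EllF_diff_ge[of 0 "\<bar>u\<bar>"] EllF_diff_ge[of "-\<bar>u\<bar>" 0] by (auto simp: EllF_0)
  qed (auto intro: isCont_EllF)
  then show ?thesis by blast
qed

lemma am_EllF: "am (EllF x q) q = x"
  unfolding am_def by (rule the_equality) (auto simp: EllF_eq_iff)

lemma EllF_am: "EllF (am u q) q = u"
  using EllF_surj[of u] am_EllF by metis

lemma am_eq_iff: "am u q = x \<longleftrightarrow> u = EllF x q"
  using EllF_am am_EllF by metis

lemma has_real_derivative_am: "((\<lambda>u. am u q) has_real_derivative Delta q (am u q)) (at u)"
proof -
  have "isCont (\<lambda>u. am u q) (EllF (am u q) q)"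
    by (rule isCont_inverse_function[where d=1]) (auto simp: am_EllF isCont_EllF)
  then have "isCont (\<lambda>u. am u q) u" by (simp add: EllF_am)
  then have "((\<lambda>u. am u q) has_real_derivative inverse (1 / Delta q (am u q))) (at u)"
    using Delta_pos[of "am u q"]
    by (intro DERIV_inverse_function[OF has_real_derivative_EllF, where a="u-1" and b="u+1"])
      (auto simp: EllF_am)
  then show ?thesis by simp
qed

text \<open>The sine, the cosine and \<open>Delta\<close> of the amplitude are Jacobi's sn, cn and
  dn. The product sn dn is included because it is the derivative of -cn up to a factor, so that its
  derivative yields the second derivative of the curvature. The shift by \<open>EllK q\<close> puts
  a zero of cn at x = 0, as the boundary condition k = 0 requires. The factor \<omega> is \<alpha>
  for the loop in arclength and \<alpha> L for a curve on the unit interval.\<close>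

lemma amplitude_derivatives:
  assumes \<phi>_def: "\<phi> = (\<lambda>x. am (\<omega> * x - EllK q) q)"
  shows "(\<phi> has_real_derivative \<omega> * Delta q (\<phi> x)) (at x)"
    and "((\<lambda>x. EllEi (\<phi> x) q) has_real_derivative \<omega> * (Delta q (\<phi> x))\<^sup>2) (at x)"
    and "((\<lambda>x. sin (\<phi> x)) has_real_derivative \<omega> * cos (\<phi> x) * Delta q (\<phi> x)) (at x)"
    and "((\<lambda>x. cos (\<phi> x)) has_real_derivative - \<omega> * sin (\<phi> x) * Delta q (\<phi> x)) (at x)"
    and "((\<lambda>x. Delta q (\<phi> x)) has_real_derivative - \<omega> * q\<^sup>2 * sin (\<phi> x) * cos (\<phi> x)) (at x)"
    and "((\<lambda>x. sin (\<phi> x) * Delta q (\<phi> x)) has_real_derivative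
      \<omega> * cos (\<phi> x) * (1 - 2 * (q\<^sup>2 * (sin (\<phi> x))\<^sup>2))) (at x)"
    and "\<phi> 0 = - (pi/2)"
proof -
  have d: "(\<phi> has_real_derivative \<omega> * Delta q (\<phi> x)) (at x)" for x
    unfolding \<phi>_def
    by (rule DERIV_cong[OF DERIV_chain2[where f="\<lambda>u. am u q", OF has_real_derivative_am]])
      (auto intro!: derivative_eq_intros)
  then show "(\<phi> has_real_derivative \<omega> * Delta q (\<phi> x)) (at x)" .
  show "((\<lambda>x. EllEi (\<phi> x) q) has_real_derivative \<omega> * (Delta q (\<phi> x))\<^sup>2) (at x)"
    by (rule DERIV_cong[OF DERIV_chain2[where f="\<lambda>u. EllEi u q", OF has_real_derivative_EllEi d]])
      (simp add: power2_eq_square)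
  show S: "((\<lambda>x. sin (\<phi> x)) has_real_derivative \<omega> * cos (\<phi> x) * Delta q (\<phi> x)) (at x)"
    and "((\<lambda>x. cos (\<phi> x)) has_real_derivative - \<omega> * sin (\<phi> x) * Delta q (\<phi> x)) (at x)"
    by (auto intro!: derivative_eq_intros d)
  show D: "((\<lambda>x. Delta q (\<phi> x)) has_real_derivative - \<omega> * q\<^sup>2 * sin (\<phi> x) * cos (\<phi> x)) (at x)"
    by (rule DERIV_cong[OF DERIV_chain2[where f="Delta q", OF has_real_derivative_Delta d]])
      (use Delta_pos[of "\<phi> x"] in simp)
  have "1 - 2 * (q\<^sup>2 * (sin (\<phi> x))\<^sup>2) = (Delta q (\<phi> x))\<^sup>2 - q\<^sup>2 * (sin (\<phi> x))\<^sup>2"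
    by (simp add: Delta_square)
  then have "\<omega> * cos (\<phi> x) * (1 - 2 * (q\<^sup>2 * (sin (\<phi> x))\<^sup>2))
      = sin (\<phi> x) * (- \<omega> * q\<^sup>2 * sin (\<phi> x) * cos (\<phi> x)) + \<omega> * cos (\<phi> x) * Delta q (\<phi> x) * Delta q (\<phi> x)"
    by (simp only:) (simp add: power2_eq_square algebra_simps)
  then show "((\<lambda>x. sin (\<phi> x) * Delta q (\<phi> x)) has_real_derivative
      \<omega> * cos (\<phi> x) * (1 - 2 * (q\<^sup>2 * (sin (\<phi> x))\<^sup>2))) (at x)"
    using DERIV_mult'[OF S D] by simp
  show "\<phi> 0 = - (pi/2)"
    by (simp add: \<phi>_def am_eq_iff EllF_minus EllK_def del: minus_divide_left)
qed

end

section \<open>Bounds for the complete integrals, by comparison with elementary primitives\<close>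

lemma increment_le:
  fixes F G :: "real \<Rightarrow> real"
  assumes "a \<le> b"
    and "\<And>x. (F has_real_derivative F' x) (at x)" "\<And>x. (G has_real_derivative G' x) (at x)"
    and "\<And>x. a < x \<Longrightarrow> x < b \<Longrightarrow> F' x \<le> G' x"
  shows "F b - F a \<le> G b - G a"
proof (cases "a < b")
  case True
  have d: "((\<lambda>x. G x - F x) has_real_derivative G' x - F' x) (at x)" for x
    using assms by (auto intro!: derivative_eq_intros)
  have c: "continuous_on {a..b} (\<lambda>x. G x - F x)"
    using DERIV_isCont[OF d] by (simp add: continuous_at_imp_continuous_on)
  obtain z where "a < z" "z < b" "(G b - F b) - (G a - F a) = (b - a) * (G' z - F' z)"
    using MVT2[OF True, of "\<lambda>x. G x - F x" "\<lambda>x. G' x - F' x"] d by auto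
  then show ?thesis using True assms(4)[of z]
    by (smt (verit) mult_nonneg_nonneg)
qed (use assms in auto)

lemma increment_less:
  fixes F G :: "real \<Rightarrow> real"
  assumes "a < b"
    and "\<And>x. (F has_real_derivative F' x) (at x)" "\<And>x. (G has_real_derivative G' x) (at x)"
    and "\<And>x. a < x \<Longrightarrow> x < b \<Longrightarrow> F' x < G' x"
  shows "F b - F a < G b - G a"
proof -
  have d: "((\<lambda>x. G x - F x) has_real_derivative G' x - F' x) (at x)" for x
    using assms by (auto intro!: derivative_eq_intros)
  obtain z where "a < z" "z < b" "(G b - F b) - (G a - F a) = (b - a) * (G' z - F' z)"
    using MVT2[OF assms(1), of "\<lambda>x. G x - F x" "\<lambda>x. G' x - F' x"] d by auto
  then show ?thesis using assms(1) assms(4)[of z]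
    by (smt (verit) mult_pos_pos)
qed

lemma sin_cos_sq_antiderivatives:
  "((\<lambda>x. (x + sin x * cos x) / 2) has_real_derivative (cos x)\<^sup>2) (at x)"
  "((\<lambda>x. (x - sin x * cos x) / 2) has_real_derivative (sin x)\<^sup>2) (at x)"
proof -
  have "(1 + ((cos x)\<^sup>2 - (sin x)\<^sup>2)) / 2 = (cos x)\<^sup>2" "(1 - ((cos x)\<^sup>2 - (sin x)\<^sup>2)) / 2 = (sin x)\<^sup>2"
    using sin_cos_squared_add[of x] by (auto simp: field_simps)
  then show
    "((\<lambda>x. (x + sin x * cos x) / 2) has_real_derivative (cos x)\<^sup>2) (at x)"
    "((\<lambda>x. (x - sin x * cos x) / 2) has_real_derivative (sin x)\<^sup>2) (at x)"
    by (auto intro!: derivative_eq_intros simp: power2_eq_square)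
qed

context
  fixes q :: real
  assumes q: "0 \<le> q" "q < 1"
begin

lemma EllE_ge_1: "1 \<le> EllE q"
proof -
  have "sin (pi/2) - sin 0 \<le> EllEi (pi/2) q - EllEi 0 q"
  proof (rule increment_le)
    fix x :: real assume "0 < x" "x < pi/2"
    have "q\<^sup>2 * (sin x)\<^sup>2 \<le> 1 * (sin x)\<^sup>2"
      by (rule mult_right_mono) (use q2_less_1[OF q] in auto)
    then have "(cos x)\<^sup>2 \<le> (Delta q x)\<^sup>2" 
      by (simp add: Delta_square[OF q] cos_squared_eq)
    then show "cos x \<le> Delta q x"
      using Delta_pos[OF q, of x] by (meson less_imp_le power2_le_imp_le)
  qed (auto intro: has_real_derivative_EllEi[OF q])
  then show ?thesis by (simp add: EllE_def EllEi_0[OF q])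
qed

text \<open>The square of \<open>Delta\<close> has mean \<open>1 - q\<^sup>2/2\<close> over a
  quarter period, and the mean of a square root is at most the root of the mean. Concavity enters as
  the inequality 2 sqrt b Delta \<le> Delta^2 + b, whose right side has an elementary
  primitive.\<close>

lemma EllE_le: "EllE q \<le> pi/2 * sqrt (1 - q\<^sup>2/2)"
proof -
  define b where "b = 1 - q\<^sup>2/2"
  have b: "b > 0" using q2_less_1[OF q] by (simp add: b_def)
  define G where "G = (\<lambda>x. ((1 + b) * x - q\<^sup>2 * ((x - sin x * cos x) / 2)) / (2 * sqrt b))"
  have "EllEi (pi/2) q - EllEi 0 q \<le> G (pi/2) - G 0"
  proof (rule increment_le)
    show "(G has_real_derivative ((1 + b) - q\<^sup>2 * (sin x)\<^sup>2) / (2 * sqrt b)) (at x)" for x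
    proof -
      have "((\<lambda>x. (1 + b) * x - q\<^sup>2 * ((x - sin x * cos x) / 2)) has_real_derivative
          (1 + b) * 1 - q\<^sup>2 * (sin x)\<^sup>2) (at x)"
        by (intro DERIV_diff DERIV_cmult DERIV_ident sin_cos_sq_antiderivatives)
      from DERIV_cdivide[OF this, of "2 * sqrt b"] show ?thesis by (simp add: G_def)
    qed
    fix x :: real assume "0 < x" "x < pi/2"
    have "0 \<le> (Delta q x - sqrt b)\<^sup>2" by simp
    then have "2 * sqrt b * Delta q x \<le> (Delta q x)\<^sup>2 + b"
      using b by (simp add: power2_diff algebra_simps)
    then show "Delta q x \<le> ((1 + b) - q\<^sup>2 * (sin x)\<^sup>2) / (2 * sqrt b)"
      using b by (simp add: Delta_square[OF q] pos_le_divide_eq algebra_simps)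
  qed (auto intro: has_real_derivative_EllEi[OF q])
  also have "G (pi/2) - G 0 = pi/2 * ((1 + b - q\<^sup>2/2) / (2 * sqrt b))"
    by (simp add: G_def field_simps)
  also have "1 + b - q\<^sup>2/2 = 2 * b" by (simp add: b_def)
  also have "2 * b / (2 * sqrt b) = sqrt b" using b by (simp add: real_div_sqrt)
  finally show ?thesis by (simp add: EllE_def EllEi_0[OF q] b_def)
qed

text \<open>The difference is the integral of q^2 sin^2 / Delta, and \<open>Delta\<close> is at most
  1.\<close>

lemma EllK_minus_EllE_ge: "q\<^sup>2 * (pi/4) \<le> EllK q - EllE q"
proof -
  have "q\<^sup>2 * ((pi/2 - sin (pi/2) * cos (pi/2)) / 2) - q\<^sup>2 * ((0 - sin 0 * cos 0) / 2)
     \<le> (EllF (pi/2) q - EllEi (pi/2) q) - (EllF 0 q - EllEi 0 q)"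
  proof (rule increment_le)
    show "((\<lambda>x. EllF x q - EllEi x q) has_real_derivative 1 / Delta q x - Delta q x) (at x)" for x
      by (intro derivative_intros has_real_derivative_EllEi has_real_derivative_EllF q)
    show "((\<lambda>x. q\<^sup>2 * ((x - sin x * cos x) / 2)) has_real_derivative q\<^sup>2 * (sin x)\<^sup>2) (at x)" for x
      by (rule DERIV_cmult sin_cos_sq_antiderivatives)+
    fix x :: real
    have "1 / Delta q x - Delta q x = q\<^sup>2 * (sin x)\<^sup>2 / Delta q x"
      using Delta_square[OF q, of x] Delta_pos[OF q, of x]
      by (simp add: field_simps power2_eq_square)
    also have "\<dots> \<ge> q\<^sup>2 * (sin x)\<^sup>2 / 1"
      by (rule divide_left_mono) (use Delta_le_1[OF q] Delta_pos[OF q] in auto)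
    finally show "q\<^sup>2 * (sin x)\<^sup>2 \<le> 1 / Delta q x - Delta q x" by simp
  qed auto
  then show ?thesis by (simp add: EllE_def EllK_def EllEi_0[OF q] EllF_0[OF q])
qed

text \<open>The integrand is q^2 cos^2 / Delta. Up to a factor this is the bending energy of half an
  arch, the integral of q^2 cn^2 over a quarter period.\<close>

lemma EllE_minus_EllK_ge: "q\<^sup>2 * (pi/4) \<le> EllE q - (1 - q\<^sup>2) * EllK q"
proof -
  have "q\<^sup>2 * ((pi/2 + sin (pi/2) * cos (pi/2)) / 2) - q\<^sup>2 * ((0 + sin 0 * cos 0) / 2)
     \<le> (EllEi (pi/2) q - (1 - q\<^sup>2) * EllF (pi/2) q) - (EllEi 0 q - (1 - q\<^sup>2) * EllF 0 q)"
  proof (rule increment_le)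
    show "((\<lambda>x. EllEi x q - (1 - q\<^sup>2) * EllF x q) has_real_derivative
        Delta q x - (1 - q\<^sup>2) * (1 / Delta q x)) (at x)" for x
      by (intro derivative_intros has_real_derivative_EllEi has_real_derivative_EllF q DERIV_cmult)
    show "((\<lambda>x. q\<^sup>2 * ((x + sin x * cos x) / 2)) has_real_derivative q\<^sup>2 * (cos x)\<^sup>2) (at x)" for x
      by (rule DERIV_cmult sin_cos_sq_antiderivatives)+
    fix x :: real
    have "Delta q x - (1 - q\<^sup>2) * (1 / Delta q x) = ((Delta q x)\<^sup>2 - (1 - q\<^sup>2)) / Delta q x"
      using Delta_pos[OF q, of x] by (simp add: field_simps power2_eq_square)
    also have "\<dots> = q\<^sup>2 * (cos x)\<^sup>2 / Delta q x"
      by (simp add: Delta_square[OF q] cos_squared_eq algebra_simps)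
    also have "\<dots> \<ge> q\<^sup>2 * (cos x)\<^sup>2 / 1"
      by (rule divide_left_mono) (use Delta_le_1[OF q] Delta_pos[OF q] in auto)
    finally show "q\<^sup>2 * (cos x)\<^sup>2 \<le> Delta q x - (1 - q\<^sup>2) * (1 / Delta q x)" by simp
  qed auto
  then show ?thesis by (simp add: EllE_def EllK_def EllEi_0[OF q] EllF_0[OF q])
qed

lemma EllK_pos: "0 < EllK q"
proof -
  have "EllF 0 q < EllF (pi/2) q" by (simp add: EllF_less_iff[OF q])
  then show ?thesis by (simp add: EllK_def EllF_0[OF q])
qed

lemma EllE_le_pi_half: "EllE q \<le> pi/2"
proof -
  have "sqrt (1 - q\<^sup>2/2) \<le> 1" by simp
  then have "pi/2 * sqrt (1 - q\<^sup>2/2) \<le> pi/2 * 1" by (intro mult_left_mono) auto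
  then show ?thesis using EllE_le by linarith
qed

text \<open>With c = sqrt (1 - q^2), \<open>Delta\<close> is at most c + cos x and so at most c +
  (pi/2 - x). The reciprocal of the latter integrates to a logarithm that blows up as c tends to
  0.\<close>

lemma EllK_ge_ln: "ln (1 + pi / (2 * sqrt (1 - q\<^sup>2))) \<le> EllK q"
proof -
  define c where "c = sqrt (1 - q\<^sup>2)"
  have c: "c > 0" using q2_less_1[OF q] by (simp add: c_def)
  define G where "G = (\<lambda>x. - ln (c + (pi/2 - x)))"
  define F where "F = (\<lambda>x. EllF x q)"
  have "G (pi/2) - G 0 \<le> F (pi/2) - F 0"
  proof -
    have dd: "((\<lambda>x. F x - G x) has_real_derivative (1 / Delta q x - 1 / (c + (pi/2 - x)))) (at x)"
      if "0 \<le> x" "x \<le> pi/2" for x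
      unfolding F_def G_def using c that
      by (auto intro!: derivative_eq_intros has_real_derivative_EllF[OF q] simp: field_simps)
    have pos: "0 \<le> 1 / Delta q x - 1 / (c + (pi/2 - x))" if x: "0 \<le> x" "x \<le> pi/2" for x
    proof -
      have "cos x = sin (pi/2 - x)" by (simp add: sin_diff)
      also have "\<dots> \<le> pi/2 - x" using x by (intro sin_x_le_x) auto
      finally have cx: "cos x \<le> pi/2 - x" .
      have c0: "0 \<le> cos x" using x by (intro cos_ge_zero) auto
      have "(Delta q x)\<^sup>2 = c\<^sup>2 + q\<^sup>2 * (cos x)\<^sup>2"
        using q2_less_1[OF q] by (simp add: Delta_square[OF q] c_def cos_squared_eq algebra_simps)
      also have "\<dots> \<le> c\<^sup>2 + 1 * (cos x)\<^sup>2"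
        by (intro add_left_mono mult_right_mono) (use q2_less_1[OF q] in auto)
      also have "\<dots> \<le> (c + cos x)\<^sup>2" using c c0 by (simp add: power2_sum)
      finally have "Delta q x \<le> c + cos x" by (rule power2_le_imp_le) (use c c0 in simp)
      with cx have "Delta q x \<le> c + (pi/2 - x)" by simp
      then have "1 / (c + (pi/2 - x)) \<le> 1 / Delta q x"
        using Delta_pos[OF q, of x] by (intro divide_left_mono) auto
      then show ?thesis by simp
    qed
    have "F 0 - G 0 \<le> F (pi/2) - G (pi/2)"
      by (rule DERIV_nonneg_imp_nondecreasing) (use dd pos in \<open>auto intro!: exI\<close>)
    then show ?thesis by simp
  qed
  also have "F (pi/2) - F 0 = EllK q" by (simp add: F_def EllK_def EllF_0[OF q])
  also have "G (pi/2) - G 0 = ln ((c + pi/2) / c)"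
    using c ln_div[of "c + pi/2" c] add_pos_pos[of c "pi/2"] by (simp add: G_def)
  also have "(c + pi/2) / c = 1 + pi / (2 * c)" using c by (simp add: field_simps)
  finally show ?thesis by (simp add: c_def)
qed

end

section \<open>Dependence on the modulus: the numbers \<open>q_star\<close> and
  \<open>q3\<close>\<close>

lemma two_EllE_minus_EllK_strict_decreasing:
  assumes "0 \<le> q" "q < r" "r < 1"
  shows "2 * EllE r - EllK r < 2 * EllE q - EllK q"
proof -
  have q: "0 \<le> q" "q < 1" and r: "0 \<le> r" "r < 1" using assms by auto
  have "(2 * EllEi (pi/2) r - EllF (pi/2) r) - (2 * EllEi 0 r - EllF 0 r)
      < (2 * EllEi (pi/2) q - EllF (pi/2) q) - (2 * EllEi 0 q - EllF 0 q)"
  proof (rule increment_less)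
    show "((\<lambda>x. 2 * EllEi x r - EllF x r) has_real_derivative 2 * Delta r x - 1 / Delta r x) (at x)"
      "((\<lambda>x. 2 * EllEi x q - EllF x q) has_real_derivative 2 * Delta q x - 1 / Delta q x) (at x)" for x
      by (intro derivative_intros has_real_derivative_EllEi has_real_derivative_EllF q r DERIV_cmult)+
    \<comment> \<open>The integrand 2 Delta - 1 / Delta increases with \<open>Delta\<close>, and
      \<open>Delta\<close> decreases as the modulus grows.\<close>
    fix x :: real assume x: "0 < x" "x < pi/2"
    have "sin x > 0" using x by (intro sin_gt_zero) auto
    then have "q\<^sup>2 * (sin x)\<^sup>2 < r\<^sup>2 * (sin x)\<^sup>2"
      using assms by (intro mult_strict_right_mono power_strict_mono) auto
    then have "(Delta r x)\<^sup>2 < (Delta q x)\<^sup>2"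
      by (simp add: Delta_square[OF q] Delta_square[OF r])
    then have "Delta r x < Delta q x"
      using Delta_pos[OF q, of x] by (meson less_imp_le power2_less_imp_less)
    moreover from this have "1 / Delta q x < 1 / Delta r x"
      using Delta_pos[OF r, of x] Delta_pos[OF q, of x] by (intro divide_strict_left_mono) auto
    ultimately show "2 * Delta r x - 1 / Delta r x < 2 * Delta q x - 1 / Delta q x" by simp
  qed auto
  then show ?thesis
    by (simp add: EllE_def EllK_def EllEi_0[OF q] EllF_0[OF q] EllEi_0[OF r] EllF_0[OF r])
qed

lemma continuous_on_EllE: "continuous_on {0..<1} EllE"
  and continuous_on_EllK: "continuous_on {0..<1} EllK"
proof -
  have ne: "1 - q\<^sup>2 * (sin x)\<^sup>2 \<noteq> 0" if "q \<in> {0..<1}" for q x :: real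
    using Delta_arg_pos[of q x] that by auto
  have "continuous_on {0..<1} (\<lambda>q. integral (cbox 0 (pi/2)) (\<lambda>\<theta>. sqrt (1 - q\<^sup>2 * (sin \<theta>)\<^sup>2)))"
    by (rule integral_continuous_on_param) (auto simp: case_prod_beta intro!: continuous_intros)
  then show "continuous_on {0..<1} EllE"
    by (rule continuous_on_cong[THEN iffD1, rotated -1]) (auto simp: EllE_def EllEi_def sint0_def)
  have "continuous_on {0..<1} (\<lambda>q. integral (cbox 0 (pi/2)) (\<lambda>\<theta>. 1 / sqrt (1 - q\<^sup>2 * (sin \<theta>)\<^sup>2)))"
    by (rule integral_continuous_on_param)
      (use ne in \<open>auto simp: case_prod_beta intro!: continuous_intros\<close>)
  then show "continuous_on {0..<1} EllK"
    by (rule continuous_on_cong[THEN iffD1, rotated -1]) (auto simp: EllK_def EllF_def sint0_def)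
qed

lemma EllK_unbounded:
  assumes "0 \<le> q0" "q0 < 1"
  shows "\<exists>q. q0 < q \<and> q < 1 \<and> B \<le> EllK q"
proof -
  \<comment> \<open>\<open>c\<close> is the complementary modulus of the witness \<open>q\<close>.
    Its first bound puts \<open>q\<close> above \<open>q0\<close>, the second makes the logarithmic
    lower bound for \<open>EllK q\<close> at least \<open>B\<close>.\<close>
  define c where "c = min (sqrt (1 - q0\<^sup>2) / 2) (pi/2 * exp (- B))"
  define q where "q = sqrt (1 - c\<^sup>2)"
  have s0: "0 < 1 - q0\<^sup>2" using q2_less_1[OF assms] by simp
  have c: "0 < c" "c \<le> sqrt (1 - q0\<^sup>2) / 2" "c \<le> pi/2 * exp (- B)"
    using s0 by (auto simp: c_def)
  have "c\<^sup>2 < (sqrt (1 - q0\<^sup>2))\<^sup>2"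
    using c s0 by (intro power_strict_mono) (auto intro: order.strict_trans1)
  then have c2: "c\<^sup>2 < 1 - q0\<^sup>2" using s0 by simp
  have q0: "q0 < q" unfolding q_def using assms c2 by (intro real_less_rsqrt) auto
  have q1: "q < 1" using c by (simp add: q_def)
  have q: "0 \<le> q" using q0 assms by simp
  have "c\<^sup>2 < 1" using c2 by (smt (verit) zero_le_power2)
  then have "sqrt (1 - q\<^sup>2) = c" using c by (simp add: q_def)
  then have K: "ln (1 + pi / (2 * c)) \<le> EllK q" using EllK_ge_ln[OF q q1] by simp
  have "exp B * (2 * c) \<le> exp B * (2 * (pi/2 * exp (- B)))" using c by (intro mult_left_mono) auto
  also have "\<dots> = pi" by (simp add: exp_minus field_simps)
  finally have "exp B \<le> pi / (2 * c)" using c by (simp add: pos_le_divide_eq)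
  then have "B \<le> ln (1 + pi / (2 * c))"
    using c by (subst ln_ge_iff) (auto intro!: add_pos_nonneg)
  with K q0 q1 show ?thesis by (intro exI[of _ q]) auto
qed

lemma q_star_unique: "\<exists>!q. 0 < q \<and> q < 1 \<and> 2 * EllE q - EllK q = 0"
proof (rule ex_ex1I)
  \<comment> \<open>Since \<open>EllE\<close> never exceeds pi/2, \<open>EllK b\<close> \<ge> pi is
    enough for a sign change between 0 and \<open>b\<close>.\<close>
  obtain b where b: "0 < b" "b < 1" "pi \<le> EllK b"
    using EllK_unbounded[of 0 pi] by auto
  have "EllE 0 = pi/2" "EllK 0 = pi/2"
    by (simp_all add: EllE_def EllEi_def EllK_def EllF_def sint0_def)
  moreover have "2 * EllE b - EllK b \<le> 0"
    using EllE_le_pi_half[of b] b by simp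
  moreover have "continuous_on {0..b} (\<lambda>q. 2 * EllE q - EllK q)"
    using b by (intro continuous_intros continuous_on_subset[OF continuous_on_EllE]
        continuous_on_subset[OF continuous_on_EllK]) auto
  ultimately obtain q where "0 \<le> q" "q \<le> b" "2 * EllE q - EllK q = 0"
    using IVT2'[of "\<lambda>q. 2 * EllE q - EllK q" b 0 0] b
    by (smt (verit) pi_half_ge_zero)
  moreover from this have "q \<noteq> 0" using \<open>EllE 0 = pi/2\<close> \<open>EllK 0 = pi/2\<close> by (auto simp: field_simps)
  ultimately show "\<exists>q. 0 < q \<and> q < 1 \<and> 2 * EllE q - EllK q = 0"
    using b by (intro exI[of _ q]) auto
next
  fix q r :: real
  assume "0 < q \<and> q < 1 \<and> 2 * EllE q - EllK q = 0" "0 < r \<and> r < 1 \<and> 2 * EllE r - EllK r = 0"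
  then show "q = r"
    using two_EllE_minus_EllK_strict_decreasing[of q r] two_EllE_minus_EllK_strict_decreasing[of r q]
    by (cases q r rule: linorder_cases) auto
qed

lemma q_star: "0 < q_star" "q_star < 1" "2 * EllE q_star = EllK q_star"
  using theI'[OF q_star_unique] unfolding q_star_def[symmetric] by auto

lemma two_EllE_less_EllK_iff:
  assumes "0 \<le> q" "q < 1"
  shows "2 * EllE q < EllK q \<longleftrightarrow> q_star < q" "2 * EllE q > EllK q \<longleftrightarrow> q < q_star"
  using two_EllE_minus_EllK_strict_decreasing[of q q_star]
    two_EllE_minus_EllK_strict_decreasing[of q_star q] q_star assms
  by (cases q q_star rule: linorder_cases; auto)+

text \<open>At q^2 = 1/2 the number 2 E - K equals 2 (E - (1 - q^2) K), which is positive; so the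
  zero lies further to the right. This makes the factor 2 q^2 - 1 of \<open>g_fun\<close> positive
  from \<open>q_star\<close> on.\<close>

lemma q_star_square_gt: "1/2 < q_star\<^sup>2"
proof -
  define q :: real where "q = sqrt (1/2)"
  have q: "0 \<le> q" "q < 1" and q2: "q\<^sup>2 = 1/2" by (auto simp: q_def)
  have "EllE q - (1 - q\<^sup>2) * EllK q > 0"
    using EllE_minus_EllK_ge[OF q] q2 by (smt (verit) pi_gt_zero divide_pos_pos mult_pos_pos)
  then have "q < q_star" using two_EllE_less_EllK_iff[OF q] q2 by simp
  then have "q\<^sup>2 < q_star\<^sup>2" using q by (intro power_strict_mono) auto
  then show ?thesis using q2 by simp
qed

text \<open>From \<open>q_star\<close> on, K - 2 E is nonnegative and increasing, and 2 q^2 - 1 is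
  positive and increasing.\<close>

lemma g_fun_strict_increasing:
  assumes "q_star \<le> q" "q < r" "r < 1"
  shows "g_fun q < g_fun r"
proof -
  have q: "0 \<le> q" and r: "0 \<le> r" "r < 1" using assms q_star by auto
  have D: "0 \<le> EllK q - 2 * EllE q" "EllK q - 2 * EllE q < EllK r - 2 * EllE r"
    using two_EllE_minus_EllK_strict_decreasing[of q r]
      two_EllE_less_EllK_iff[of q] assms q by fastforce+
  have "q_star\<^sup>2 \<le> q\<^sup>2" using assms q_star by (intro power_mono) auto
  then have w: "0 < 2 * q\<^sup>2 - 1" using q_star_square_gt by simp
  have "q\<^sup>2 < r\<^sup>2" using assms q by (intro power_strict_mono) auto
  then have "(EllK q - 2 * EllE q)\<^sup>2 * (2 * q\<^sup>2 - 1) \<le> (EllK q - 2 * EllE q)\<^sup>2 * (2 * r\<^sup>2 - 1)"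
    by (intro mult_left_mono) auto
  also have "\<dots> < (EllK r - 2 * EllE r)\<^sup>2 * (2 * r\<^sup>2 - 1)"
    using D w \<open>q\<^sup>2 < r\<^sup>2\<close> by (intro mult_strict_right_mono power_strict_mono) auto
  finally show ?thesis by (simp add: g_fun_def power2_commute[of "2 * _" "EllK _"])
qed

lemma q3_unique:
  assumes c: "0 < c"
  shows "\<exists>!q. q_star < q \<and> q < 1 \<and> g_fun q = c"
proof (rule ex_ex1I)
  have w0: "0 < 2 * q_star\<^sup>2 - 1" using q_star_square_gt by simp
  \<comment> \<open>\<open>B\<close> is the size of K - 2 E that would suffice for
    \<open>g_fun\<close> to reach \<open>c\<close> if the factor 2 q^2 - 1 kept its value at
    \<open>q_star\<close>. As E \<le> pi/2, this size is reached when K \<ge> pi + B.\<close>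
  define B where "B = sqrt (c / (8 * (2 * q_star\<^sup>2 - 1)))"
  have B: "0 \<le> B" "8 * B\<^sup>2 * (2 * q_star\<^sup>2 - 1) = c"
    using c w0 by (auto simp: B_def field_simps)
  obtain b where b: "q_star < b" "b < 1" "pi + B \<le> EllK b"
    using EllK_unbounded[of q_star "pi + B"] q_star by auto
  have b0: "0 \<le> b" using b q_star by simp
  have "EllK b - 2 * EllE b \<ge> B"
    using EllE_le_pi_half[OF b0 b(2)] b by simp
  then have "B\<^sup>2 \<le> (2 * EllE b - EllK b)\<^sup>2"
    using B by (subst power2_commute) (intro power_mono, auto)
  moreover have "q_star\<^sup>2 \<le> b\<^sup>2" using b q_star by (intro power_mono) auto
  ultimately have "B\<^sup>2 * (2 * q_star\<^sup>2 - 1) \<le> (2 * EllE b - EllK b)\<^sup>2 * (2 * b\<^sup>2 - 1)"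
    using w0 by (intro mult_mono) auto
  then have "c \<le> g_fun b" using B by (simp add: g_fun_def mult.assoc)
  moreover have "g_fun q_star = 0" by (simp add: g_fun_def q_star)
  moreover have "continuous_on {q_star..b} g_fun"
    unfolding g_fun_def[abs_def] using b q_star
    by (intro continuous_intros continuous_on_subset[OF continuous_on_EllE]
        continuous_on_subset[OF continuous_on_EllK]) auto
  ultimately obtain q where "q_star \<le> q" "q \<le> b" "g_fun q = c"
    using IVT'[of g_fun q_star c b] b c by auto
  moreover from this have "q \<noteq> q_star" using \<open>g_fun q_star = 0\<close> c by auto
  ultimately show "\<exists>q. q_star < q \<and> q < 1 \<and> g_fun q = c"
    using b by (intro exI[of _ q]) auto
next
  fix q r :: real
  assume "q_star < q \<and> q < 1 \<and> g_fun q = c" "q_star < r \<and> r < 1 \<and> g_fun r = c"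
  then show "q = r"
    using g_fun_strict_increasing[of q r] g_fun_strict_increasing[of r q]
    by (cases q r rule: linorder_cases) auto
qed

lemma q3_eqI: "q_star < q \<Longrightarrow> q < 1 \<Longrightarrow> g_fun q = c \<Longrightarrow> 0 < c \<Longrightarrow> q3 c = q"
  unfolding q3_def using q3_unique[of c] by (intro the1_equality) auto

lemma q3:
  assumes "0 < c"
  shows "q_star < q3 c" "q3 c < 1" "g_fun (q3 c) = c"
  using theI'[OF q3_unique[OF assms]] unfolding q3_def[symmetric] by auto

section \<open>Energies of wavelike elasticae\<close>

lemma d1_d2_eq:
  assumes "a < b"
    and 1: "\<And>x. x \<in> {a..b} \<Longrightarrow> (c has_vector_derivative c1 x) (at x within {a..b})"
    and 2: "\<And>x. x \<in> {a..b} \<Longrightarrow> (c1 has_vector_derivative c2 x) (at x within {a..b})"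
    and x: "x \<in> {a..b}"
  shows "d1 {a..b} c x = c1 x" "d2 {a..b} c x = c2 x"
proof -
  have eq: "vector_derivative c (at v within {a..b}) = c1 v" if "v \<in> {a..b}" for v
    by (rule vector_derivative_within_closed_interval[OF assms(1) that 1[OF that]])
  show "d1 {a..b} c x = c1 x" using eq[OF x] by (simp add: d1_def)
  have "((\<lambda>v. vector_derivative c (at v within {a..b})) has_vector_derivative c2 x) (at x within {a..b})"
    by (rule has_vector_derivative_transform[OF x _ 2[OF x]]) (simp add: eq)
  then show "d2 {a..b} c x = c2 x"
    unfolding d2_def by (rule vector_derivative_within_closed_interval[OF assms(1) x])
qed

text \<open>The energy of \<open>n\<close> consecutive arches of the elastica with curvature \<open>2 \<alpha> q cn(\<alpha> s - K(q), q)\<close>,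
  which is critical for \<open>lam = 2 \<alpha>\<^sup>2 (2 q\<^sup>2 - 1)\<close>.\<close>
definition arch_energy :: "real \<Rightarrow> real \<Rightarrow> real \<Rightarrow> real" where
  "arch_energy \<alpha> q n = 4 * \<alpha> * n * (2 * (EllE q - (1 - q\<^sup>2) * EllK q) + (2 * q\<^sup>2 - 1) * EllK q)"

text \<open>The definition of \<open>q3\<close> encodes criticality: substituting l = (2 / \<alpha>)
  (K - 2 E) into \<open>lam = 2 * \<alpha>\<^sup>2 * (2 * q\<^sup>2 - 1)\<close> gives
  \<open>g_fun q = lam * l\<^sup>2\<close>. The curve has unit speed because q^2 sn^2 = 1 - dn^2,
  and its curvature is 2 \<alpha> q cn over one full arch.\<close>

lemma loop_energy:
  assumes "0 < lam" "0 < l"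
  shows "elastic_energy lam 0 (loop_len lam l) (gamma_loop lam l) = arch_energy (loop_alpha lam l) (loop_q lam l) 1"
    and "lam = 2 * (loop_alpha lam l)\<^sup>2 * (2 * (loop_q lam l)\<^sup>2 - 1)"
    and "0 < loop_alpha lam l"
proof -
  define q where "q = loop_q lam l"
  define \<alpha> where "\<alpha> = loop_alpha lam l"
  define len where "len = 2 * EllK q / \<alpha>"
  have len_eq: "loop_len lam l = len" by (simp add: loop_len_def len_def q_def \<alpha>_def)
  have c: "0 < lam * l\<^sup>2" using assms by simp
  have q3': "q_star < q" "q < 1" "g_fun q = lam * l\<^sup>2"
    using q3[OF c] by (simp_all add: q_def loop_q_def)
  have q: "0 \<le> q" "q < 1" using q3' q_star by auto
  have D: "EllK q - 2 * EllE q > 0" using two_EllE_less_EllK_iff[OF q] q3' by simp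
  have \<alpha>_eq: "\<alpha> = 2 / l * (EllK q - 2 * EllE q)"
    by (simp add: \<alpha>_def loop_alpha_def q_def Let_def)
  show \<alpha>: "0 < loop_alpha lam l" using D assms by (simp add: \<alpha>_eq flip: \<alpha>_def)
  have "\<alpha>\<^sup>2 * l\<^sup>2 = 4 * (2 * EllE q - EllK q)\<^sup>2"
    using assms by (simp add: \<alpha>_eq power2_eq_square field_simps)
  then have "2 * (2 * q\<^sup>2 - 1) * (\<alpha>\<^sup>2 * l\<^sup>2) = lam * l\<^sup>2"
    using q3'(3) by (simp only: g_fun_def) (simp add: algebra_simps)
  then have "(2 * \<alpha>\<^sup>2 * (2 * q\<^sup>2 - 1)) * l\<^sup>2 = lam * l\<^sup>2"
    by (simp add: algebra_simps)
  then show lam: "lam = 2 * (loop_alpha lam l)\<^sup>2 * (2 * (loop_q lam l)\<^sup>2 - 1)"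
    using assms by (simp add: \<alpha>_def q_def)
  note \<alpha> = \<alpha>[folded \<alpha>_def]
  have len: "0 < len" using \<alpha> EllK_pos[OF q] by (simp add: len_def)
  define \<phi> where "\<phi> = (\<lambda>s. am (\<alpha> * s - EllK q) q)"
  define c where "c = gamma_loop lam l"
  have c_eq: "c = (\<lambda>s. ((1/\<alpha>) * (- 2 * EllEi (\<phi> s) q - 2 * EllE q + \<alpha> * s),
        (1/\<alpha>) * (2 * q * cos (\<phi> s))))"
    by (simp add: fun_eq_iff c_def gamma_loop_def Let_def cn_def \<phi>_def flip: q_def \<alpha>_def)
  define S C D where "S = (\<lambda>s. sin (\<phi> s))" and "C = (\<lambda>s. cos (\<phi> s))" and "D = (\<lambda>s. Delta q (\<phi> s))"
  have D2: "(D s)\<^sup>2 = 1 - q\<^sup>2 * (S s)\<^sup>2" for s by (simp add: D_def S_def Delta_square[OF q])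
  note amp = amplitude_derivatives[OF q \<phi>_def]
  define c1 where "c1 = (\<lambda>s. (1 - 2 * (D s)\<^sup>2, - 2 * q * S s * D s))"
  define c2 where "c2 = (\<lambda>s. (4 * \<alpha> * q\<^sup>2 * S s * C s * D s, - 2 * q * \<alpha> * C s * (2 * (D s)\<^sup>2 - 1)))"
  have "(c has_vector_derivative c1 s) (at s)" for s
    unfolding c_eq c1_def
    by (intro has_vector_derivative_Pair)
      (use \<alpha> in \<open>auto intro!: derivative_eq_intros amp(1,2)
        simp: has_real_derivative_iff_has_vector_derivative[symmetric] D_def S_def field_simps\<close>)
  then have 1: "(c has_vector_derivative c1 s) (at s within T)" for s T
    by (rule has_vector_derivative_at_within)
  have "(c1 has_vector_derivative c2 s) (at s)" for s
  proof -
    have "1 - 2 * (q\<^sup>2 * (S s)\<^sup>2) = 2 * (D s)\<^sup>2 - 1" using D2[of s] by simp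
    then have "((\<lambda>s. S s * D s) has_real_derivative \<alpha> * C s * (2 * (D s)\<^sup>2 - 1)) (at s)"
      using amp(6)[of s] by (simp only: S_def C_def D_def)
    from DERIV_cmult[OF this, of "-2 * q"]
    have "((\<lambda>s. -2 * q * S s * D s) has_real_derivative - 2 * q * \<alpha> * C s * (2 * (D s)\<^sup>2 - 1)) (at s)"
      by (simp add: algebra_simps)
    moreover have "((\<lambda>s. 1 - 2 * (D s)\<^sup>2) has_real_derivative 4 * \<alpha> * q\<^sup>2 * S s * C s * D s) (at s)"
      unfolding S_def C_def D_def by (auto intro!: derivative_eq_intros amp(5))
    ultimately show ?thesis
      unfolding c1_def c2_def
      by (intro has_vector_derivative_Pair) (simp_all add: has_real_derivative_iff_has_vector_derivative[symmetric])
  qed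
  then have 2: "(c1 has_vector_derivative c2 s) (at s within T)" for s T
    by (rule has_vector_derivative_at_within)
  note d = d1_d2_eq[OF len 1 2]
  have n1: "norm (c1 s) = 1" for s
  proof -
    have "(1 - 2 * (D s)\<^sup>2)\<^sup>2 + (- 2 * q * S s * D s)\<^sup>2 = (1 - 2 * (D s)\<^sup>2)\<^sup>2 + 4 * (q\<^sup>2 * (S s)\<^sup>2) * (D s)\<^sup>2"
      by (simp add: power_mult_distrib)
    also have "q\<^sup>2 * (S s)\<^sup>2 = 1 - (D s)\<^sup>2" using D2[of s] by simp
    also have "(1 - 2 * (D s)\<^sup>2)\<^sup>2 + 4 * (1 - (D s)\<^sup>2) * (D s)\<^sup>2 = 1"
      by (simp add: power2_eq_square algebra_simps)
    finally show ?thesis by (simp add: c1_def norm_Pair)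
  qed
  have curv: "signed_curv {0..len} c s = 2 * q * \<alpha> * C s" if "s \<in> {0..len}" for s
  proof -
    have "fst (c1 s) * snd (c2 s) - snd (c1 s) * fst (c2 s)
      = 2 * q * \<alpha> * C s * ((2 * (D s)\<^sup>2 - 1)\<^sup>2 + 4 * (q\<^sup>2 * (S s)\<^sup>2) * (D s)\<^sup>2)"
      by (simp add: c1_def c2_def power2_eq_square algebra_simps)
    also have "q\<^sup>2 * (S s)\<^sup>2 = 1 - (D s)\<^sup>2" using D2[of s] by simp
    also have "(2 * (D s)\<^sup>2 - 1)\<^sup>2 + 4 * (1 - (D s)\<^sup>2) * (D s)\<^sup>2 = 1"
      by (simp add: power2_eq_square algebra_simps)
    finally show ?thesis using that by (simp add: signed_curv_def d n1)
  qed
  have "((\<lambda>s. (signed_curv {0..len} c s)\<^sup>2 * norm (d1 {0..len} c s)) has_integral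
     (4 * \<alpha> * (EllEi (\<phi> len) q - (1 - q\<^sup>2) * (\<alpha> * len - EllK q))
      - 4 * \<alpha> * (EllEi (\<phi> 0) q - (1 - q\<^sup>2) * (\<alpha> * 0 - EllK q)))) {0..len}"
  proof (rule fundamental_theorem_of_calculus)
    fix s assume s: "s \<in> {0..len}"
    \<comment> \<open>The square of dn integrates to the incomplete integral of the second kind, so
      writing q^2 cn^2 as dn^2 - (1 - q^2) yields a primitive.\<close>
    have C2: "q\<^sup>2 * (C s)\<^sup>2 = (D s)\<^sup>2 - (1 - q\<^sup>2)"
      by (simp add: D2 C_def S_def cos_squared_eq algebra_simps)
    have "((\<lambda>s. 4 * \<alpha> * (EllEi (\<phi> s) q - (1 - q\<^sup>2) * (\<alpha> * s - EllK q))) has_real_derivative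
       4 * \<alpha> * (\<alpha> * (D s)\<^sup>2 - (1 - q\<^sup>2) * \<alpha>)) (at s)"
      unfolding D_def by (rule DERIV_cong[OF DERIV_cmult[OF DERIV_diff[OF amp(2) DERIV_cmult[where D=\<alpha>]]]])
        (auto intro!: derivative_eq_intros)
    also have "4 * \<alpha> * (\<alpha> * (D s)\<^sup>2 - (1 - q\<^sup>2) * \<alpha>) = 4 * \<alpha>\<^sup>2 * (q\<^sup>2 * (C s)\<^sup>2)"
      unfolding C2 by (simp add: power2_eq_square algebra_simps)
    also have "\<dots> = (signed_curv {0..len} c s)\<^sup>2 * norm (d1 {0..len} c s)"
      using s by (simp add: curv d n1 power_mult_distrib)
    finally show "((\<lambda>s. 4 * \<alpha> * (EllEi (\<phi> s) q - (1 - q\<^sup>2) * (\<alpha> * s - EllK q))) has_vector_derivative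
      (signed_curv {0..len} c s)\<^sup>2 * norm (d1 {0..len} c s)) (at s within {0..len})"
      by (simp add: has_real_derivative_iff_has_vector_derivative has_vector_derivative_at_within)
  qed (use len in simp)
  moreover have "\<phi> len = pi/2"
  proof -
    have "\<alpha> * len - EllK q = EllF (pi/2) q" using \<alpha> by (simp add: len_def EllK_def)
    then show ?thesis by (simp add: \<phi>_def am_EllF[OF q])
  qed
  moreover note amp(7)
  moreover have "\<alpha> * len = 2 * EllK q" using \<alpha> by (simp add: len_def)
  ultimately have I1: "integral {0..len} (\<lambda>s. (signed_curv {0..len} c s)\<^sup>2 * norm (d1 {0..len} c s))
     = 8 * \<alpha> * (EllE q - (1 - q\<^sup>2) * EllK q)"
    by (simp add: has_integral_iff EllEi_minus[OF q] algebra_simps flip: EllE_def)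
  have "integral {0..len} (\<lambda>u. norm (d1 {0..len} c u)) = integral {0..len} (\<lambda>u. 1)"
    by (intro integral_cong) (simp add: d n1)
  then have I2: "curve_length 0 len c = len" using len by (simp add: curve_length_def)
  have "lam * len = 4 * \<alpha> * (2 * q\<^sup>2 - 1) * EllK q"
    using \<alpha> unfolding lam[folded q_def \<alpha>_def] by (simp add: len_def power2_eq_square)
  then have "elastic_energy lam 0 len c = arch_energy \<alpha> q 1"
    unfolding elastic_energy_def I1 I2 arch_energy_def by (simp add: algebra_simps)
  then show "elastic_energy lam 0 (loop_len lam l) (gamma_loop lam l) = arch_energy (loop_alpha lam l) (loop_q lam l) 1"
    by (simp add: len_eq c_def \<alpha>_def q_def)
qed

text \<open>With w = sqrt (2 q^2 - 1), the excess over lam l is 4 \<alpha> n times 2 (E - (1 - q^2)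
  K) + w^2 (K - |2 E - K|), while sqrt lam = sqrt 2 \<alpha> w. The sum is at least (1 + w^2) q^2
  pi/2, where q^2 = (1 + w^2) / 2. Hence two arches reach 4 pi sqrt lam as soon as 2 sqrt 2 w \<le>
  (1 + w^2)^2.\<close>

lemma multi_arch_energy_ge:
  assumes q: "0 \<le> q" "q < 1" and w: "1/2 < q\<^sup>2" and \<alpha>: "0 < \<alpha>" and n: "2 \<le> n"
    and lam: "lam = 2 * \<alpha>\<^sup>2 * (2 * q\<^sup>2 - 1)"
    and l: "l = 2 * n / \<alpha> * \<bar>2 * EllE q - EllK q\<bar>"
  shows "lam * l + 4 * pi * sqrt lam \<le> arch_energy \<alpha> q n"
proof -
  define w where "w = sqrt (2 * q\<^sup>2 - 1)"
  have w: "w > 0" "w\<^sup>2 = 2 * q\<^sup>2 - 1" using w by (auto simp: w_def)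
  have q2: "q\<^sup>2 = (1 + w\<^sup>2) / 2" using w by simp
  have sq: "sqrt lam = sqrt 2 * \<alpha> * w"
    using \<alpha> by (simp add: lam real_sqrt_mult w_def)
  have "lam = 2 * \<alpha>\<^sup>2 * w\<^sup>2" by (simp add: lam w)
  then have laml: "lam * l = 4 * n * \<alpha> * w\<^sup>2 * \<bar>2 * EllE q - EllK q\<bar>"
    using \<alpha> by (simp add: l power2_eq_square)
  \<comment> \<open>If 2 E \<ge> K, the left side is 2 (K - E). Otherwise it is 2 E, which is at
    least 2 and so exceeds pi/2.\<close>
  have "EllK q - \<bar>2 * EllE q - EllK q\<bar> \<ge> q\<^sup>2 * (pi/2)"
  proof (cases "2 * EllE q - EllK q \<ge> 0")
    case True
    then show ?thesis using EllK_minus_EllE_ge[OF q] by simp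
  next
    case False
    have "q\<^sup>2 * (pi/2) \<le> 1 * (pi/2)" using q2_less_1[OF q] by (intro mult_right_mono) auto
    also have "\<dots> \<le> 2 * EllE q" using EllE_ge_1[OF q] pi_less_4 by simp
    finally show ?thesis using False by simp
  qed
  then have "w\<^sup>2 * (q\<^sup>2 * (pi/2)) \<le> w\<^sup>2 * (EllK q - \<bar>2 * EllE q - EllK q\<bar>)"
    by (intro mult_left_mono) auto
  then have A: "q\<^sup>2 * (pi/2) + w\<^sup>2 * (q\<^sup>2 * (pi/2))
      \<le> 2 * (EllE q - (1 - q\<^sup>2) * EllK q) + w\<^sup>2 * (EllK q - \<bar>2 * EllE q - EllK q\<bar>)"
    using EllE_minus_EllK_ge[OF q] by simp
  \<comment> \<open>A sum of squares for (1 + w^2)^2 - 3 w. The number 9/16 is close to the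
    minimiser, 1/3 is close to its square, and the remainder 8/9 - 27/32 is positive.\<close>
  have "0 \<le> (w\<^sup>2 - 1/3)\<^sup>2 + 8/3 * (w - 9/16)\<^sup>2 + (8/9 - 27/32)" by simp
  then have "3 * w \<le> (1 + w\<^sup>2)\<^sup>2" by (simp add: power2_eq_square algebra_simps)
  moreover have "2 * sqrt 2 * w \<le> 3 * w"
  proof (rule mult_right_mono)
    show "2 * sqrt 2 \<le> 3" 
      by (rule power2_le_imp_le) (auto simp: power_mult_distrib)
  qed (use w in simp)
  ultimately have "pi/2 * (2 * sqrt 2 * w) \<le> pi/2 * (1 + w\<^sup>2)\<^sup>2" by (intro mult_left_mono) auto
  also have "\<dots> = 2 * (q\<^sup>2 * (pi/2) + w\<^sup>2 * (q\<^sup>2 * (pi/2)))" unfolding q2 by (simp add: power2_eq_square algebra_simps add_divide_distrib)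
  also have "\<dots> \<le> n * (q\<^sup>2 * (pi/2) + w\<^sup>2 * (q\<^sup>2 * (pi/2)))"
    by (rule mult_right_mono[OF n]) auto
  also have "\<dots> \<le> n * (2 * (EllE q - (1 - q\<^sup>2) * EllK q) + w\<^sup>2 * (EllK q - \<bar>2 * EllE q - EllK q\<bar>))"
    using n A by (intro mult_left_mono) auto
  finally have "4 * \<alpha> * (pi * (sqrt 2 * w)) \<le>
    4 * \<alpha> * (n * (2 * (EllE q - (1 - q\<^sup>2) * EllK q) + w\<^sup>2 * (EllK q - \<bar>2 * EllE q - EllK q\<bar>)))"
    using \<alpha> by (intro mult_left_mono) auto
  then show ?thesis
    unfolding arch_energy_def sq laml w(2)[symmetric] by (simp add: algebra_simps)
qed

text \<open>For the loop K > 2 E, so replacing (1 - w^2) K by the smaller (1 - w^2) 2 E bounds the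
  excess over lam l by 16 \<alpha> w^2 E. By \<open>EllE_le\<close>, w E is at most pi/2 times sqrt
  (1/2), and the excess is at most 4 pi sqrt lam, the threshold that two arches reach.\<close>

lemma loop_energy_le:
  assumes "0 < lam" "0 < l"
  shows "elastic_energy lam 0 (loop_len lam l) (gamma_loop lam l) \<le> lam * l + 4 * pi * sqrt lam"
proof -
  define q where "q = loop_q lam l"
  define \<alpha> where "\<alpha> = loop_alpha lam l"
  note le = loop_energy[OF assms, folded q_def \<alpha>_def]
  have c: "0 < lam * l\<^sup>2" using assms by simp
  have q3': "q_star < q" "q < 1" "g_fun q = lam * l\<^sup>2"
    using q3[OF c] by (simp_all add: q_def loop_q_def)
  have q: "0 \<le> q" "q < 1" using q3' q_star by auto
  have D: "EllK q - 2 * EllE q > 0" using two_EllE_less_EllK_iff[OF q] q3' by simp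
  define w where "w = sqrt (2 * q\<^sup>2 - 1)"
  have "q_star\<^sup>2 < q\<^sup>2" using q3' q_star by (intro power_strict_mono) auto
  then have w: "w > 0" "w\<^sup>2 = 2 * q\<^sup>2 - 1" using q_star_square_gt by (auto simp: w_def)
  have q2: "q\<^sup>2 = (1 + w\<^sup>2) / 2" using w by simp
  have w1: "w\<^sup>2 < 1" using q2_less_1[OF q] w by simp
  have sq: "sqrt lam = sqrt 2 * \<alpha> * w"
    using le(3) by (subst le(2)) (simp add: real_sqrt_mult w_def)
  have \<alpha>_eq: "\<alpha> = 2 / l * (EllK q - 2 * EllE q)"
    by (simp add: \<alpha>_def loop_alpha_def q_def Let_def)
  have "\<alpha> * l = 2 * (EllK q - 2 * EllE q)" using assms by (simp add: \<alpha>_eq)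
  then have "2 * \<alpha> * w\<^sup>2 * (\<alpha> * l) = 4 * \<alpha> * w\<^sup>2 * (EllK q - 2 * EllE q)"
    by simp
  then have laml: "lam * l = 4 * \<alpha> * w\<^sup>2 * (EllK q - 2 * EllE q)"
    unfolding le(2)[folded w(2)] by (simp add: power2_eq_square[of \<alpha>] mult_ac)
  \<comment> \<open>In terms of w, the defect from 1/2 factors as (1 - w^2) (2 - w^2) / 4; it
    vanishes only in the limit q = 1.\<close>
  have "(w * sqrt (1 - q\<^sup>2/2))\<^sup>2 = w\<^sup>2 * (1 - q\<^sup>2/2)"
    using q2_less_1[OF q] by (simp add: power_mult_distrib)
  also have "\<dots> = 1/2 - (1 - w\<^sup>2) * (2 - w\<^sup>2) / 4" unfolding q2 by (simp add: power2_eq_square field_simps)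
  also have "\<dots> \<le> 1/2" using w1 by simp
  finally have "w * sqrt (1 - q\<^sup>2/2) \<le> sqrt (1/2)" by (rule real_le_rsqrt)
  moreover have "w * EllE q \<le> w * (pi/2 * sqrt (1 - q\<^sup>2/2))"
    using w EllE_le[OF q] by (intro mult_left_mono) auto
  moreover have "w * (pi/2 * sqrt (1 - q\<^sup>2/2)) \<le> pi/2 * sqrt (1/2)"
    using mult_left_mono[OF calculation(1), of "pi/2"] by (simp add: algebra_simps)
  ultimately have "4 * (w * EllE q) \<le> 2 * pi * sqrt (1/2)" by linarith
  also have "\<dots> = pi * sqrt 2" by (simp add: real_sqrt_divide real_div_sqrt field_simps)
  finally have "w * (4 * (w * EllE q)) \<le> w * (pi * sqrt 2)" using w by (intro mult_left_mono) auto
  moreover have "(1 - w\<^sup>2) * (2 * EllE q) \<le> (1 - w\<^sup>2) * EllK q" using w1 D by (intro mult_left_mono) auto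
  moreover have "2 * (EllE q - (1 - q\<^sup>2) * EllK q) = 2 * EllE q - (1 - w\<^sup>2) * EllK q"
    by (simp add: q2 algebra_simps)
  ultimately have "2 * (EllE q - (1 - q\<^sup>2) * EllK q) + w\<^sup>2 * EllK q
     \<le> w\<^sup>2 * (EllK q - 2 * EllE q) + sqrt 2 * pi * w"
    by (simp add: algebra_simps power2_eq_square)
  then have "4 * \<alpha> * (2 * (EllE q - (1 - q\<^sup>2) * EllK q) + w\<^sup>2 * EllK q)
     \<le> 4 * \<alpha> * (w\<^sup>2 * (EllK q - 2 * EllE q) + sqrt 2 * pi * w)"
    using le(3) by (intro mult_left_mono) auto
  then show ?thesis
    unfolding le(1) arch_energy_def laml sq w(2)[symmetric] by (simp add: algebra_simps)
qed

section \<open>Classification of pinned elasticae\<close>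

lemma nonincreasing_within_Icc:
  fixes f :: "real \<Rightarrow> real"
  assumes d: "\<And>x. x \<in> {a..b} \<Longrightarrow> (f has_real_derivative f' x) (at x within {a..b})"
    and "\<And>x. x \<in> {a<..<b} \<Longrightarrow> f' x \<le> 0" and "a \<le> x" "x \<le> y" "y \<le> b"
  shows "f y \<le> f x"
proof (cases "x < y")
  case True
  show ?thesis
  proof (rule DERIV_nonpos_imp_decreasing_open[OF less_imp_le[OF True]])
    fix z assume z: "x < z" "z < y"
    then have "(f has_real_derivative f' z) (at z)"
      using d[of z] assms(3-5) at_within_Icc_at[of a z b] by auto
    then show "\<exists>d. (f has_real_derivative d) (at z) \<and> d \<le> 0"
      using assms z by (intro exI[of _ "f' z"]) auto
  next
    show "continuous_on {x..y} f"
      using assms by (intro continuous_on_subset[OF DERIV_continuous_on[OF d]]) auto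
  qed
next
  case False
  then show ?thesis using assms by (cases "x = y") auto
qed

lemma gronwall_zero:
  fixes y :: "real \<Rightarrow> real"
  assumes d: "\<And>x. x \<in> {0..1} \<Longrightarrow> (y has_real_derivative y' x) (at x within {0..1})"
    and "\<And>x. x \<in> {0..1} \<Longrightarrow> y' x \<le> C * y x" "y 0 = 0" "\<And>x. 0 \<le> y x" "x \<in> {0..1}"
  shows "y x = 0"
proof -
  have "y x * exp (- C * x) \<le> y 0 * exp (- C * 0)"
  proof (rule nonincreasing_within_Icc[where f="\<lambda>x. y x * exp (- C * x)" and x=0 and y=x and f'="\<lambda>x. (y' x - C * y x) * exp (- C * x)" and a=0 and b=1])
    show "((\<lambda>x. y x * exp (- C * x)) has_real_derivative (y' x - C * y x) * exp (- C * x)) (at x within {0..1})"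
      if "x \<in> {0..1}" for x using that
      by (auto intro!: derivative_eq_intros d[OF that] simp: algebra_simps)
    show "(y' x - C * y x) * exp (- C * x) \<le> 0" if "x \<in> {0<..<1}" for x :: real
      using that assms(2)[of x] by (intro mult_nonpos_nonneg) auto
  qed (use assms in auto)
  then have "y x \<le> 0" using assms(3) by (simp add: mult_le_0_iff)
  with assms(4)[of x] show ?thesis by simp
qed

text \<open>The elastica equation 2 k'' + k^3 = lam k in arclength, as a system of first order on
  the unit interval traversed with speed L. Gronwall is applied to the squared distance of two
  solutions; the cubic term is Lipschitz only on bounded sets, whence the common bound
  \<open>B\<close>.\<close>

lemma elastica_ode_unique:
  fixes k1 k2 p1 p2 :: "real \<Rightarrow> real"
  assumes L: "0 < L" and lam: "0 < lam"
    and k1: "\<And>x. x \<in> {0..1} \<Longrightarrow> (k1 has_real_derivative L * p1 x) (at x within {0..1})"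
    and p1: "\<And>x. x \<in> {0..1} \<Longrightarrow> (p1 has_real_derivative L * ((lam * k1 x - k1 x ^ 3) / 2)) (at x within {0..1})"
    and k2: "\<And>x. x \<in> {0..1} \<Longrightarrow> (k2 has_real_derivative L * p2 x) (at x within {0..1})"
    and p2: "\<And>x. x \<in> {0..1} \<Longrightarrow> (p2 has_real_derivative L * ((lam * k2 x - k2 x ^ 3) / 2)) (at x within {0..1})"
    and init: "k1 0 = k2 0" "p1 0 = p2 0" and x: "x \<in> {0..1}"
  shows "k1 x = k2 x"
proof -
  have "compact (k1 ` {0..1})" "compact (k2 ` {0..1})"
    by (auto intro!: compact_continuous_image DERIV_continuous_on k1 k2)
  then obtain B1 B2 where "\<forall>x\<in>{0..1}. \<bar>k1 x\<bar> \<le> B1" "\<forall>x\<in>{0..1}. \<bar>k2 x\<bar> \<le> B2"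
    by (auto dest!: compact_imp_bounded simp: bounded_iff)
  then obtain B where B: "\<And>x. x \<in> {0..1} \<Longrightarrow> \<bar>k1 x\<bar> \<le> B" "\<And>x. x \<in> {0..1} \<Longrightarrow> \<bar>k2 x\<bar> \<le> B"
    by (metis max.coboundedI1 max.coboundedI2)
  define y where "y = (\<lambda>x. (k1 x - k2 x)\<^sup>2 + (p1 x - p2 x)\<^sup>2)"
  define Q where "Q = (\<lambda>x. (k1 x)\<^sup>2 + k1 x * k2 x + (k2 x)\<^sup>2)"
  have "y x = 0"
  proof (rule gronwall_zero[of y _ "L + L * (lam + 3 * B\<^sup>2) / 2"])
    fix x :: real assume x: "x \<in> {0..1}"
    have cube: "k1 x ^ 3 - k2 x ^ 3 = (k1 x - k2 x) * Q x"
      by (simp add: Q_def power2_eq_square power3_eq_cube algebra_simps)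
    show "(y has_real_derivative (2 * L + L * (lam - Q x)) * ((k1 x - k2 x) * (p1 x - p2 x))) (at x within {0..1})"
      unfolding y_def
      by (rule derivative_eq_intros k1[OF x] p1[OF x] k2[OF x] p2[OF x] refl)+
        (use cube in \<open>simp add: field_simps; algebra\<close>)
    have "\<bar>(k1 x)\<^sup>2\<bar> \<le> B\<^sup>2" "\<bar>(k2 x)\<^sup>2\<bar> \<le> B\<^sup>2"
      using B[OF x] power_mono[of "\<bar>k1 x\<bar>" B 2] power_mono[of "\<bar>k2 x\<bar>" B 2] by auto
    moreover have "\<bar>k1 x * k2 x\<bar> \<le> B\<^sup>2"
      using B[OF x] by (simp add: abs_mult power2_eq_square mult_mono)
    ultimately have Q: "\<bar>Q x\<bar> \<le> 3 * B\<^sup>2" unfolding Q_def by linarith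
    have "(2 * L + L * (lam - Q x)) * ((k1 x - k2 x) * (p1 x - p2 x))
      \<le> \<bar>2 * L + L * (lam - Q x)\<bar> * (\<bar>k1 x - k2 x\<bar> * \<bar>p1 x - p2 x\<bar>)"
      by (simp flip: abs_mult)
    also have "\<dots> \<le> (2 * L + L * (lam + 3 * B\<^sup>2)) * (((k1 x - k2 x)\<^sup>2 + (p1 x - p2 x)\<^sup>2) / 2)"
    proof (rule mult_mono)
      have "\<bar>lam - Q x\<bar> \<le> lam + 3 * B\<^sup>2" using Q lam by linarith
      then have "L * \<bar>lam - Q x\<bar> \<le> L * (lam + 3 * B\<^sup>2)" using L by (intro mult_left_mono) auto
      then show "\<bar>2 * L + L * (lam - Q x)\<bar> \<le> 2 * L + L * (lam + 3 * B\<^sup>2)"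
        using L abs_triangle_ineq[of "2 * L" "L * (lam - Q x)"] unfolding abs_mult by linarith
      have "0 \<le> (\<bar>k1 x - k2 x\<bar> - \<bar>p1 x - p2 x\<bar>)\<^sup>2" by simp
      then show "\<bar>k1 x - k2 x\<bar> * \<bar>p1 x - p2 x\<bar> \<le> ((k1 x - k2 x)\<^sup>2 + (p1 x - p2 x)\<^sup>2) / 2"
        by (simp add: power2_diff)
    qed (use L lam in auto)
    also have "\<dots> = (L + L * (lam + 3 * B\<^sup>2) / 2) * y x" by (simp add: y_def field_simps)
    finally show "(2 * L + L * (lam - Q x)) * ((k1 x - k2 x) * (p1 x - p2 x))
      \<le> (L + L * (lam + 3 * B\<^sup>2) / 2) * y x" .
  qed (use init x in \<open>auto simp: y_def\<close>)
  then show ?thesis by (simp add: y_def sum_power2_eq_zero_iff)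
qed

text \<open>The integrand is (1 - 2 q^2 sin^2) / Delta, which changes sign at most once on the
  quarter period, from positive to negative. So the function can only rise and afterwards fall to
  its final value 2 E - K, which is positive. Geometrically, the first coordinate of an arch,
  measured from its apex, has the sign of the amplitude.\<close>

lemma two_EllEi_minus_EllF_pos:
  assumes q: "0 \<le> q" "q < 1" and pos: "EllK q < 2 * EllE q" and x: "0 < x" "x \<le> pi/2"
  shows "0 < 2 * EllEi x q - EllF x q"
proof (cases "x = pi/2")
  case True
  then show ?thesis using pos unfolding EllE_def EllK_def True by simp
next
  case False
  then have x: "0 < x" "x < pi/2" using x by auto
  have d: "((\<lambda>x. 2 * EllEi x q - EllF x q) has_real_derivative 2 * Delta q y - 1 / Delta q y) (at y)" for y
    by (intro derivative_intros has_real_derivative_EllEi has_real_derivative_EllF q DERIV_cmult)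
  have e: "2 * Delta q y - 1 / Delta q y = (1 - 2 * q\<^sup>2 * (sin y)\<^sup>2) / Delta q y" for y
    using Delta_pos[OF q, of y] Delta_square[OF q, of y]
    by (simp add: field_simps power2_eq_square)
  show ?thesis
  proof (cases "2 * q\<^sup>2 * (sin x)\<^sup>2 \<le> 1")
    case True
    have "(\<lambda>x. 0) x - (\<lambda>x. 0::real) 0 < (2 * EllEi x q - EllF x q) - (2 * EllEi 0 q - EllF 0 q)"
    proof (rule increment_less[OF x(1) DERIV_const d])
      fix y assume y: "0 < y" "y < x"
      have "sin y < sin x" using x y by (intro sin_monotone_2pi) auto
      then have "(sin y)\<^sup>2 < (sin x)\<^sup>2"
        using x y by (intro power_strict_mono sin_ge_zero) auto
      then have "2 * q\<^sup>2 * (sin y)\<^sup>2 < 1"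
        using True q by (cases "q = 0") (auto intro: less_le_trans[OF mult_strict_left_mono])
      then show "0 < 2 * Delta q y - 1 / Delta q y"
        using Delta_pos[OF q, of y] by (simp add: e)
    qed
    then show ?thesis by (simp add: EllEi_0[OF q] EllF_0[OF q])
  next
    case False
    have "(2 * EllEi (pi/2) q - EllF (pi/2) q) - (2 * EllEi x q - EllF x q) \<le> (\<lambda>x. 0) (pi/2) - (\<lambda>x. 0::real) x"
    proof (rule increment_le[OF less_imp_le[OF x(2)] d DERIV_const])
      fix y assume y: "x < y" "y < pi/2"
      have "sin x < sin y" using x y by (intro sin_monotone_2pi) auto
      then have "(sin x)\<^sup>2 \<le> (sin y)\<^sup>2"
        using x y by (intro power_mono sin_ge_zero) auto
      then have "2 * q\<^sup>2 * (sin x)\<^sup>2 \<le> 2 * q\<^sup>2 * (sin y)\<^sup>2" by (intro mult_left_mono) auto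
      then show "2 * Delta q y - 1 / Delta q y \<le> 0"
        using False Delta_pos[OF q, of y] by (simp add: e divide_le_0_iff)
    qed
    then show ?thesis using pos by (simp add: EllE_def EllK_def)
  qed
qed

lemma has_vector_derivative_Complex:
  "(f has_real_derivative f') (at x within S) \<Longrightarrow> (g has_real_derivative g') (at x within S) \<Longrightarrow>
    ((\<lambda>x. Complex (f x) (g x)) has_vector_derivative Complex f' g') (at x within S)"
  by (simp add: has_vector_derivative_complex_iff)

lemma has_vector_derivative_cis:
  assumes "(\<theta> has_real_derivative \<theta>') (at x within S)"
  shows "((\<lambda>x. cis (\<theta> x)) has_vector_derivative (\<i> * of_real \<theta>' * cis (\<theta> x))) (at x within S)"
proof -
  have "((\<lambda>x. Complex (cos (\<theta> x)) (sin (\<theta> x))) has_vector_derivative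
      Complex (- sin (\<theta> x) * \<theta>') (cos (\<theta> x) * \<theta>')) (at x within S)"
    by (rule has_vector_derivative_Complex)
      (auto intro!: derivative_eq_intros assms simp: mult.commute)
  also have "Complex (- sin (\<theta> x) * \<theta>') (cos (\<theta> x) * \<theta>') = \<i> * of_real \<theta>' * cis (\<theta> x)"
    by (simp add: complex_eq_iff)
  finally show ?thesis by (simp add: cis.code)
qed

text \<open>Since k vanishes at 0, uniqueness leaves the slope \<open>p 0\<close> as the only
  parameter of the curvature, and it suffices to exhibit a solution for every nonzero slope.
  Tangent, curve, end point distance and energy are then explicit. The direction at the start is not
  prescribed and is carried along as a rotation \<open>c0\<close>.\<close>

lemma elastica_embedded:
  fixes \<theta> k p :: "real \<Rightarrow> real"
  assumes L: "0 < L" and lam: "0 < lam" and l: "0 < l"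
    and d\<theta>: "\<And>x. x \<in> {0..1} \<Longrightarrow> (\<theta> has_real_derivative L * k x) (at x within {0..1})"
    and dk: "\<And>x. x \<in> {0..1} \<Longrightarrow> (k has_real_derivative L * p x) (at x within {0..1})"
    and dp: "\<And>x. x \<in> {0..1} \<Longrightarrow> (p has_real_derivative L * ((lam * k x - k x ^ 3) / 2)) (at x within {0..1})"
    and k0: "k 0 = 0" and k1: "k 1 = 0"
    and end1: "integral {0..1} (\<lambda>x. of_real L * cis (\<theta> x)) = of_real l"
    and energy: "L * integral {0..1} (\<lambda>x. (k x)\<^sup>2) + lam * L
      < elastic_energy lam 0 (loop_len lam l) (gamma_loop lam l)"
  shows "inj_on (\<lambda>x. integral {0..x} (\<lambda>y. of_real L * cis (\<theta> y))) {0..1}"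
proof (cases "p 0 = 0")
  case True
  have k: "k x = 0" if "x \<in> {0..1}" for x
    using elastica_ode_unique[OF L lam dk dp, of "\<lambda>_. 0" "\<lambda>_. 0" x] True k0 that by auto
  have "(\<theta> has_vector_derivative 0) (at x within {0..1})" if "x \<in> {0..1}" for x
    using d\<theta>[OF that] k[OF that] by (simp add: has_real_derivative_iff_has_vector_derivative)
  then obtain c where c: "\<theta> x = c" if "x \<in> {0..1}" for x
    using has_vector_derivative_zero_constant[of "{0..1}" \<theta>] by auto

  have "integral {0..x} (\<lambda>y. of_real L * cis (\<theta> y)) = integral {0..x} (\<lambda>y. of_real L * cis c)"
    if "x \<in> {0..1}" for x using that by (intro integral_cong) (simp add: c)
  then have "integral {0..x} (\<lambda>y. of_real L * cis (\<theta> y)) = of_real x * (of_real L * cis c)"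
    if "x \<in> {0..1}" for x using that by (auto simp: scaleR_conv_of_real)
  then show ?thesis using L by (auto simp: inj_on_def)
next
  case False
  define \<epsilon> where "\<epsilon> = sgn (p 0)"
  have \<epsilon>: "\<epsilon>\<^sup>2 = 1" "\<epsilon> \<noteq> 0" "\<epsilon> * \<bar>p 0\<bar> = p 0" using False by (auto simp: \<epsilon>_def sgn_if)
  \<comment> \<open>The curvature 2 \<alpha> q cn requires lam = 2 \<alpha>^2 (2 q^2 - 1) and has
    initial slope of size 2 \<alpha>^2 q sqrt (1 - q^2). Then lam^2 plus four times the squared
    slope is 4 \<alpha>^4, which determines \<alpha> and afterwards q. The sign \<epsilon> accounts
    for reflections.\<close>
  define \<alpha> where "\<alpha> = sqrt (sqrt (lam\<^sup>2 + 4 * (p 0)\<^sup>2) / 2)"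
  define q where "q = sqrt ((1 + lam / (2 * \<alpha>\<^sup>2)) / 2)"
  have "lam < sqrt (lam\<^sup>2 + 4 * (p 0)\<^sup>2)" using False lam by (intro real_less_rsqrt) auto
  then have \<alpha>2: "2 * \<alpha>\<^sup>2 = sqrt (lam\<^sup>2 + 4 * (p 0)\<^sup>2)" "lam < 2 * \<alpha>\<^sup>2" and \<alpha>: "0 < \<alpha>"
    using lam by (auto simp: \<alpha>_def intro!: add_pos_nonneg)
  have q2: "q\<^sup>2 = (1 + lam / (2 * \<alpha>\<^sup>2)) / 2" using lam \<alpha> by (simp add: q_def)
  have lam_eq: "lam = 2 * \<alpha>\<^sup>2 * (2 * q\<^sup>2 - 1)" using \<alpha> by (simp add: q2 field_simps)
  have q: "0 \<le> q" "q < 1"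
  proof -
    show "0 \<le> q" using lam by (simp add: q_def)
    have "lam / (2 * \<alpha>\<^sup>2) < 1" using \<alpha>2(2) \<alpha> by (subst pos_divide_less_eq) auto
    then show "q < 1" by (simp add: q_def)
  qed
  have q12: "1/2 < q\<^sup>2" using lam \<alpha> by (simp add: q2)
  then have q0: "q \<noteq> 0" by auto
  have p0: "\<bar>p 0\<bar> = 2 * \<alpha>\<^sup>2 * q * sqrt (1 - q\<^sup>2)"
  proof -
    have "(2 * \<alpha>\<^sup>2)\<^sup>2 = lam\<^sup>2 + 4 * (p 0)\<^sup>2" unfolding \<alpha>2(1) by simp
    then have "(p 0)\<^sup>2 = (2 * \<alpha>\<^sup>2 * q)\<^sup>2 * (1 - q\<^sup>2)"
      unfolding lam_eq by (simp add: power2_eq_square algebra_simps)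
    also have "\<dots> = (2 * \<alpha>\<^sup>2 * q * sqrt (1 - q\<^sup>2))\<^sup>2"
      using q2_less_1[OF q] by (simp add: power_mult_distrib)
    finally have "sqrt ((p 0)\<^sup>2) = sqrt ((2 * \<alpha>\<^sup>2 * q * sqrt (1 - q\<^sup>2))\<^sup>2)" by simp
    then have "\<bar>p 0\<bar> = \<bar>2 * \<alpha>\<^sup>2 * q * sqrt (1 - q\<^sup>2)\<bar>" by (simp only: real_sqrt_abs)
    then show ?thesis using q q2_less_1[OF q] by simp
  qed
  define K E where "K = EllK q" and "E = EllE q"
  define \<phi> where "\<phi> = (\<lambda>x. am (\<alpha> * L * x - K) q)"
  define S C D where "S = (\<lambda>x. sin (\<phi> x))" and "C = (\<lambda>x. cos (\<phi> x))" and "D = (\<lambda>x. Delta q (\<phi> x))"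
  have F\<phi>: "EllF (\<phi> x) q = \<alpha> * L * x - K" for x by (simp add: \<phi>_def EllF_am[OF q])
  have D2: "(D s)\<^sup>2 = 1 - q\<^sup>2 * (S s)\<^sup>2" for s by (simp add: D_def S_def Delta_square[OF q])
  note amp = amplitude_derivatives[OF q \<phi>_def[unfolded K_def]]
  note \<phi>0 = amp(7)
  have dE: "((\<lambda>s. EllEi (\<phi> s) q) has_real_derivative \<alpha> * L * (D s)\<^sup>2) (at s)"
    and dS: "(S has_real_derivative \<alpha> * L * C s * D s) (at s)"
    and dC: "(C has_real_derivative - (\<alpha> * L) * S s * D s) (at s)"
    and dSD: "((\<lambda>s. S s * D s) has_real_derivative \<alpha> * L * C s * (1 - 2 * (q\<^sup>2 * (S s)\<^sup>2))) (at s)" for s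
    unfolding S_def C_def D_def by (rule amp(2) amp(3) amp(4) amp(6))+
  have init: "S 0 = -1" "C 0 = 0" "D 0 = sqrt (1 - q\<^sup>2)"
    by (simp_all add: S_def C_def D_def Delta_def \<phi>0 del: minus_divide_left)
  define kk where "kk = (\<lambda>x. 2 * \<epsilon> * \<alpha> * q * C x)"
  define pp where "pp = (\<lambda>x. - 2 * \<epsilon> * \<alpha>\<^sup>2 * q * (S x * D x))"
  have k_eq: "k x = kk x" if "x \<in> {0..1}" for x
  proof (rule elastica_ode_unique[OF L lam dk dp, where ?p2.0 = pp])
    fix x
    have "(kk has_real_derivative 2 * \<epsilon> * \<alpha> * q * (- (\<alpha> * L) * S x * D x)) (at x)"
      unfolding kk_def by (rule DERIV_cmult[OF dC])
    then show "(kk has_real_derivative L * pp x) (at x within {0..1})"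
      by (rule DERIV_cong[OF has_field_derivative_at_within]) (simp add: pp_def power2_eq_square)
    have "(pp has_real_derivative - 2 * \<epsilon> * \<alpha>\<^sup>2 * q * (\<alpha> * L * C x * (1 - 2 * (q\<^sup>2 * (S x)\<^sup>2)))) (at x)"
      unfolding pp_def by (rule DERIV_cmult[OF dSD])
    moreover have "- 2 * \<epsilon> * \<alpha>\<^sup>2 * q * (\<alpha> * L * C x * (1 - 2 * (q\<^sup>2 * (S x)\<^sup>2))) = L * ((lam * kk x - kk x ^ 3) / 2)"
    proof -
      have e3: "\<epsilon> ^ 3 = \<epsilon>" using \<epsilon>(1) by (simp add: power3_eq_cube power2_eq_square)
      have C3: "C x ^ 3 = C x * (1 - (S x)\<^sup>2)"
        unfolding S_def C_def sin_squared_eq by (simp add: power2_eq_square power3_eq_cube)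
      have k3: "kk x ^ 3 = 8 * \<epsilon> * \<alpha> ^ 3 * q ^ 3 * (C x * (1 - (S x)\<^sup>2))"
        by (simp add: kk_def power_mult_distrib e3 C3)
      show ?thesis
        unfolding lam_eq k3 by (simp add: kk_def power2_eq_square power3_eq_cube algebra_simps)
    qed
    ultimately show "(pp has_real_derivative L * ((lam * kk x - kk x ^ 3) / 2)) (at x within {0..1})"
      by (metis has_field_derivative_at_within)
  next
    have "p 0 = \<epsilon> * (2 * \<alpha>\<^sup>2 * q * sqrt (1 - q\<^sup>2))" using p0 \<epsilon>(3) by simp
    then show "p 0 = pp 0" by (simp add: pp_def init)
  qed (use that k0 in \<open>auto simp: kk_def init\<close>)
  \<comment> \<open>\<open>T\<close> turns at the rate L k, as does \<open>cis (\<theta> x)\<close>,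
    so the two differ by a constant factor \<open>c0\<close> of modulus one. Such a rotation changes
    neither the distance of the ends nor injectivity.\<close>
  define T where "T = (\<lambda>x. Complex (1 - 2 * (q\<^sup>2 * (S x)\<^sup>2)) (2 * \<epsilon> * q * (S x * D x)))"
  have dT: "(T has_vector_derivative \<i> * of_real (L * kk x) * T x) (at x within A)" for x A
  proof -
    have a: "((\<lambda>x. 1 - 2 * (q\<^sup>2 * (S x)\<^sup>2)) has_real_derivative - (L * kk x) * (2 * \<epsilon> * q * (S x * D x))) (at x within A)"
      by (rule has_field_derivative_at_within)
        (auto intro!: derivative_eq_intros dS simp: kk_def \<epsilon>(1) power2_eq_square[of \<epsilon>, symmetric] algebra_simps,
          use \<epsilon>(1) in \<open>simp add: power2_eq_square\<close>)
    have b: "((\<lambda>x. 2 * \<epsilon> * q * (S x * D x)) has_real_derivative (L * kk x) * (1 - 2 * (q\<^sup>2 * (S x)\<^sup>2))) (at x within A)"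
      by (rule has_field_derivative_at_within, rule DERIV_cong[OF DERIV_cmult[OF dSD]])
        (simp add: kk_def)
    show ?thesis unfolding T_def
      by (rule has_vector_derivative_eq_rhs[OF has_vector_derivative_Complex[OF a b]])
        (simp add: complex_eq_iff)
  qed
  have T1: "T x * cnj (T x) = 1" for x
  proof -
    have "(1 - 2 * (q\<^sup>2 * (S x)\<^sup>2))\<^sup>2 + (2 * \<epsilon> * q * (S x * D x))\<^sup>2
      = (1 - 2 * (q\<^sup>2 * (S x)\<^sup>2))\<^sup>2 + 4 * (q\<^sup>2 * (S x)\<^sup>2) * (D x)\<^sup>2"
      by (simp add: power_mult_distrib \<epsilon>)
    also have "\<dots> = 1" unfolding D2 by (simp add: power2_eq_square algebra_simps)
    finally show ?thesis by (simp add: T_def complex_mult_cnj)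
  qed
  have "((\<lambda>x. cis (\<theta> x) * cnj (T x)) has_vector_derivative 0) (at x within {0..1})" if x: "x \<in> {0..1}" for x
    by (rule has_vector_derivative_eq_rhs[OF has_vector_derivative_mult[OF
        has_vector_derivative_cis[OF d\<theta>[OF x]] has_vector_derivative_cnj[OF dT]]])
      (simp add: k_eq[OF x] algebra_simps)
  then obtain c0 where c0: "cis (\<theta> x) * cnj (T x) = c0" if "x \<in> {0..1}" for x
    using has_vector_derivative_zero_constant[of "{0..1}" "\<lambda>x. cis (\<theta> x) * cnj (T x)"] by auto
  have cis_eq: "cis (\<theta> x) = c0 * T x" if "x \<in> {0..1}" for x
    using c0[OF that] T1[of x] by (metis mult.assoc mult.commute mult.right_neutral)
  have "norm (T x) = 1" for x
    using T1[of x] by (metis complex_mod_mult_cnj norm_one power2_eq_1_iff norm_ge_zero zero_le_one abs_of_nonneg real_sqrt_abs real_sqrt_one)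
  then have c0_1: "norm c0 = 1" using cis_eq[of 0] by (metis norm_cis norm_mult mult.right_neutral atLeastAtMost_iff order_refl zero_le_one)
  define G where "G = (\<lambda>x. Complex ((2 * EllEi (\<phi> x) q - (\<alpha> * L * x - K)) / \<alpha>) (- (2 * \<epsilon> * q / \<alpha>) * C x))"
  have dG: "(G has_vector_derivative of_real L * T x) (at x within A)" for x A
  proof -
    have a: "((\<lambda>x. (2 * EllEi (\<phi> x) q - (\<alpha> * L * x - K)) / \<alpha>) has_real_derivative
        (2 * (\<alpha> * L * (D x)\<^sup>2) - \<alpha> * L) / \<alpha>) (at x within A)"
      by (rule has_field_derivative_at_within, rule DERIV_cdivide, rule DERIV_diff, rule DERIV_cmult[OF dE])
        (auto intro!: derivative_eq_intros)
    have b: "((\<lambda>x. - (2 * \<epsilon> * q / \<alpha>) * C x) has_real_derivative - (2 * \<epsilon> * q / \<alpha>) * (- (\<alpha> * L) * S x * D x)) (at x within A)"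
      by (rule has_field_derivative_at_within) (rule DERIV_cmult[OF dC])
    show ?thesis unfolding G_def
      by (rule has_vector_derivative_eq_rhs[OF has_vector_derivative_Complex[OF a b]])
        (use \<alpha> in \<open>simp add: complex_eq_iff T_def D2 field_simps\<close>)
  qed
  have int: "integral {0..x} (\<lambda>y. of_real L * cis (\<theta> y)) = c0 * (G x - G 0)" if x: "x \<in> {0..1}" for x
  proof -
    have "((\<lambda>y. c0 * (of_real L * T y)) has_integral c0 * (G x - G 0)) {0..x}"
      by (rule has_integral_mult_right, rule fundamental_theorem_of_calculus) (use x dG in auto)
    then have "((\<lambda>y. of_real L * cis (\<theta> y)) has_integral c0 * (G x - G 0)) {0..x}"
      by (rule has_integral_eq[rotated]) (use x cis_eq in auto)
    then show ?thesis by blast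
  qed
  \<comment> \<open>The condition k = 0 at the far end makes the final amplitude an odd multiple of
    pi/2. It lies above the initial value -pi/2, so it is n pi - pi/2 with n \<ge> 1, and n counts
    the arches.\<close>
  have "cos (\<phi> 1) = 0" using k_eq[of 1] k1 \<alpha> q0 \<epsilon> by (simp add: kk_def C_def)
  then obtain i where i: "odd i" "\<phi> 1 = of_int i * (pi/2)" by (auto simp: cos_zero_iff_int)
  have "EllF (\<phi> 0) q < EllF (\<phi> 1) q" unfolding F\<phi> using \<alpha> L by simp
  then have "\<phi> 0 < \<phi> 1" by (simp add: EllF_less_iff[OF q])
  then have "0 < (of_int i + 1) * pi" unfolding \<phi>0 i(2) by (simp add: algebra_simps)
  then have "- 1 < real_of_int i" by (simp add: zero_less_mult_iff)
  then have "- 1 < i" by linarith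
  obtain j where j: "i = 2 * j + 1" using i(1) by (rule oddE)
  obtain n :: nat where n: "1 \<le> n" "i = 2 * int n - 1"
    using that[of "nat (j + 1)"] j \<open>- 1 < i\<close> by simp
  have \<phi>1: "\<phi> 1 = real n * pi - pi/2" unfolding i(2) n(2) by (simp add: algebra_simps)
  have \<alpha>L: "\<alpha> * L = 2 * n * K"
    using F\<phi>[of 1] unfolding \<phi>1 EllF_odd_multiple[OF q] by (simp add: K_def algebra_simps)
  have E0: "EllEi (\<phi> 0) q = - E" and E1: "EllEi (\<phi> 1) q = (2 * real n - 1) * E"
    unfolding \<phi>0 \<phi>1 EllEi_odd_multiple[OF q] by (simp_all add: E_def EllE_def EllEi_minus[OF q] del: minus_divide_left)
  have "cmod (G 1 - G 0) = l"
  proof -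
    have "cmod (c0 * (G 1 - G 0)) = l" using int[of 1] end1 l by simp
    then show ?thesis by (simp add: norm_mult c0_1)
  qed
  \<comment> \<open>This number is real but of either sign, and \<open>c0\<close> can absorb the
    sign; hence the absolute value in the formula for \<open>l\<close>.\<close>
  moreover have "G 1 - G 0 = of_real (2 * real n / \<alpha> * (2 * E - K))"
  proof -
    have "C 1 = 0" using \<open>cos (\<phi> 1) = 0\<close> by (simp add: C_def)
    then show ?thesis using \<alpha>
      unfolding G_def E0 E1 mult_1_right \<alpha>L init by (simp add: complex_eq_iff field_simps)
  qed
  ultimately have l_eq: "l = 2 * real n / \<alpha> * \<bar>2 * E - K\<bar>"
    using \<alpha> by (simp only: norm_of_real abs_mult) simp
  have "((\<lambda>x. L * (k x)\<^sup>2) has_integral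
      (4 * \<alpha> * (EllEi (\<phi> 1) q - (1 - q\<^sup>2) * (\<alpha> * L * 1 - K)) - 4 * \<alpha> * (EllEi (\<phi> 0) q - (1 - q\<^sup>2) * (\<alpha> * L * 0 - K)))) {0..1}"
  proof (rule fundamental_theorem_of_calculus)
    fix x :: real assume x: "x \<in> {0..1}"
    have "((\<lambda>x. 4 * \<alpha> * (EllEi (\<phi> x) q - (1 - q\<^sup>2) * (\<alpha> * L * x - K))) has_real_derivative
        4 * \<alpha> * (\<alpha> * L * (D x)\<^sup>2 - (1 - q\<^sup>2) * (\<alpha> * L))) (at x)"
      by (rule DERIV_cmult[OF DERIV_diff[OF dE DERIV_cmult]]) (auto intro!: derivative_eq_intros)
    also have "4 * \<alpha> * (\<alpha> * L * (D x)\<^sup>2 - (1 - q\<^sup>2) * (\<alpha> * L)) = 4 * \<alpha>\<^sup>2 * L * q\<^sup>2 * (1 - (S x)\<^sup>2)"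
      unfolding D2 by (simp add: power2_eq_square algebra_simps)
    also have "\<dots> = L * (k x)\<^sup>2"
      unfolding k_eq[OF x] kk_def by (simp add: power_mult_distrib \<epsilon> S_def C_def cos_squared_eq)
    finally show "((\<lambda>x. 4 * \<alpha> * (EllEi (\<phi> x) q - (1 - q\<^sup>2) * (\<alpha> * L * x - K))) has_vector_derivative L * (k x)\<^sup>2) (at x within {0..1})"
      by (simp add: has_real_derivative_iff_has_vector_derivative has_vector_derivative_at_within)
  qed simp
  then have I: "L * integral {0..1} (\<lambda>x. (k x)\<^sup>2) = 4 * \<alpha> * n * (2 * (E - (1 - q\<^sup>2) * K))"
    unfolding E0 E1 mult_1_right \<alpha>L by (simp add: has_integral_iff algebra_simps)
  have "lam * L = 2 * \<alpha> * (2 * q\<^sup>2 - 1) * (\<alpha> * L)" unfolding lam_eq by (simp add: power2_eq_square)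
  then have lamL: "lam * L = 4 * \<alpha> * n * ((2 * q\<^sup>2 - 1) * K)" unfolding \<alpha>L by simp
  have less: "arch_energy \<alpha> q n < elastic_energy lam 0 (loop_len lam l) (gamma_loop lam l)"
    using energy unfolding I lamL arch_energy_def E_def K_def by (simp add: algebra_simps)
  have n1: "n = 1"
  proof (rule ccontr)
    assume "n \<noteq> 1"
    with n have "2 \<le> real n" by simp
    from multi_arch_energy_ge[OF q q12 \<alpha> this lam_eq l_eq[unfolded E_def K_def]] loop_energy_le[OF lam l] less
    show False by simp
  qed
  have not_loop: "\<not> 2 * E < K"
  proof
    assume *: "2 * E < K"
    then have qs: "q_star < q" using two_EllE_less_EllK_iff[OF q] by (simp add: E_def K_def)
    have l2: "l = 2 / \<alpha> * (K - 2 * E)" using * l_eq n1 by simp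
    \<comment> \<open>Uniqueness of \<open>q3\<close> turns this equation into equality of modulus
      and scale with those of the loop, whose energy is not less than itself.\<close>
    have "lam * l\<^sup>2 = g_fun q"
      unfolding lam_eq l2 g_fun_def using \<alpha> by (simp add: E_def K_def power2_eq_square field_simps)
    then have "loop_q lam l = q"
      using q3_eqI[OF qs q(2), of "lam * l\<^sup>2"] mult_pos_pos[OF lam zero_less_power[OF l, of 2]]
      by (simp add: loop_q_def)
    moreover from this have "loop_alpha lam l = \<alpha>"
    proof -
      have "loop_alpha lam l = 2 / l * (K - 2 * E)"
        using \<open>loop_q lam l = q\<close> by (simp add: loop_alpha_def Let_def E_def K_def)
      then have "l * loop_alpha lam l = 2 * (K - 2 * E)" using l by simp
      moreover have "l * \<alpha> = 2 * (K - 2 * E)" using \<alpha> by (simp add: l2)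
      ultimately have "l * loop_alpha lam l = l * \<alpha>" by simp
      then show ?thesis using l by simp
    qed
    ultimately show False using less loop_energy(1)[OF lam l] n1 by simp
  qed
  have "2 * E \<noteq> K" using l l_eq by auto
  with not_loop have pos: "K < 2 * E" by simp
  show ?thesis
  proof (rule inj_onI)
    fix x y :: real
    assume x: "x \<in> {0..1}" and y: "y \<in> {0..1}"
      and eq: "integral {0..x} (\<lambda>y. of_real L * cis (\<theta> y)) = integral {0..y} (\<lambda>y. of_real L * cis (\<theta> y))"
    have "c0 \<noteq> 0" using c0_1 by auto
    then have G: "G x = G y" using eq unfolding int[OF x] int[OF y] by simp
    \<comment> \<open>\<open>M\<close> at the amplitude is \<alpha> times the first coordinate of
      the unrotated arch. Equal second coordinates mean equal cosines, hence amplitudes equal up to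
      sign; \<open>M\<close> is odd and positive on positive amplitudes, so it decides the
      sign.\<close>
    define M where "M = (\<lambda>\<phi>. 2 * EllEi \<phi> q - EllF \<phi> q)"
    have M: "M (\<phi> x) = M (\<phi> y)" and "C x = C y"
      using G \<alpha> q0 \<epsilon> by (simp_all add: G_def M_def F\<phi>)
    have bnd: "\<bar>\<phi> z\<bar> \<le> pi/2" if z: "z \<in> {0..1}" for z
    proof -
      have "\<not> EllF (\<phi> z) q < EllF (\<phi> 0) q" "\<not> EllF (\<phi> 1) q < EllF (\<phi> z) q"
        unfolding F\<phi> using \<alpha> L z by (auto simp: not_less mult_left_le)
      then have "\<not> \<phi> z < \<phi> 0" "\<not> \<phi> 1 < \<phi> z" by (simp_all add: EllF_less_iff[OF q])
      then show ?thesis using \<phi>0 \<phi>1 n1 by (simp add: abs_le_iff)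
    qed
    have "cos \<bar>\<phi> x\<bar> = cos \<bar>\<phi> y\<bar>" using \<open>C x = C y\<close> by (simp add: C_def)
    then have abs: "\<bar>\<phi> x\<bar> = \<bar>\<phi> y\<bar>"
      using cos_inj_pi[of "\<bar>\<phi> x\<bar>" "\<bar>\<phi> y\<bar>"] bnd[OF x] bnd[OF y] by simp
    have M_odd: "M (- z) = - M z" for z by (simp add: M_def EllEi_minus[OF q] EllF_minus[OF q])
    have M_pos: "0 < M z" if "0 < z" "z \<le> pi/2" for z
      unfolding M_def using pos that by (intro two_EllEi_minus_EllF_pos[OF q]) (auto simp: E_def K_def)
    have "\<phi> x = \<phi> y"
      using abs M M_odd[of "\<phi> y"] M_odd[of "\<phi> x"] M_pos[of "\<phi> x"] M_pos[of "\<phi> y"] bnd[OF x] bnd[OF y]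
      by (smt (verit))
    then have "\<alpha> * L * x - K = \<alpha> * L * y - K" by (metis F\<phi>)
    then show "x = y" using \<alpha> L by simp
  qed
qed

section \<open>Compactness\<close>

lemma has_integral_increment:
  fixes F :: "real \<Rightarrow> 'a::banach"
  assumes d: "\<And>x. x \<in> {0..1} \<Longrightarrow> (F has_vector_derivative F' x) (at x within {0..1})"
    and xy: "0 \<le> x" "x \<le> y" "y \<le> 1"
  shows "(F' has_integral F y - F x) {x..y}"
proof (rule fundamental_theorem_of_calculus[OF xy(2)])
  have sub: "{x..y} \<subseteq> {0..1}" using xy by auto
  show "(F has_vector_derivative F' z) (at z within {x..y})" if "z \<in> {x..y}" for z
    using has_vector_derivative_within_subset[OF d sub, of z] sub that by auto
qed

lemma integral_nonneg_continuous:
  fixes f :: "real \<Rightarrow> real"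
  shows "continuous_on {a..b} f \<Longrightarrow> (\<And>x. x \<in> {a..b} \<Longrightarrow> 0 \<le> f x) \<Longrightarrow> 0 \<le> integral {a..b} f"
  by (rule Henstock_Kurzweil_Integration.integral_nonneg[OF integrable_continuous_real])

lemma increment_bound_within_Icc:
  fixes F :: "real \<Rightarrow> real"
  assumes d: "\<And>x. x \<in> {0..1} \<Longrightarrow> (F has_real_derivative F' x) (at x within {0..1})"
    and F': "continuous_on {0..1} F'" and h: "continuous_on {0..1} h"
    and le: "\<And>x. x \<in> {0..1} \<Longrightarrow> \<bar>F' x\<bar> \<le> h x"
    and xy: "0 \<le> x" "x \<le> y" "y \<le> 1"
  shows "\<bar>F y - F x\<bar> \<le> integral {x..y} h"
proof -
  have sub: "{x..y} \<subseteq> {0..1}" using xy by auto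
  have "F y - F x = integral {x..y} F'"
    using has_integral_increment[OF d[unfolded has_real_derivative_iff_has_vector_derivative] xy]
    by (simp add: has_integral_iff)
  moreover have "norm (integral {x..y} F') \<le> integral {x..y} h"
    by (rule integral_norm_bound_integral)
      (use le xy continuous_on_subset[OF F' sub] continuous_on_subset[OF h sub] in
        \<open>auto intro!: integrable_continuous_real\<close>)
  ultimately show ?thesis by simp
qed

lemma integral_subinterval_le:
  fixes h :: "real \<Rightarrow> real"
  assumes h: "continuous_on {0..1} h" "\<And>x. x \<in> {0..1} \<Longrightarrow> 0 \<le> h x"
    and xy: "0 \<le> x" "y \<le> 1"
  shows "integral {x..y} h \<le> integral {0..1} h"
proof (rule integral_subset_le)
  show "{x..y} \<subseteq> {0..1}" using xy by auto
  then show "h integrable_on {x..y}" "h integrable_on {0..1}"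
    using continuous_on_subset[OF h(1)] h(1) by (auto intro!: integrable_continuous_real)
qed (use h in auto)

lemma increment_bound_total:
  fixes F :: "real \<Rightarrow> real"
  assumes d: "\<And>x. x \<in> {0..1} \<Longrightarrow> (F has_real_derivative F' x) (at x within {0..1})"
    and F': "continuous_on {0..1} F'" and h: "continuous_on {0..1} h"
    and le: "\<And>x. x \<in> {0..1} \<Longrightarrow> \<bar>F' x\<bar> \<le> h x"
    and xy: "x \<in> {0..1}" "y \<in> {0..1}"
  shows "\<bar>F y - F x\<bar> \<le> integral {0..1} h"
proof -
  have *: "\<bar>F y - F x\<bar> \<le> integral {0..1} h" if "0 \<le> x" "x \<le> y" "y \<le> 1" for x y
    using increment_bound_within_Icc[OF d F' h le that]
      integral_subinterval_le[OF h order_trans[OF abs_ge_zero le] that(1,3)] by simp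
  show ?thesis using *[of x y] *[of y x] xy by (cases "x \<le> y") auto
qed

lemma uniform_limit_constants:
  "c \<longlonglongrightarrow> l \<Longrightarrow> uniform_limit X (\<lambda>n x. c n) (\<lambda>x. l) sequentially"
  by (simp add: uniform_limit_iff tendsto_iff)

lemma uniform_limit_mult_continuous:
  fixes f g :: "nat \<Rightarrow> real \<Rightarrow> 'a::real_normed_algebra"
  assumes "uniform_limit {a..b} f l sequentially" "uniform_limit {a..b} g m sequentially"
    and "continuous_on {a..b} l" "continuous_on {a..b} m"
  shows "uniform_limit {a..b} (\<lambda>n x. f n x * g n x) (\<lambda>x. l x * m x) sequentially"
  using assms by (intro uniform_lim_mult compact_imp_bounded compact_continuous_image) auto

lemma uniform_limit_integral_lower:
  fixes g :: "nat \<Rightarrow> real \<Rightarrow> 'a::banach"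
  assumes u: "uniform_limit {0..1} g h sequentially"
    and c: "\<And>n. continuous_on {0..1} (g n)" "continuous_on {0..1} h"
  shows "uniform_limit {0..1} (\<lambda>n x. integral {0..x} (g n)) (\<lambda>x. integral {0..x} h) sequentially"
proof (rule uniform_limitI)
  fix e :: real assume e: "0 < e"
  show "\<forall>\<^sub>F n in sequentially. \<forall>x\<in>{0..1}. dist (integral {0..x} (g n)) (integral {0..x} h) < e"
    using uniform_limitD[OF u half_gt_zero[OF e]]
  proof eventually_elim
    case (elim n)
    show ?case
    proof
      fix x :: real assume x: "x \<in> {0..1}"
      have sub: "{0..x} \<subseteq> {0..1}" using x by auto
      have i: "g n integrable_on {0..x}" "h integrable_on {0..x}"
        using continuous_on_subset[OF c(1) sub] continuous_on_subset[OF c(2) sub]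
        by (auto intro!: integrable_continuous_real)
      have "norm (integral {0..x} (\<lambda>y. g n y - h y)) \<le> integral {0..x} (\<lambda>y. e/2)"
        by (rule integral_norm_bound_integral)
          (use elim sub i in \<open>auto intro!: integrable_diff simp: dist_norm intro: less_imp_le\<close>)
      also have "\<dots> = x * (e/2)" using x by simp
      also have "\<dots> \<le> 1 * (e/2)" using x e by (intro mult_right_mono) auto
      also have "\<dots> < e" using e by simp
      finally show "dist (integral {0..x} (g n)) (integral {0..x} h) < e"
        by (simp add: dist_norm integral_diff[OF i])
    qed
  qed
qed

text \<open>Cauchy-Schwarz in the form |w| \<le> (\<delta> + w^2 / \<delta>) / 2. The free weight
  \<delta> takes the place of the square root of an integral.\<close>

lemma integral_abs_le:
  fixes w :: "real \<Rightarrow> real"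
  assumes "continuous_on {x..y} w" "0 < \<delta>" "x \<le> y"
  shows "integral {x..y} (\<lambda>t. \<bar>w t\<bar>) \<le> (\<delta> * (y - x) + integral {x..y} (\<lambda>t. (w t)\<^sup>2) / \<delta>) / 2"
proof -
  have pt: "\<bar>w t\<bar> \<le> (\<delta> + (w t)\<^sup>2 / \<delta>) / 2" for t
  proof -
    have "0 \<le> (\<delta> - \<bar>w t\<bar>)\<^sup>2" by simp
    then have "\<bar>w t\<bar> * (2 * \<delta>) \<le> \<delta>\<^sup>2 + (w t)\<^sup>2" by (simp add: power2_diff algebra_simps)
    then show ?thesis using assms(2) by (simp add: field_simps power2_eq_square)
  qed
  have i: "(\<lambda>t. (w t)\<^sup>2 / \<delta>) integrable_on {x..y}"
    using assms by (intro integrable_continuous_real continuous_intros) auto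
  have "integral {x..y} (\<lambda>t. \<bar>w t\<bar>) \<le> integral {x..y} (\<lambda>t. (\<delta> + (w t)\<^sup>2 / \<delta>) / 2)"
    using assms pt by (intro integral_le integrable_continuous_real continuous_intros) auto
  also have "\<dots> = (\<delta> * (y - x) + integral {x..y} (\<lambda>t. (w t)\<^sup>2) / \<delta>) / 2"
    using assms integral_add[OF integrable_const_ivl[of \<delta> x y] i] by simp
  finally show ?thesis .
qed

lemma norm_cis_diff_le: "cmod (cis a - cis b) \<le> \<bar>a - b\<bar>"
proof -
  have "cmod (cis a - cis b) = cmod (cis b * (cis (a - b) - 1))"
    by (simp add: algebra_simps cis_mult)
  also have "\<dots> = cmod (cis (a - b) - 1)" by (simp add: norm_mult)
  also have "\<dots> = 2 * \<bar>sin ((a - b) / 2)\<bar>"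
  proof -
    define t where "t = (a - b) / 2"
    have "(cmod (cis (2 * t) - 1))\<^sup>2 = (cos (2 * t) - 1)\<^sup>2 + (sin (2 * t))\<^sup>2"
      by (simp add: cmod_power2)
    also have "\<dots> = 2 - 2 * cos (2 * t)"
      using sin_cos_squared_add[of "2 * t"] by (simp add: power2_diff)
    also have "\<dots> = (2 * \<bar>sin t\<bar>)\<^sup>2"
      unfolding cos_double_sin by (simp add: power_mult_distrib)
    finally have "cmod (cis (2 * t) - 1) = 2 * \<bar>sin t\<bar>"
      by (rule power2_eq_imp_eq) auto
    moreover have "2 * t = a - b" by (simp add: t_def)
    ultimately show ?thesis unfolding t_def by argo
  qed
  also have "\<dots> \<le> \<bar>a - b\<bar>" using abs_sin_x_le_abs_x[of "(a - b) / 2"] by simp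
  finally show ?thesis .
qed

lemma uniform_limit_cis:
  assumes "uniform_limit X f g F"
  shows "uniform_limit X (\<lambda>n x. cis (f n x)) (\<lambda>x. cis (g x)) F"
proof (rule uniform_limitI)
  fix e :: real assume "0 < e"
  from uniform_limitD[OF assms this]
  show "\<forall>\<^sub>F n in F. \<forall>x\<in>X. dist (cis (f n x)) (cis (g x)) < e"
    by eventually_elim (auto simp: dist_norm intro: le_less_trans[OF norm_cis_diff_le])
qed

text \<open>An L2 bound on the derivative makes the functions equicontinuous, so the Arzela-Ascoli
  theorem applies. The lengths are packed with the angles into one function, and a single extraction
  serves both. The statement is used for angles with their curvatures, and also for curvatures with
  their derivatives.\<close>

lemma angle_compactness:
  fixes L :: "nat \<Rightarrow> real" and \<theta> k :: "nat \<Rightarrow> real \<Rightarrow> real"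
  assumes L: "\<And>n. 0 < L n" "\<And>n. L n \<le> Lm"
    and d\<theta>: "\<And>n x. x \<in> {0..1} \<Longrightarrow> (\<theta> n has_real_derivative L n * k n x) (at x within {0..1})"
    and ck: "\<And>n. continuous_on {0..1} (k n)"
    and M: "\<And>n. integral {0..1} (\<lambda>x. (k n x)\<^sup>2) \<le> M"
    and \<theta>0: "\<And>n. \<bar>\<theta> n 0\<bar> \<le> pi"
  obtains r L' \<theta>' where "strict_mono (r :: nat \<Rightarrow> nat)" "(\<lambda>n. L (r n)) \<longlonglongrightarrow> L'"
    "continuous_on {0..1} \<theta>'" "uniform_limit {0..1} (\<lambda>n. \<theta> (r n)) \<theta>' sequentially"
proof -
  have Lm: "0 < Lm" using L[of 0] by simp
  have "0 \<le> integral {0..1} (\<lambda>x. (k 0 x)\<^sup>2)"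
    by (intro integral_nonneg_continuous continuous_intros ck) auto
  then have M0: "0 \<le> M" using M[of 0] by simp
  have inc: "\<bar>\<theta> n y - \<theta> n x\<bar> \<le> Lm * ((\<delta> * (y - x) + M / \<delta>) / 2)"
    if \<delta>: "0 < \<delta>" and xy: "0 \<le> x" "x \<le> y" "y \<le> 1" for n x y \<delta>
  proof -
    have sub: "{x..y} \<subseteq> {0..1}" using xy by auto
    have "\<bar>\<theta> n y - \<theta> n x\<bar> \<le> integral {x..y} (\<lambda>t. Lm * \<bar>k n t\<bar>)"
      using L[of n] by (intro increment_bound_within_Icc[OF d\<theta>] xy continuous_intros ck)
        (auto simp: abs_mult intro!: mult_right_mono)
    also have "\<dots> = Lm * integral {x..y} (\<lambda>t. \<bar>k n t\<bar>)" by simp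
    also have "integral {x..y} (\<lambda>t. \<bar>k n t\<bar>) \<le> (\<delta> * (y - x) + integral {x..y} (\<lambda>t. (k n t)\<^sup>2) / \<delta>) / 2"
      by (rule integral_abs_le[OF continuous_on_subset[OF ck sub] \<delta> xy(2)])
    also have "integral {x..y} (\<lambda>t. (k n t)\<^sup>2) \<le> M"
      by (rule order_trans[OF integral_subinterval_le M]) (use xy in \<open>auto intro!: continuous_intros ck\<close>)
    finally show ?thesis using Lm \<delta> by (simp add: divide_right_mono)
  qed
  define F where "F = (\<lambda>n x. (L n, \<theta> n x))"
  obtain g r where g: "continuous_on {0..1} g" and r: "strict_mono (r :: nat \<Rightarrow> nat)"
    and conv: "\<And>e. 0 < e \<Longrightarrow> \<exists>N. \<forall>n x. n \<ge> N \<and> x \<in> {0..1} \<longrightarrow> norm (F (r n) x - g x) < e"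
  proof (rule Arzela_Ascoli[of "{0..1::real}" F "Lm + (pi + Lm * ((1 + M) / 2))"])
    fix n and x :: real assume x: "x \<in> {0..1}"
    have "\<bar>\<theta> n x - \<theta> n 0\<bar> \<le> Lm * ((1 * (x - 0) + M / 1) / 2)" using x by (intro inc) auto
    also have "\<dots> \<le> Lm * ((1 + M) / 2)" using x Lm by (intro mult_left_mono) auto
    finally have "\<bar>\<theta> n x\<bar> \<le> pi + Lm * ((1 + M) / 2)" using \<theta>0[of n] by linarith
    then show "norm (F n x) \<le> Lm + (pi + Lm * ((1 + M) / 2))"
      using L[of n] norm_Pair_le[of "L n" "\<theta> n x"] by (simp add: F_def)
  next
    fix x e :: real assume x: "x \<in> {0..1}" and e: "0 < e"
    \<comment> \<open>The increment is at most the mean of two terms. This \<delta> makes the one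
      containing \<open>M\<close> at most \<open>e\<close>, and \<open>d\<close> makes the other
      less than \<open>e\<close>. With M + 1 in place of M, \<delta> is positive even if M =
      0.\<close>
    define \<delta> where "\<delta> = Lm * (M + 1) / e"
    have \<delta>: "0 < \<delta>" using Lm M0 e by (simp add: \<delta>_def)
    define d where "d = e / (Lm * \<delta>)"
    have d: "0 < d" using \<delta> e Lm by (simp add: d_def)
    have close: "\<bar>\<theta> n y - \<theta> n x\<bar> < e" if "0 \<le> x" "x \<le> y" "y \<le> 1" "y - x < d" for n x y
    proof -
      have "\<bar>\<theta> n y - \<theta> n x\<bar> \<le> (Lm * \<delta> * (y - x) + Lm * M / \<delta>) / 2"
        using inc[OF \<delta> that(1-3), of n] by (simp add: algebra_simps)
      moreover have "Lm * \<delta> * (y - x) < e"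
        using that(4) mult_pos_pos[OF Lm \<delta>] by (simp add: d_def pos_less_divide_eq mult.commute)
      moreover have "Lm * M / \<delta> \<le> e"
      proof -
        have "Lm * M / \<delta> = e * (M / (M + 1))" using Lm by (simp add: \<delta>_def)
        also have "\<dots> \<le> e * 1" using e M0 by (intro mult_left_mono) auto
        finally show ?thesis by simp
      qed
      moreover have "(X + Y) / 2 < e" if "X < e" "Y \<le> e" for X Y :: real using that by simp
      ultimately show ?thesis by (meson le_less_trans)
    qed
    show "\<exists>d>0. \<forall>n y. y \<in> {0..1} \<and> norm (x - y) < d \<longrightarrow> norm (F n x - F n y) < e"
    proof (intro exI[of _ d] conjI allI impI d)
      fix n y assume y: "y \<in> {0..1} \<and> norm (x - y) < d"
      then show "norm (F n x - F n y) < e"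
        using close[of x y n] close[of y x n] x by (cases "x \<le> y") (auto simp: F_def norm_Pair abs_minus_commute)
    qed
  qed auto
  have u: "uniform_limit {0..1} (\<lambda>n. F (r n)) g sequentially"
  proof (rule uniform_limitI)
    fix e :: real assume "0 < e"
    then obtain N where "\<forall>n x. n \<ge> N \<and> x \<in> {0..1} \<longrightarrow> norm (F (r n) x - g x) < e" using conv by blast
    then show "\<forall>\<^sub>F n in sequentially. \<forall>x\<in>{0..1}. dist (F (r n) x) (g x) < e"
      unfolding eventually_sequentially dist_norm by blast
  qed
  have "uniform_limit {0..1} (\<lambda>n. \<theta> (r n)) (\<lambda>x. snd (g x)) sequentially"
    using bounded_linear.uniform_limit[OF bounded_linear_snd u] by (simp add: F_def)
  moreover have "(\<lambda>n. L (r n)) \<longlonglongrightarrow> fst (g 0)"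
    using tendsto_fst[OF tendsto_uniform_limitI[OF u, of 0]] by (simp add: F_def)
  ultimately show ?thesis
    using that[OF r _ continuous_on_snd[OF g]] by blast
qed

text \<open>The expression lam k - k^3 - 2 f is the normal velocity. Its smallness alone does not
  control f, because the L2 bound on k says nothing about the cubic term. Let s be the maximum of
  |k|. Rolle's theorem supplies a zero of p, and |k|^3 \<le> s k^2 bounds p by a linear function of
  s. The increments of k^2 from the end point, where k = 0, then give s^2 \<le> const (1 + s), which
  bounds s. With k and p bounded, the equation passes to the limit in integrated form.\<close>

lemma elastica_compactness:
  fixes L :: "nat \<Rightarrow> real" and \<theta> k p f :: "nat \<Rightarrow> real \<Rightarrow> real"
  assumes lam: "0 < lam" and L: "\<And>n. 0 < L n" "\<And>n. L n \<le> Lm"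
    and d\<theta>: "\<And>n x. x \<in> {0..1} \<Longrightarrow> (\<theta> n has_real_derivative L n * k n x) (at x within {0..1})"
    and dk: "\<And>n x. x \<in> {0..1} \<Longrightarrow> (k n has_real_derivative L n * p n x) (at x within {0..1})"
    and dp: "\<And>n x. x \<in> {0..1} \<Longrightarrow> (p n has_real_derivative L n * f n x) (at x within {0..1})"
    and cf: "\<And>n. continuous_on {0..1} (f n)"
    and bc: "\<And>n. k n 0 = 0" "\<And>n. k n 1 = 0"
    and M: "\<And>n. integral {0..1} (\<lambda>x. (k n x)\<^sup>2) \<le> M"
    and \<theta>0: "\<And>n. \<bar>\<theta> n 0\<bar> \<le> pi"
    and w: "(\<lambda>n. integral {0..1} (\<lambda>x. (lam * k n x - k n x ^ 3 - 2 * f n x)\<^sup>2)) \<longlonglongrightarrow> 0"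
  obtains r L' \<theta>' k' p' where "strict_mono (r :: nat \<Rightarrow> nat)" "(\<lambda>n. L (r n)) \<longlonglongrightarrow> L'"
    "uniform_limit {0..1} (\<lambda>n. \<theta> (r n)) \<theta>' sequentially"
    "uniform_limit {0..1} (\<lambda>n. k (r n)) k' sequentially"
    "\<And>x. x \<in> {0..1} \<Longrightarrow> (\<theta>' has_real_derivative L' * k' x) (at x within {0..1})"
    "\<And>x. x \<in> {0..1} \<Longrightarrow> (k' has_real_derivative L' * p' x) (at x within {0..1})"
    "\<And>x. x \<in> {0..1} \<Longrightarrow> (p' has_real_derivative L' * ((lam * k' x - k' x ^ 3) / 2)) (at x within {0..1})"
    "k' 0 = 0" "k' 1 = 0"
proof -
  have Lm: "0 < Lm" using L[of 0] by simp
  have ck: "continuous_on {0..1} (k n)" for n using dk by (rule DERIV_continuous_on)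
  have cp: "continuous_on {0..1} (p n)" for n using dp by (rule DERIV_continuous_on)
  have "0 \<le> integral {0..1} (\<lambda>x. (k 0 x)\<^sup>2)"
    by (intro integral_nonneg_continuous continuous_intros ck) auto
  then have M0: "0 \<le> M" using M[of 0] by simp
  define W where "W = (\<lambda>n x. lam * k n x - k n x ^ 3 - 2 * f n x)"
  define J where "J = (\<lambda>n. integral {0..1} (\<lambda>x. (W n x)\<^sup>2))"
  have J: "J \<longlonglongrightarrow> 0" using w by (simp add: J_def W_def)
  then have "bounded (range J)" by (rule convergent_imp_bounded)
  then obtain J0 where "\<forall>n. \<bar>J n\<bar> \<le> J0" by (auto simp: bounded_iff)
  then have J0: "J n \<le> J0" for n using abs_le_iff by blast
  have "0 \<le> J n" for n unfolding J_def W_def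
    by (intro integral_nonneg_continuous continuous_intros ck cf) auto
  then have J00: "0 \<le> J0" using J0[of 0] order_trans by blast
  have cW: "continuous_on {0..1} (W n)" for n unfolding W_def by (intro continuous_intros ck cf)
  have int_k: "integral {0..1} (\<lambda>x. \<bar>k n x\<bar>) \<le> (1 + M) / 2" for n
    using integral_abs_le[OF ck zero_less_one zero_le_one, of n] M[of n] by simp
  have int_W: "integral {0..1} (\<lambda>x. \<bar>W n x\<bar>) \<le> (\<delta> + J n / \<delta>) / 2" if "0 < \<delta>" for n \<delta>
    using integral_abs_le[OF cW that zero_le_one, of n] by (simp add: J_def)
  define A where "A = lam * (1 + M) + (1 + J0)"
  define B1 where "B1 = 2 * Lm\<^sup>2 * (1 + M)"
  define S where "S = 1 + B1 * A + B1 * M"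
  have A: "0 \<le> A" and B1: "0 \<le> B1" using M0 J00 lam Lm by (auto simp: A_def B1_def)
  have p_bound: "\<bar>p n x\<bar> \<le> Lm * (A + s * M)" if s: "0 \<le> s" "\<And>x. x \<in> {0..1} \<Longrightarrow> \<bar>k n x\<bar> \<le> s" and x: "x \<in> {0..1}" for n s x
  proof -
    \<comment> \<open>The curvature vanishes at both ends, so its derivative \<open>p\<close> has a
      zero from which increments can be measured.\<close>
    have "\<exists>l z. 0 < z \<and> z < 1 \<and> (k n has_real_derivative l) (at z) \<and> k n 1 - k n 0 = (1 - 0) * l"
    proof (rule MVT)
      show "k n differentiable (at x)" if "0 < x" "x < 1" for x
        using dk[of x n] that at_within_Icc_at[of 0 x 1] by (auto simp: real_differentiable_def)
    qed (use ck in auto)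
    then obtain z where z: "0 < z" "z < 1" "(k n has_real_derivative 0) (at z)" using bc by auto
    then have "L n * p n z = 0"
      using dk[of z n] at_within_Icc_at[of 0 z 1] DERIV_unique by fastforce
    then have pz: "p n z = 0" using L[of n] by simp
    have "\<bar>p n x - p n z\<bar> \<le> integral {0..1} (\<lambda>x. Lm * (lam * \<bar>k n x\<bar> + s * (k n x)\<^sup>2 + \<bar>W n x\<bar>))"
    proof (rule increment_bound_total[OF dp])
      fix y :: real assume y: "y \<in> {0..1}"
      have "\<bar>k n y ^ 3\<bar> = \<bar>k n y\<bar> * (k n y)\<^sup>2" by (simp add: abs_mult power3_eq_cube power2_eq_square)
      also have "\<dots> \<le> s * (k n y)\<^sup>2" by (intro mult_right_mono s y) auto
      finally have k3: "\<bar>k n y ^ 3\<bar> \<le> s * (k n y)\<^sup>2" .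
      have "2 * f n y = lam * k n y - k n y ^ 3 - W n y" by (simp add: W_def)
      then have "2 * \<bar>f n y\<bar> \<le> \<bar>lam * k n y\<bar> + \<bar>k n y ^ 3\<bar> + \<bar>W n y\<bar>" by linarith
      moreover have "\<bar>lam * k n y\<bar> = lam * \<bar>k n y\<bar>" using lam by (simp add: abs_mult)
      ultimately have "\<bar>f n y\<bar> \<le> lam * \<bar>k n y\<bar> + s * (k n y)\<^sup>2 + \<bar>W n y\<bar>" using k3 by linarith
      then show "\<bar>L n * f n y\<bar> \<le> Lm * (lam * \<bar>k n y\<bar> + s * (k n y)\<^sup>2 + \<bar>W n y\<bar>)"
        unfolding abs_mult using L[of n] by (intro mult_mono) auto
    qed (use z x in \<open>auto intro!: continuous_intros ck cf cW\<close>)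
    also have "\<dots> = Lm * (lam * integral {0..1} (\<lambda>x. \<bar>k n x\<bar>) + s * integral {0..1} (\<lambda>x. (k n x)\<^sup>2)
        + integral {0..1} (\<lambda>x. \<bar>W n x\<bar>))"
    proof -
      have "(\<lambda>x. lam * \<bar>k n x\<bar>) integrable_on {0..1}" "(\<lambda>x. s * (k n x)\<^sup>2) integrable_on {0..1}"
        "(\<lambda>x. \<bar>W n x\<bar>) integrable_on {0..1}"
        by (intro integrable_continuous_real continuous_intros ck cW)+
      then show ?thesis by (simp add: integral_add integrable_add)
    qed
    also have "\<dots> \<le> Lm * (lam * (1 + M) + s * M + (1 + J0))"
    proof -
      have "integral {0..1} (\<lambda>x. \<bar>k n x\<bar>) \<le> 1 + M" using int_k[of n] M0 by simp
      then have "lam * integral {0..1} (\<lambda>x. \<bar>k n x\<bar>) \<le> lam * (1 + M)" using lam by (intro mult_left_mono) auto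
      moreover have "s * integral {0..1} (\<lambda>x. (k n x)\<^sup>2) \<le> s * M" by (intro mult_left_mono M s)
      moreover have "integral {0..1} (\<lambda>x. \<bar>W n x\<bar>) \<le> 1 + J0" using int_W[of 1 n] J0[of n] J00 by simp
      ultimately show ?thesis using Lm by (intro mult_left_mono) auto
    qed
    finally show ?thesis by (simp add: pz A_def algebra_simps)
  qed
  have k_bound: "\<bar>k n x\<bar> \<le> S" if x: "x \<in> {0..1}" for n x
  proof -
    obtain x0 where x0: "x0 \<in> {0..1}" "\<And>y. y \<in> {0..1} \<Longrightarrow> \<bar>k n y\<bar> \<le> \<bar>k n x0\<bar>"
      using continuous_attains_sup[OF compact_Icc _ continuous_on_rabs[OF ck], of n] by auto
    define s where "s = \<bar>k n x0\<bar>"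
    have s: "0 \<le> s" by (simp add: s_def)
    define P where "P = Lm * (A + s * M)"
    have P: "\<bar>p n x\<bar> \<le> P" if "x \<in> {0..1}" for x
      unfolding P_def using p_bound[of s n x] x0 that by (simp add: s_def)
    have P0: "0 \<le> P" using P[of 0] by simp
    \<comment> \<open>Squaring k is what makes the bound close: the derivative 2 k k' is controlled
      by the integral of |k| times the maximum of |p|, and the latter is only linear in
      \<open>s\<close>, against \<open>s\<^sup>2\<close> on the left.\<close>
    have "\<bar>(k n x0)\<^sup>2 - (k n 0)\<^sup>2\<bar> \<le> integral {0..1} (\<lambda>x. 2 * Lm * P * \<bar>k n x\<bar>)"
    proof (rule increment_bound_total[where F="\<lambda>x. (k n x)\<^sup>2" and x=0 and y=x0 and F'="\<lambda>x. 2 * k n x * (L n * p n x)"])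
      show "((\<lambda>x. (k n x)\<^sup>2) has_real_derivative 2 * k n x * (L n * p n x)) (at x within {0..1})"
        if "x \<in> {0..1}" for x by (auto intro!: derivative_eq_intros dk that)
      fix x :: real assume x: "x \<in> {0..1}"
      have "L n * \<bar>p n x\<bar> \<le> Lm * P" using L[of n] P[OF x] by (intro mult_mono) auto
      then have "2 * \<bar>k n x\<bar> * (L n * \<bar>p n x\<bar>) \<le> 2 * \<bar>k n x\<bar> * (Lm * P)" by (intro mult_left_mono) auto
      then show "\<bar>2 * k n x * (L n * p n x)\<bar> \<le> 2 * Lm * P * \<bar>k n x\<bar>"
        using L[of n] by (simp add: abs_mult algebra_simps)
    qed (use x0 in \<open>auto intro!: continuous_intros ck cp\<close>)
    also have "\<dots> = 2 * Lm * P * integral {0..1} (\<lambda>x. \<bar>k n x\<bar>)" by simp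
    also have "\<dots> \<le> 2 * Lm * P * (1 + M)"
      using int_k[of n] M0 Lm P0 by (intro mult_left_mono) auto
    finally have "s\<^sup>2 \<le> B1 * A + B1 * M * s"
      by (simp add: bc s_def[symmetric] P_def B1_def power2_eq_square algebra_simps) (simp add: s_def power2_eq_square)
    moreover have "0 \<le> B1 * A" "0 \<le> B1 * M" using A B1 M0 by auto
    \<comment> \<open>For s > 1 the constant term is at most B1 A s, and dividing by s leaves a
      bound without s. The summand 1 in \<open>S\<close> covers the other case.\<close>
    ultimately have "s \<le> S"
    proof (cases "s \<le> 1")
      case True
      then show ?thesis using \<open>0 \<le> B1 * A\<close> \<open>0 \<le> B1 * M\<close> by (simp add: S_def)
    next
      case False
      then have "B1 * A \<le> B1 * A * s" using \<open>0 \<le> B1 * A\<close> by (simp add: mult_le_cancel_left1)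
      then have "s * s \<le> (B1 * A + B1 * M) * s"
        using \<open>s\<^sup>2 \<le> B1 * A + B1 * M * s\<close> by (simp add: power2_eq_square algebra_simps)
      then have "s \<le> B1 * A + B1 * M" using False by (simp add: mult_le_cancel_right)
      then show ?thesis by (simp add: S_def)
    qed
    then show ?thesis using x0(2)[OF x] by (simp add: s_def)
  qed
  have S0: "0 \<le> S" using k_bound[of 0 0] by simp
  define P where "P = Lm * (A + S * M)"
  have P: "\<bar>p n x\<bar> \<le> P" if "x \<in> {0..1}" for n x
    unfolding P_def using p_bound[OF S0 k_bound that] by simp
  have P0: "0 \<le> P" using P[of 0 0] by simp
  have p2: "integral {0..1} (\<lambda>x. (p n x)\<^sup>2) \<le> P\<^sup>2" for n
  proof -
    have "integral {0..1} (\<lambda>x. (p n x)\<^sup>2) \<le> integral {0..1::real} (\<lambda>_. P\<^sup>2)"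
    proof (rule integral_le)
      show "(p n x)\<^sup>2 \<le> P\<^sup>2" if "x \<in> {0..1}" for x
        using power_mono[OF P[OF that, of n], of 2] by simp
    qed (intro integrable_continuous_real continuous_intros cp)+
    then show ?thesis by simp
  qed
  \<comment> \<open>The curvature and its derivative \<open>p\<close> take the places of angle and
    curvature here.\<close>
  obtain r1 L' k' where r1: "strict_mono (r1 :: nat \<Rightarrow> nat)" and L1: "(\<lambda>n. L (r1 n)) \<longlonglongrightarrow> L'"
    and ck': "continuous_on {0..1} k'" and uk1: "uniform_limit {0..1} (\<lambda>n. k (r1 n)) k' sequentially"
    by (rule angle_compactness[of L Lm k p, OF L dk cp p2]) (use bc in auto)
  have "bounded (range (\<lambda>n. (\<theta> (r1 n) 0, p (r1 n) 0)))"
  proof (rule boundedI)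
    fix y assume "y \<in> range (\<lambda>n. (\<theta> (r1 n) 0, p (r1 n) 0))"
    then obtain n where "y = (\<theta> (r1 n) 0, p (r1 n) 0)" by blast
    then show "norm y \<le> pi + P"
      using norm_Pair_le[of "\<theta> (r1 n) 0" "p (r1 n) 0"] \<theta>0[of "r1 n"] P[of 0 "r1 n"] by simp
  qed
  then obtain y r2 where r2: "strict_mono (r2 :: nat \<Rightarrow> nat)"
    and y: "(\<lambda>n. (\<theta> (r1 (r2 n)) 0, p (r1 (r2 n)) 0)) \<longlonglongrightarrow> y"
    using bounded_imp_convergent_subsequence[of "\<lambda>n. (\<theta> (r1 n) 0, p (r1 n) 0)"] by (auto simp: o_def)
  define r t' a' where "r = (\<lambda>n. r1 (r2 n))" and "t' = fst y" and "a' = snd y"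
  have r: "strict_mono r" unfolding r_def using strict_mono_o[OF r1 r2] by (simp add: o_def)
  have L': "(\<lambda>n. L (r n)) \<longlonglongrightarrow> L'" using LIMSEQ_subseq_LIMSEQ[OF L1 r2] by (simp add: o_def r_def)
  have uk: "uniform_limit {0..1} (\<lambda>n. k (r n)) k' sequentially"
    using filterlim_compose[OF uk1 filterlim_subseq[OF r2]] by (simp add: r_def)
  have t': "(\<lambda>n. \<theta> (r n) 0) \<longlonglongrightarrow> t'" and a': "(\<lambda>n. p (r n) 0) \<longlonglongrightarrow> a'"
    using tendsto_fst[OF y] tendsto_snd[OF y] by (simp_all add: r_def t'_def a'_def)
  define f' where "f' = (\<lambda>x. (lam * k' x - k' x ^ 3) / 2)"
  \<comment> \<open>Built by integrating the limit equation, so that the derivatives are immediate;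
    that \<open>p\<close> and the angles really converge to these functions is shown below.\<close>
  define p' where "p' = (\<lambda>x. a' + integral {0..x} (\<lambda>y. L' * f' y))"
  define \<theta>' where "\<theta>' = (\<lambda>x. t' + integral {0..x} (\<lambda>y. L' * k' y))"
  have cf': "continuous_on {0..1} f'" unfolding f'_def by (intro continuous_intros ck') auto
  have dp': "(p' has_real_derivative L' * f' x) (at x within {0..1})" if "x \<in> {0..1}" for x
    unfolding p'_def using that
    by (auto intro!: derivative_eq_intros integral_has_real_derivative continuous_intros cf')
  have d\<theta>': "(\<theta>' has_real_derivative L' * k' x) (at x within {0..1})" if "x \<in> {0..1}" for x
    unfolding \<theta>'_def using that
    by (auto intro!: derivative_eq_intros integral_has_real_derivative continuous_intros ck')
  have cp': "continuous_on {0..1} p'" using dp' by (rule DERIV_continuous_on)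
  have uL: "uniform_limit {0..1} (\<lambda>n x. L (r n)) (\<lambda>x. L') sequentially"
    by (rule uniform_limit_constants[OF L'])
  have incr: "F x = F 0 + integral {0..x} F'"
    if d: "\<And>x. x \<in> {0..1} \<Longrightarrow> (F has_real_derivative F' x) (at x within {0..1})" and x: "x \<in> {0..1}" for F F' :: "real \<Rightarrow> real" and x
    using has_integral_increment[OF d[unfolded has_real_derivative_iff_has_vector_derivative], of 0 x] x
    by (simp add: has_integral_iff)
  have u\<theta>: "uniform_limit {0..1} (\<lambda>n. \<theta> (r n)) \<theta>' sequentially"
  proof -
    have "uniform_limit {0..1} (\<lambda>n x. \<theta> (r n) 0 + integral {0..x} (\<lambda>y. L (r n) * k (r n) y)) \<theta>' sequentially"
      unfolding \<theta>'_def
      by (intro uniform_limit_add uniform_limit_constants[OF t'] uniform_limit_integral_lower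
          uniform_limit_mult_continuous uL uk continuous_intros ck ck')
    then show ?thesis
      by (rule uniform_limit_cong'[THEN iffD1, rotated -1]) ((rule incr[OF d\<theta>, symmetric] | assumption | rule refl)+)
  qed
  define fk where "fk = (\<lambda>n x. (lam * k n x - k n x ^ 3) / 2)"
  have cfk: "continuous_on {0..1} (fk n)" for n unfolding fk_def by (intro continuous_intros ck) auto
  have ufk: "uniform_limit {0..1} (\<lambda>n. fk (r n)) f' sequentially"
  proof -
    have e: "fk = (\<lambda>n x. (lam / 2) * k n x - (k n x * k n x) * ((1/2) * k n x))"
      "f' = (\<lambda>x. (lam / 2) * k' x - (k' x * k' x) * ((1/2) * k' x))"
      by (simp_all add: fk_def f'_def fun_eq_iff power3_eq_cube field_simps)
    show ?thesis unfolding e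
      by (intro uniform_limit_minus uniform_limit_mult_continuous uniform_limit_const uk continuous_intros ck')
  qed
  have uW: "uniform_limit {0..1} (\<lambda>n x. integral {0..x} (\<lambda>y. L (r n) * (W (r n) y / 2))) (\<lambda>x. 0) sequentially"
  proof (rule uniform_limitI)
    fix e :: real assume e: "0 < e"
    \<comment> \<open>With this weight the bound for the integral is less than Lm \<delta> = e once
      the squared L2 norm of \<open>W\<close> is below \<delta>^2.\<close>
    define \<delta> where "\<delta> = e / Lm"
    have \<delta>: "0 < \<delta>" using e Lm by (simp add: \<delta>_def)
    have "(\<lambda>n. J (r n)) \<longlonglongrightarrow> 0" using J r by (rule LIMSEQ_subseq_LIMSEQ[unfolded o_def])
    then have "\<forall>\<^sub>F n in sequentially. J (r n) < \<delta>\<^sup>2" using \<delta> by (intro order_tendstoD) auto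
    then show "\<forall>\<^sub>F n in sequentially. \<forall>x\<in>{0..1}. dist (integral {0..x} (\<lambda>y. L (r n) * (W (r n) y / 2))) 0 < e"
    proof eventually_elim
      case (elim n)
      show ?case
      proof
        fix x :: real assume x: "x \<in> {0..1}"
        have sub: "{0..x} \<subseteq> {0..1}" using x by auto
        have "norm (integral {0..x} (\<lambda>y. L (r n) * (W (r n) y / 2))) \<le> integral {0..x} (\<lambda>y. Lm * \<bar>W (r n) y\<bar>)"
        proof (rule integral_norm_bound_integral)
          show "norm (L (r n) * (W (r n) y / 2)) \<le> Lm * \<bar>W (r n) y\<bar>" for y
            using L[of "r n"] unfolding real_norm_def abs_mult by (intro mult_mono) auto
        qed (auto intro!: integrable_continuous_real continuous_intros continuous_on_subset[OF cW sub])
        also have "\<dots> \<le> integral {0..1} (\<lambda>y. Lm * \<bar>W (r n) y\<bar>)"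
          by (rule integral_subinterval_le) (use x Lm in \<open>auto intro!: continuous_intros cW\<close>)
        also have "\<dots> = Lm * integral {0..1} (\<lambda>y. \<bar>W (r n) y\<bar>)" by simp
        also have "\<dots> \<le> Lm * ((\<delta> + J (r n) / \<delta>) / 2)"
          using Lm int_W[OF \<delta>] by (intro mult_left_mono) auto
        also have "\<dots> < Lm * \<delta>"
        proof -
          have "J (r n) / \<delta> < \<delta>" using elim \<delta> by (simp add: pos_divide_less_eq power2_eq_square)
          then show ?thesis using Lm by (intro mult_strict_left_mono) auto
        qed
        also have "\<dots> = e" using Lm by (simp add: \<delta>_def)
        finally show "dist (integral {0..x} (\<lambda>y. L (r n) * (W (r n) y / 2))) 0 < e" by simp
      qed
    qed
  qed
  have up: "uniform_limit {0..1} (\<lambda>n. p (r n)) p' sequentially"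
  proof -
    have ul: "uniform_limit {0..1} (\<lambda>n x. p (r n) 0 + integral {0..x} (\<lambda>y. L (r n) * fk (r n) y)
        - integral {0..x} (\<lambda>y. L (r n) * (W (r n) y / 2))) (\<lambda>x. p' x - 0) sequentially"
      unfolding p'_def
      by (intro uniform_limit_add uniform_limit_minus uW uniform_limit_constants[OF a'] uniform_limit_integral_lower
          uniform_limit_mult_continuous uL ufk continuous_intros cfk cf')
    have pn: "p (r n) x = p (r n) 0 + integral {0..x} (\<lambda>y. L (r n) * fk (r n) y)
        - integral {0..x} (\<lambda>y. L (r n) * (W (r n) y / 2))" if x: "x \<in> {0..1}" for n x
    proof -
      have sub: "{0..x} \<subseteq> {0..1}" using x by auto
      have "(\<lambda>y. L (r n) * fk (r n) y) integrable_on {0..x}" "(\<lambda>y. L (r n) * (W (r n) y / 2)) integrable_on {0..x}"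
        by (intro integrable_continuous_real continuous_intros
            continuous_on_subset[OF cfk sub] continuous_on_subset[OF cW sub]; simp)+
      note integral_diff[OF this]
      moreover have "(\<lambda>y. L (r n) * fk (r n) y - L (r n) * (W (r n) y / 2)) = (\<lambda>y. L (r n) * f (r n) y)"
        by (simp add: fk_def W_def fun_eq_iff field_simps)
      ultimately show ?thesis using incr[OF dp x] by simp
    qed
    show ?thesis
      by (rule uniform_limit_cong'[THEN iffD1, OF _ _ ul]) (erule pn[symmetric], simp)
  qed
  \<comment> \<open>So far \<open>k'\<close> is only a uniform limit. Passing to the limit in the
    integrated relation k = integral of L p exhibits it as a primitive, hence as
    differentiable.\<close>
  have k_eq: "k' x = integral {0..x} (\<lambda>y. L' * p' y)" if x: "x \<in> {0..1}" for x
  proof -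
    have "uniform_limit {0..1} (\<lambda>n x. integral {0..x} (\<lambda>y. L (r n) * p (r n) y)) (\<lambda>x. integral {0..x} (\<lambda>y. L' * p' y)) sequentially"
      by (intro uniform_limit_integral_lower uniform_limit_mult_continuous uL up continuous_intros cp cp')
    from tendsto_uniform_limitI[OF this x]
    have "(\<lambda>n. k (r n) x) \<longlonglongrightarrow> integral {0..x} (\<lambda>y. L' * p' y)"
      using incr[OF dk x] by (simp add: bc)
    with tendsto_uniform_limitI[OF uk x] show ?thesis using LIMSEQ_unique by blast
  qed
  have dk': "(k' has_real_derivative L' * p' x) (at x within {0..1})" if x: "x \<in> {0..1}" for x
    unfolding has_real_derivative_iff_has_vector_derivative
  proof (rule has_vector_derivative_transform[OF x k_eq])
    show "((\<lambda>x. integral {0..x} (\<lambda>y. L' * p' y)) has_vector_derivative L' * p' x) (at x within {0..1})"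
      using x by (intro integral_has_vector_derivative continuous_intros cp')
  qed
  have "k' 0 = 0" "k' 1 = 0"
    using LIMSEQ_unique[OF tendsto_uniform_limitI[OF uk, of 0], of 0] LIMSEQ_unique[OF tendsto_uniform_limitI[OF uk, of 1], of 0]
    by (simp_all add: bc)
  with that[OF r L' u\<theta> uk d\<theta>' dk' dp'[unfolded f'_def]] show ?thesis by blast
qed

section \<open>Curves of constant speed\<close>

text \<open>The representative of constant speed of a curve issuing from the origin;
  \<open>L\<close> is its length. All information sits in \<open>L\<close> and \<theta>, and uniform
  convergence of the angles together with convergence of the lengths is C^1 convergence.\<close>

definition cis_curve :: "real \<Rightarrow> (real \<Rightarrow> real) \<Rightarrow> real \<Rightarrow> complex" where
  "cis_curve L \<theta> x = integral {0..x} (\<lambda>y. of_real L * cis (\<theta> y))"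

lemma continuous_on_cis_comp:
  assumes "continuous_on S \<theta>"
  shows "continuous_on S (\<lambda>x. cis (\<theta> x))"
  unfolding cis_conv_exp by (intro continuous_intros assms)

lemma continuous_on_cis_curve:
  "continuous_on {0..1} \<theta> \<Longrightarrow> continuous_on {0..1} (cis_curve L \<theta>)"
  unfolding cis_curve_def[abs_def]
  by (intro indefinite_integral_continuous_1 integrable_continuous_real continuous_intros continuous_on_cis_comp)

text \<open>The chord differs from the segment of length L (y - x) in the direction
  \<open>cis (\<theta> x)\<close> by at most L e (y - x), which gives the lower bound.\<close>

lemma cis_curve_increment:
  assumes \<theta>: "continuous_on {0..1} \<theta>" and L: "0 < L" and xy: "0 \<le> x" "x \<le> y" "y \<le> 1"
    and e: "\<And>t. t \<in> {x..y} \<Longrightarrow> \<bar>\<theta> t - \<theta> x\<bar> \<le> e"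
  shows "cmod (cis_curve L \<theta> y - cis_curve L \<theta> x) \<le> L * (y - x)"
    and "L * (1 - e) * (y - x) \<le> cmod (cis_curve L \<theta> y - cis_curve L \<theta> x)"
proof -
  have int: "(\<lambda>t. of_real L * cis (\<theta> t)) integrable_on {a..b}" if "0 \<le> a" "b \<le> 1" for a b
    using that by (intro integrable_continuous_real continuous_intros continuous_on_cis_comp
        continuous_on_subset[OF \<theta>]) auto
  have eq: "cis_curve L \<theta> y - cis_curve L \<theta> x = integral {x..y} (\<lambda>t. of_real L * cis (\<theta> t))"
    using Henstock_Kurzweil_Integration.integral_combine[of 0 x y "\<lambda>t. of_real L * cis (\<theta> t)"] xy int[of 0 y]
    by (simp add: cis_curve_def algebra_simps)
  have "cmod (integral {x..y} (\<lambda>t. of_real L * cis (\<theta> t))) \<le> integral {x..y} (\<lambda>t. L)"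
    by (rule integral_norm_bound_integral) (use L xy int in \<open>auto simp: norm_mult\<close>)
  then show "cmod (cis_curve L \<theta> y - cis_curve L \<theta> x) \<le> L * (y - x)"
    using xy by (simp add: eq mult.commute)
  have "cmod (integral {x..y} (\<lambda>t. of_real L * cis (\<theta> t) - of_real L * cis (\<theta> x))) \<le> integral {x..y} (\<lambda>t. L * e)"
  proof (rule integral_norm_bound_integral)
    fix t assume t: "t \<in> {x..y}"
    have "cmod (of_real L * cis (\<theta> t) - of_real L * cis (\<theta> x)) = L * cmod (cis (\<theta> t) - cis (\<theta> x))"
      using L by (simp add: norm_mult flip: right_diff_distrib)
    also have "\<dots> \<le> L * e" using L e[OF t] norm_cis_diff_le[of "\<theta> t" "\<theta> x"] by (intro mult_left_mono) auto
    finally show "cmod (of_real L * cis (\<theta> t) - of_real L * cis (\<theta> x)) \<le> L * e" .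
  qed (use xy int in \<open>auto intro!: integrable_diff\<close>)
  also have "integral {x..y} (\<lambda>t. of_real L * cis (\<theta> t) - of_real L * cis (\<theta> x))
      = (cis_curve L \<theta> y - cis_curve L \<theta> x) - of_real (y - x) * (of_real L * cis (\<theta> x))"
    using xy by (subst integral_diff) (auto simp: eq scaleR_conv_of_real intro!: int)
  finally have "cmod ((cis_curve L \<theta> y - cis_curve L \<theta> x) - of_real (y - x) * (of_real L * cis (\<theta> x))) \<le> L * e * (y - x)"
    using xy by (simp add: mult_ac)
  moreover have "cmod (of_real (y - x) * (of_real L * cis (\<theta> x))) = L * (y - x)"
    using xy L by (simp add: norm_mult del: of_real_diff)
  ultimately show "L * (1 - e) * (y - x) \<le> cmod (cis_curve L \<theta> y - cis_curve L \<theta> x)"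
    using norm_triangle_ineq2[of "of_real (y - x) * (of_real L * cis (\<theta> x))" "cis_curve L \<theta> y - cis_curve L \<theta> x"]
    by (simp add: norm_minus_commute algebra_simps)
qed

lemma cis_curve_lipschitz:
  assumes \<theta>: "continuous_on {0..1} \<theta>" and L: "0 < L" and xy: "x \<in> {0..1}" "y \<in> {0..1}"
  shows "cmod (cis_curve L \<theta> y - cis_curve L \<theta> x) \<le> L * \<bar>y - x\<bar>"
proof -
  have "\<exists>B. \<forall>t\<in>{0..1}. \<bar>\<theta> t\<bar> \<le> B"
    using compact_imp_bounded[OF compact_continuous_image[OF \<theta> compact_Icc]] by (auto simp: bounded_iff)
  then obtain B where B: "\<And>t. t \<in> {0..1} \<Longrightarrow> \<bar>\<theta> t\<bar> \<le> B" by blast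
  have *: "cmod (cis_curve L \<theta> y - cis_curve L \<theta> x) \<le> L * (y - x)" if "0 \<le> x" "x \<le> y" "y \<le> 1" for x y
  proof (rule cis_curve_increment(1)[OF \<theta> L that, of "2 * B"])
    fix t assume "t \<in> {x..y}"
    then show "\<bar>\<theta> t - \<theta> x\<bar> \<le> 2 * B" using B[of t] B[of x] that by auto
  qed
  show ?thesis using *[of x y] *[of y x] xy by (cases "x \<le> y") (auto simp: norm_minus_commute)
qed

text \<open>Uniform continuity of the angle: at small scale the ratio of chord to arclength is as
  close to 1 as desired.\<close>

lemma cis_curve_local_lower_bound:
  assumes \<theta>: "continuous_on {0..1} \<theta>" and L: "0 < L" and e: "0 < e"
  obtains d where "0 < d" "\<And>x y. x \<in> {0..1} \<Longrightarrow> y \<in> {0..1} \<Longrightarrow> \<bar>x - y\<bar> < d \<Longrightarrow>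
    L * (1 - e) * \<bar>x - y\<bar> \<le> cmod (cis_curve L \<theta> x - cis_curve L \<theta> y)"
proof -
  have "uniformly_continuous_on {0..1} \<theta>" using \<theta> by (intro compact_uniformly_continuous) auto
  then obtain d where d: "0 < d" "\<And>x y. x \<in> {0..1} \<Longrightarrow> y \<in> {0..1} \<Longrightarrow> dist y x < d \<Longrightarrow> dist (\<theta> y) (\<theta> x) < e"
    using e unfolding uniformly_continuous_on_def by metis
  have *: "L * (1 - e) * (y - x) \<le> cmod (cis_curve L \<theta> y - cis_curve L \<theta> x)"
    if "0 \<le> x" "x \<le> y" "y \<le> 1" "y - x < d" for x y
  proof (rule cis_curve_increment(2)[OF \<theta> L that(1-3)])
    fix t assume "t \<in> {x..y}"
    then show "\<bar>\<theta> t - \<theta> x\<bar> \<le> e" using d(2)[of x t] that by (auto simp: dist_real_def)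
  qed
  show ?thesis
  proof (rule that[OF d(1)])
    fix x y :: real assume "x \<in> {0..1}" "y \<in> {0..1}" "\<bar>x - y\<bar> < d"
    then show "L * (1 - e) * \<bar>x - y\<bar> \<le> cmod (cis_curve L \<theta> x - cis_curve L \<theta> y)"
      using *[of x y] *[of y x] by (cases "x \<le> y") (auto simp: norm_minus_commute)
  qed
qed

text \<open>Chaining through equal steps shorter than \<open>d\<close> preserves the Lipschitz
  constant on an interval.\<close>

lemma lipschitz_from_local:
  fixes h :: "real \<Rightarrow> real"
  assumes d: "0 < d" and loc: "\<And>u w. u \<in> {0..1} \<Longrightarrow> w \<in> {0..1} \<Longrightarrow> \<bar>u - w\<bar> < d \<Longrightarrow> a * \<bar>h u - h w\<bar> \<le> \<bar>u - w\<bar>"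
    and a: "0 < a" and uw: "0 \<le> u" "u \<le> w" "w \<le> 1"
  shows "a * \<bar>h w - h u\<bar> \<le> w - u"
proof -
  obtain N :: nat where N: "1 / d < real N" using reals_Archimedean2 by blast
  then have N0: "0 < real N" using d by (meson less_trans zero_less_divide_1_iff)
  define s where "s = (w - u) / real N"
  have s: "0 \<le> s" "real N * s = w - u" using uw N0 by (auto simp: s_def)
  have "s \<le> 1 / real N" using uw N0 by (simp add: s_def divide_right_mono)
  also have "\<dots> < d" using N N0 d by (simp add: field_simps)
  finally have sd: "s < d" .
  have "a * \<bar>h (u + real i * s) - h u\<bar> \<le> real i * s" if "i \<le> N" for i
    using that
  proof (induction i)
    case (Suc i)
    have "real i * s \<le> real N * s" "real (Suc i) * s \<le> real N * s"
      using Suc.prems s by (intro mult_right_mono; simp)+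
    moreover have "0 \<le> real i * s" using s by simp
    ultimately have "a * \<bar>h (u + real (Suc i) * s) - h (u + real i * s)\<bar> \<le> \<bar>(u + real (Suc i) * s) - (u + real i * s)\<bar>"
      using s uw sd by (intro loc) (auto simp: algebra_simps)
    also have "\<dots> = s" using s by (simp add: algebra_simps)
    finally have "a * \<bar>h (u + real (Suc i) * s) - h (u + real i * s)\<bar> + a * \<bar>h (u + real i * s) - h u\<bar> \<le> s + real i * s"
      using Suc by simp
    moreover have "a * \<bar>h (u + real (Suc i) * s) - h u\<bar>
      \<le> a * (\<bar>h (u + real (Suc i) * s) - h (u + real i * s)\<bar> + \<bar>h (u + real i * s) - h u\<bar>)"
      using a by (intro mult_left_mono) auto
    ultimately show ?case by (simp add: algebra_simps)
  qed simp
  from this[of N] show ?thesis using s by simp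
qed

text \<open>A curve of speed at most \<open>L\<close> running inside an embedded arc of constant speed \<open>L\<close>,
  from one end to the other in unit time, has no time to spare.\<close>
lemma curve_inside_embedded_arc_eq:
  fixes c :: "real \<Rightarrow> complex"
  assumes \<theta>: "continuous_on {0..1} \<theta>" and L: "0 < L"
    and inj: "inj_on (cis_curve L \<theta>) {0..1}"
    and lip: "\<And>u w. u \<in> {0..1} \<Longrightarrow> w \<in> {0..1} \<Longrightarrow> cmod (c u - c w) \<le> L * \<bar>u - w\<bar>"
    and img: "c ` {0..1} \<subseteq> cis_curve L \<theta> ` {0..1}"
    and ends: "c 0 = cis_curve L \<theta> 0" "c 1 = cis_curve L \<theta> 1" and u: "u \<in> {0..1}"
  shows "c u = cis_curve L \<theta> u"
proof -
  define \<eta> where "\<eta> = cis_curve L \<theta>"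
  \<comment> \<open>\<open>h u\<close> is the position on the arc of the point \<open>c u\<close>.
    It is continuous because an injective continuous map of a compact interval is a homeomorphism
    onto its image.\<close>
  define h where "h = (\<lambda>u. inv_into {0..1} \<eta> (c u))"
  have h: "h u \<in> {0..1}" "\<eta> (h u) = c u" if "u \<in> {0..1}" for u
  proof -
    have "c u \<in> \<eta> ` {0..1}" using img that by (auto simp: \<eta>_def)
    then show "h u \<in> {0..1}" "\<eta> (h u) = c u"
      unfolding h_def by (rule inv_into_into, rule f_inv_into_f)
  qed
  have c\<eta>: "continuous_on {0..1} \<eta>" unfolding \<eta>_def by (rule continuous_on_cis_curve[OF \<theta>])
  have cc: "continuous_on {0..1} c"
  proof (rule lipschitz_on_continuous_on[of L], rule lipschitz_onI)
    show "dist (c x) (c y) \<le> L * dist x y" if "x \<in> {0..1}" "y \<in> {0..1}" for x y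
      using lip[OF that] by (simp add: dist_norm)
  qed (use L in simp)
  have "continuous_on (\<eta> ` {0..1}) (inv_into {0..1} \<eta>)"
    by (rule continuous_on_inv[OF c\<eta> compact_Icc]) (use inj in \<open>auto simp: \<eta>_def inv_into_f_f\<close>)
  then have "continuous_on {0..1} h"
    unfolding h_def by (rule continuous_on_compose2[OF _ cc]) (use img in \<open>auto simp: \<eta>_def\<close>)
  then have uh: "uniformly_continuous_on {0..1} h" by (intro compact_uniformly_continuous) auto
  \<comment> \<open>For each a < 1 chords of the arc are at least a L times the parameter difference
    at scale \<open>d1\<close>, and continuity of \<open>h\<close> keeps its increments within that
    scale. As \<open>c\<close> has speed at most L, \<open>h\<close> is Lipschitz with constant 1/a
    for every a < 1.\<close>
  have lip_h: "\<bar>h w - h u\<bar> \<le> w - u" if uw: "0 \<le> u" "u \<le> w" "w \<le> 1" for u w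
  proof (rule field_le_mult_one_interval)
    fix a :: real assume a: "0 < a" "a < 1"
    obtain d1 where d1: "0 < d1" "\<And>x y. x \<in> {0..1} \<Longrightarrow> y \<in> {0..1} \<Longrightarrow> \<bar>x - y\<bar> < d1 \<Longrightarrow>
        L * (1 - (1 - a)) * \<bar>x - y\<bar> \<le> cmod (\<eta> x - \<eta> y)"
      using cis_curve_local_lower_bound[OF \<theta> L, of "1 - a"] a unfolding \<eta>_def by auto
    obtain d where d: "0 < d" "\<And>x y. x \<in> {0..1} \<Longrightarrow> y \<in> {0..1} \<Longrightarrow> dist y x < d \<Longrightarrow> dist (h y) (h x) < d1"
      using uh d1(1) unfolding uniformly_continuous_on_def by metis
    show "a * \<bar>h w - h u\<bar> \<le> w - u"
    proof (rule lipschitz_from_local[OF d(1) _ a(1) uw])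
      fix u w :: real assume uw: "u \<in> {0..1}" "w \<in> {0..1}" "\<bar>u - w\<bar> < d"
      have "L * (1 - (1 - a)) * \<bar>h u - h w\<bar> \<le> cmod (\<eta> (h u) - \<eta> (h w))"
        using d(2)[of w u] uw h by (intro d1(2)) (auto simp: dist_real_def)
      also have "\<dots> \<le> L * \<bar>u - w\<bar>" using uw h lip by simp
      finally show "a * \<bar>h u - h w\<bar> \<le> \<bar>u - w\<bar>" using L by (simp add: mult.assoc)
    qed
  qed
  have "h 0 = 0" "h 1 = 1"
    using h[of 0] h[of 1] ends inj by (auto simp: \<eta>_def inj_on_def)
  \<comment> \<open>A map with Lipschitz constant 1 that fixes both ends satisfies h u \<le> u and 1
    - h u \<le> 1 - u.\<close>
  then have "h u = u" using lip_h[of 0 u] lip_h[of u 1] u by auto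
  then show ?thesis using h(2)[OF u] by (simp add: \<eta>_def)
qed

lemma uniform_limit_cis_curve:
  assumes L: "L \<longlonglongrightarrow> L'" and \<theta>: "uniform_limit {0..1} \<theta> \<theta>' sequentially"
    and c: "\<And>n. continuous_on {0..1} (\<theta> n)" "continuous_on {0..1} \<theta>'"
  shows "uniform_limit {0..1} (\<lambda>n. cis_curve (L n) (\<theta> n)) (cis_curve L' \<theta>') sequentially"
  unfolding cis_curve_def[abs_def]
  by (intro uniform_limit_integral_lower uniform_limit_mult_continuous uniform_limit_constants
      tendsto_of_real L uniform_limit_cis \<theta> continuous_intros continuous_on_cis_comp c)

text \<open>Embeddedness is stable under C^1 convergence. Parameters closer than \<open>d\<close>
  are separated because the tangent turns by less than one radian between them. For all other pairs
  compactness gives a positive distance \<open>m\<close> on the limit curve, which survives errors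
  below m/2 at both points.\<close>

lemma eventually_inj_cis_curve:
  assumes L: "L \<longlonglongrightarrow> L'" "0 < L'" and \<theta>: "uniform_limit {0..1} \<theta> \<theta>' sequentially"
    and c: "\<And>n. continuous_on {0..1} (\<theta> n)" "continuous_on {0..1} \<theta>'"
    and inj: "inj_on (cis_curve L' \<theta>') {0..1}"
  shows "\<forall>\<^sub>F n in sequentially. inj_on (cis_curve (L n) (\<theta> n)) {0..1}"
proof -
  have "uniformly_continuous_on {0..1} \<theta>'" using c by (intro compact_uniformly_continuous) auto
  then obtain d where d: "0 < d"
      "\<And>x y. x \<in> {0..1} \<Longrightarrow> y \<in> {0..1} \<Longrightarrow> dist y x < d \<Longrightarrow> dist (\<theta>' y) (\<theta>' x) < 1/4"
    unfolding uniformly_continuous_on_def by (elim allE[of _ "1/4"]) auto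
  define T where "T = {z \<in> {0..1::real} \<times> {0..1::real}. d \<le> \<bar>fst z - snd z\<bar>}"
  define \<eta> where "\<eta> = cis_curve L' \<theta>'"
  have c\<eta>: "continuous_on {0..1} \<eta>" unfolding \<eta>_def by (rule continuous_on_cis_curve[OF c(2)])
  have "T = ({0..1} \<times> {0..1}) \<inter> {z. d \<le> \<bar>fst z - snd z\<bar>}" by (auto simp: T_def)
  moreover have "closed {z :: real \<times> real. d \<le> \<bar>fst z - snd z\<bar>}"
    by (intro closed_Collect_le continuous_intros)
  ultimately have T: "compact T" by (simp add: compact_Int_closed compact_Times)
  have "\<exists>m>0. \<forall>z\<in>T. m \<le> cmod (\<eta> (fst z) - \<eta> (snd z))"
  proof (cases "T = {}")
    case False
    have "continuous_on T (\<lambda>z. cmod (\<eta> (fst z) - \<eta> (snd z)))"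
    proof (intro continuous_on_norm continuous_on_diff)
      show "continuous_on T (\<lambda>z. \<eta> (fst z))"
        by (rule continuous_on_compose2[OF c\<eta>, where f=fst]) (auto simp: T_def intro!: continuous_intros)
      show "continuous_on T (\<lambda>z. \<eta> (snd z))"
        by (rule continuous_on_compose2[OF c\<eta>, where f=snd]) (auto simp: T_def intro!: continuous_intros)
    qed
    from continuous_attains_inf[OF T False this]
    obtain z where z: "z \<in> T" "\<forall>y\<in>T. cmod (\<eta> (fst z) - \<eta> (snd z)) \<le> cmod (\<eta> (fst y) - \<eta> (snd y))"
      by blast
    have "\<eta> (fst z) \<noteq> \<eta> (snd z)"
    proof
      assume "\<eta> (fst z) = \<eta> (snd z)"
      then have "fst z = snd z" using z(1) inj by (auto simp: T_def \<eta>_def dest!: inj_onD)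
      then show False using z(1) d(1) by (simp add: T_def)
    qed
    then have "0 < cmod (\<eta> (fst z) - \<eta> (snd z))" by simp
    then show ?thesis using z(2) by blast
  next
    case True
    then show ?thesis by (intro exI[of _ 1]) simp
  qed
  then obtain m where m: "0 < m" "\<And>x y. x \<in> {0..1} \<Longrightarrow> y \<in> {0..1} \<Longrightarrow> d \<le> \<bar>x - y\<bar> \<Longrightarrow> m \<le> cmod (\<eta> x - \<eta> y)"
  proof -
    assume *: "\<And>m. 0 < m \<Longrightarrow> (\<And>x y. x \<in> {0..1} \<Longrightarrow> y \<in> {0..1} \<Longrightarrow> d \<le> \<bar>x - y\<bar> \<Longrightarrow> m \<le> cmod (\<eta> x - \<eta> y)) \<Longrightarrow> thesis"
    assume "\<exists>m>0. \<forall>z\<in>T. m \<le> cmod (\<eta> (fst z) - \<eta> (snd z))"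
    then obtain m where m: "0 < m" "\<forall>z\<in>T. m \<le> cmod (\<eta> (fst z) - \<eta> (snd z))" by blast
    show thesis
    proof (rule *[OF m(1)])
      fix x y :: real assume "x \<in> {0..1}" "y \<in> {0..1}" "d \<le> \<bar>x - y\<bar>"
      then show "m \<le> cmod (\<eta> x - \<eta> y)" using m(2)[rule_format, of "(x, y)"] by (simp add: T_def)
    qed
  qed
  have "\<forall>\<^sub>F n in sequentially. 0 < L n" using L by (intro order_tendstoD) auto
  moreover have "\<forall>\<^sub>F n in sequentially. \<forall>x\<in>{0..1}. dist (\<theta> n x) (\<theta>' x) < 1/4"
    using uniform_limitD[OF \<theta>, of "1/4"] by simp
  moreover have "\<forall>\<^sub>F n in sequentially. \<forall>x\<in>{0..1}. dist (cis_curve (L n) (\<theta> n) x) (\<eta> x) < m / 2"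
    using uniform_limitD[OF uniform_limit_cis_curve[OF L(1) \<theta> c], of "m/2"] m(1) by (simp add: \<eta>_def)
  ultimately show ?thesis
  proof eventually_elim
    case (elim n)
    have *: "cis_curve (L n) (\<theta> n) x \<noteq> cis_curve (L n) (\<theta> n) y" if xy: "0 \<le> x" "x < y" "y \<le> 1" for x y
    proof (cases "y - x < d")
      case True
      \<comment> \<open>The angle of the limit oscillates by less than 1/4 here, and each of the two
        approximations adds an error of less than 1/4.\<close>
      have "L n * (1 - 3/4) * (y - x) \<le> cmod (cis_curve (L n) (\<theta> n) y - cis_curve (L n) (\<theta> n) x)"
      proof (rule cis_curve_increment(2)[OF c(1) elim(1)])
        fix t assume t: "t \<in> {x..y}"
        then have "dist (\<theta>' t) (\<theta>' x) < 1/4" using d(2)[of x t] xy True by (auto simp: dist_real_def)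
        moreover have "dist (\<theta> n t) (\<theta>' t) < 1/4" "dist (\<theta> n x) (\<theta>' x) < 1/4" using elim(2) t xy by auto
        ultimately show "\<bar>\<theta> n t - \<theta> n x\<bar> \<le> 3/4" unfolding dist_real_def by linarith
      qed (use xy in auto)
      moreover have "0 < L n * (1 - 3/4) * (y - x)" using elim(1) xy by simp
      ultimately show ?thesis by auto
    next
      case False
      then have "m \<le> cmod (\<eta> x - \<eta> y)" using xy by (intro m(2)) auto
      moreover have "dist (cis_curve (L n) (\<theta> n) x) (\<eta> x) < m / 2" "dist (cis_curve (L n) (\<theta> n) y) (\<eta> y) < m / 2"
        using elim(3) xy by auto
      ultimately show ?thesis
        using dist_triangle[of "\<eta> x" "\<eta> y" "cis_curve (L n) (\<theta> n) x"] by (auto simp: dist_norm norm_minus_commute)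
    qed
    show ?case
    proof (rule inj_onI)
      fix x y :: real assume "x \<in> {0..1}" "y \<in> {0..1}" "cis_curve (L n) (\<theta> n) x = cis_curve (L n) (\<theta> n) y"
      then show "x = y" using *[of x y] *[of y x] by (cases x y rule: linorder_cases) auto
    qed
  qed
qed

section \<open>Curvature and arclength\<close>

lemma has_vector_derivative_quotient:
  fixes f g :: "real \<Rightarrow> complex"
  assumes "(f has_vector_derivative f') (at x within S)" "(g has_vector_derivative g') (at x within S)" "g x \<noteq> 0"
  shows "((\<lambda>x. f x / g x) has_vector_derivative (f' * g x - f x * g') / (g x)\<^sup>2) (at x within S)"
  using has_derivative_divide'[OF assms(1,2)[unfolded has_vector_derivative_def] assms(3)]
  by (simp add: has_vector_derivative_def power2_eq_square scaleR_conv_of_real algebra_simps)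

lemma has_real_derivative_Re:
  "(f has_vector_derivative f') F \<Longrightarrow> ((\<lambda>x. Re (f x)) has_real_derivative Re f') F"
  unfolding has_real_derivative_iff_has_vector_derivative
  by (rule bounded_linear.has_vector_derivative[OF bounded_linear_Re])

lemma has_real_derivative_Im:
  "(f has_vector_derivative f') F \<Longrightarrow> ((\<lambda>x. Im (f x)) has_real_derivative Im f') F"
  unfolding has_real_derivative_iff_has_vector_derivative
  by (rule bounded_linear.has_vector_derivative[OF bounded_linear_Im])

text \<open>The real part of f' / f is the logarithmic derivative of the modulus, just as its
  imaginary part is the angular speed.\<close>

lemma has_real_derivative_cmod:
  assumes "(f has_vector_derivative f') (at x within S)" "f x \<noteq> 0"
  shows "((\<lambda>x. cmod (f x)) has_real_derivative cmod (f x) * Re (f' / f x)) (at x within S)"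
proof -
  have pos: "(Re (f x))\<^sup>2 + (Im (f x))\<^sup>2 > 0"
    using assms(2) by (simp add: complex_eq_iff sum_power2_gt_zero_iff)
  have a: "((\<lambda>x. Re (f x)) has_real_derivative Re f') (at x within S)" by (rule has_real_derivative_Re[OF assms(1)])
  have b: "((\<lambda>x. Im (f x)) has_real_derivative Im f') (at x within S)" by (rule has_real_derivative_Im[OF assms(1)])
  have "((\<lambda>x. (Re (f x))\<^sup>2 + (Im (f x))\<^sup>2) has_real_derivative 2 * Re (f x) * Re f' + 2 * Im (f x) * Im f') (at x within S)"
    using DERIV_add[OF DERIV_power[OF a, of 2] DERIV_power[OF b, of 2]] by (simp add: mult_ac)
  note DERIV_chain2[OF DERIV_real_sqrt[OF pos] this, folded cmod_def]
  moreover have "(2 * Re (f x) * Re f' + 2 * Im (f x) * Im f') / (2 * cmod (f x)) = cmod (f x) * Re (f' / f x)"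
    unfolding Re_divide cmod_power2[symmetric] using assms(2) by (simp add: power2_eq_square field_simps)
  then have "inverse (cmod (f x)) / 2 * (2 * Re (f x) * Re f' + 2 * Im (f x) * Im f') = cmod (f x) * Re (f' / f x)"
    by (simp only: divide_inverse inverse_mult_distrib mult_ac)
  ultimately show ?thesis by (simp only:)
qed

text \<open>The class C^n on the unit interval, with one-sided derivatives at its ends. Quantifying
  the derivative existentially lets products, reciprocals and roots be handled by induction on n,
  with no formula for higher derivatives.\<close>

fun Cn :: "nat \<Rightarrow> (real \<Rightarrow> real) \<Rightarrow> bool" where
  "Cn 0 f = continuous_on {0..1} f"
| "Cn (Suc n) f = (\<exists>f'. (\<forall>u\<in>{0..1}. (f has_real_derivative f' u) (at u within {0..1})) \<and> Cn n f')"

lemma Cn_SucI: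
  "(\<And>u. u \<in> {0..1} \<Longrightarrow> (f has_real_derivative f' u) (at u within {0..1})) \<Longrightarrow> Cn n f' \<Longrightarrow> Cn (Suc n) f"
  unfolding Cn.simps by (intro exI[of _ f'] conjI ballI)

lemma Cn_SucE:
  assumes "Cn (Suc n) f"
  obtains f' where "\<forall>u\<in>{0..1}. (f has_real_derivative f' u) (at u within {0..1})" "Cn n f'"
proof -
  from assms have "\<exists>f'. (\<forall>u\<in>{0..1}. (f has_real_derivative f' u) (at u within {0..1})) \<and> Cn n f'"
    unfolding Cn.simps .
  then show thesis using that by blast
qed

lemma Cn_Suc_imp: "Cn (Suc n) f \<Longrightarrow> Cn n f"
proof (induction n arbitrary: f)
  case 0
  then obtain f' where f': "\<forall>u\<in>{0..1}. (f has_real_derivative f' u) (at u within {0..1})" "Cn 0 f'"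
    by (rule Cn_SucE)
  show ?case unfolding Cn.simps by (rule DERIV_continuous_on[OF bspec[OF f'(1)]])
next
  case (Suc n)
  from Suc.prems obtain f' where
    f': "\<forall>u\<in>{0..1}. (f has_real_derivative f' u) (at u within {0..1})" "Cn (Suc n) f'" by (rule Cn_SucE)
  show ?case by (rule Cn_SucI[OF bspec[OF f'(1)] Suc.IH[OF f'(2)]])
qed

lemma Cn_add: "Cn n f \<Longrightarrow> Cn n g \<Longrightarrow> Cn n (\<lambda>u. f u + g u)"
proof (induction n arbitrary: f g)
  case 0
  then show ?case by (auto intro: continuous_intros)
next
  case (Suc n)
  obtain f' where f': "\<forall>u\<in>{0..1}. (f has_real_derivative f' u) (at u within {0..1})" "Cn n f'"
    using Suc.prems(1) by (rule Cn_SucE)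
  obtain g' where g': "\<forall>u\<in>{0..1}. (g has_real_derivative g' u) (at u within {0..1})" "Cn n g'"
    using Suc.prems(2) by (rule Cn_SucE)
  show ?case by (rule Cn_SucI[OF DERIV_add[OF bspec[OF f'(1)] bspec[OF g'(1)]] Suc.IH[OF f'(2) g'(2)]])
qed

lemma Cn_mult: "Cn n f \<Longrightarrow> Cn n g \<Longrightarrow> Cn n (\<lambda>u. f u * g u)"
proof (induction n arbitrary: f g)
  case 0
  then show ?case by (auto intro: continuous_intros)
next
  case (Suc n)
  obtain f' where f': "\<forall>u\<in>{0..1}. (f has_real_derivative f' u) (at u within {0..1})" "Cn n f'"
    using Suc.prems(1) by (rule Cn_SucE)
  obtain g' where g': "\<forall>u\<in>{0..1}. (g has_real_derivative g' u) (at u within {0..1})" "Cn n g'"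
    using Suc.prems(2) by (rule Cn_SucE)
  have "Cn n f" "Cn n g" using Suc.prems Cn_Suc_imp by blast+
  then have C: "Cn n (\<lambda>u. f' u * g u + g' u * f u)" by (intro Cn_add Suc.IH f' g')
  show ?case by (rule Cn_SucI[OF DERIV_mult[OF bspec[OF f'(1)] bspec[OF g'(1)]] C])
qed

lemma Cn_const: "Cn n (\<lambda>_. c)"
  by (induction n arbitrary: c) (auto intro!: Cn_SucI[OF DERIV_const] simp del: Cn.simps(2))

lemma Cn_inverse: "Cn n f \<Longrightarrow> (\<And>u. u \<in> {0..1} \<Longrightarrow> f u \<noteq> 0) \<Longrightarrow> Cn n (\<lambda>u. inverse (f u))"
proof (induction n)
  case 0
  then show ?case by (auto intro: continuous_intros)
next
  case (Suc n)
  obtain f' where f': "\<forall>u\<in>{0..1}. (f has_real_derivative f' u) (at u within {0..1})" "Cn n f'"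
    using Suc.prems(1) by (rule Cn_SucE)
  have "Cn n (\<lambda>u. inverse (f u))" using Suc Cn_Suc_imp by blast
  then have "Cn n (\<lambda>u. (-1) * (f' u * (inverse (f u) * inverse (f u))))"
    using f' by (intro Cn_mult Cn_const)
  moreover have "((\<lambda>u. inverse (f u)) has_real_derivative (-1) * (f' u * (inverse (f u) * inverse (f u)))) (at u within {0..1})"
    if "u \<in> {0..1}" for u
    using DERIV_inverse'[OF bspec[OF f'(1) that] Suc.prems(2)[OF that]] by (simp add: mult_ac)
  ultimately show ?case by (rule Cn_SucI[rotated])
qed

lemma Cn_sqrt: "Cn n f \<Longrightarrow> (\<And>u. u \<in> {0..1} \<Longrightarrow> 0 < f u) \<Longrightarrow> Cn n (\<lambda>u. sqrt (f u))"
proof (induction n)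
  case 0
  then show ?case by (auto intro: continuous_intros)
next
  case (Suc n)
  obtain f' where f': "\<forall>u\<in>{0..1}. (f has_real_derivative f' u) (at u within {0..1})" "Cn n f'"
    using Suc.prems(1) by (rule Cn_SucE)
  have C: "Cn n (\<lambda>u. sqrt (f u))" by (rule Suc.IH[OF Cn_Suc_imp[OF Suc.prems(1)] Suc.prems(2)])
  have nz: "2 * sqrt (f u) \<noteq> 0" if "u \<in> {0..1}" for u using Suc.prems(2)[OF that] by simp
  have "Cn n (\<lambda>u. f' u * inverse (2 * sqrt (f u)))"
    by (rule Cn_mult[OF f'(2) Cn_inverse[OF Cn_mult[OF Cn_const C] nz]])
  moreover have "((\<lambda>u. sqrt (f u)) has_real_derivative f' u * inverse (2 * sqrt (f u))) (at u within {0..1})"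
    if "u \<in> {0..1}" for u
    by (rule DERIV_cong[OF DERIV_chain2[OF DERIV_real_sqrt[OF Suc.prems(2)[OF that]] bspec[OF f'(1) that]]])
      (simp only: divide_inverse inverse_mult_distrib mult_ac)
  ultimately show ?case by (rule Cn_SucI[rotated])
qed

definition speed :: "(real \<Rightarrow> complex) \<Rightarrow> real \<Rightarrow> real" where
  "speed z1 u = cmod (z1 u)"

definition unit_tangent :: "(real \<Rightarrow> complex) \<Rightarrow> real \<Rightarrow> complex" where
  "unit_tangent z1 u = z1 u / of_real (cmod (z1 u))"

text \<open>For a curve with velocity \<open>z1\<close> and acceleration \<open>z2\<close>, the
  imaginary part of the quotient is the angular speed of the tangent; dividing by the speed gives
  the turning per arclength.\<close>

definition curvature :: "(real \<Rightarrow> complex) \<Rightarrow> (real \<Rightarrow> complex) \<Rightarrow> real \<Rightarrow> real" where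
  "curvature z1 z2 u = Im (z2 u / z1 u) / cmod (z1 u)"

text \<open>\<open>ks\<close> and \<open>kss\<close> are the first two arclength derivatives of the
  curvature. The speed appears as a factor since all differentiation is in the parameter u.\<close>

definition curvature_derivatives ::
  "(real \<Rightarrow> complex) \<Rightarrow> (real \<Rightarrow> complex) \<Rightarrow> (real \<Rightarrow> real) \<Rightarrow> (real \<Rightarrow> real) \<Rightarrow> bool" where
  "curvature_derivatives z1 z2 ks kss \<longleftrightarrow>
    (\<forall>u\<in>{0..1}. (curvature z1 z2 has_real_derivative speed z1 u * ks u) (at u within {0..1})) \<and>
    (\<forall>u\<in>{0..1}. (ks has_real_derivative speed z1 u * kss u) (at u within {0..1})) \<and>
    continuous_on {0..1} kss"

lemma has_vector_derivative_unit_tangent: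
  assumes z1: "(z1 has_vector_derivative z2 u) (at u within S)" and ne: "z1 u \<noteq> 0"
  shows "(unit_tangent z1 has_vector_derivative
      \<i> * of_real (speed z1 u * curvature z1 z2 u) * unit_tangent z1 u) (at u within S)"
proof -
  have r: "((\<lambda>u. complex_of_real (cmod (z1 u))) has_vector_derivative of_real (cmod (z1 u) * Re (z2 u / z1 u))) (at u within S)"
    using has_real_derivative_cmod[OF z1 ne] unfolding has_real_derivative_iff_has_vector_derivative
    by (rule bounded_linear.has_vector_derivative[OF bounded_linear_of_real])
  have "(unit_tangent z1 has_vector_derivative
      (z2 u * of_real (cmod (z1 u)) - z1 u * of_real (cmod (z1 u) * Re (z2 u / z1 u))) / (of_real (cmod (z1 u)))\<^sup>2) (at u within S)"
    unfolding unit_tangent_def[abs_def] by (rule has_vector_derivative_quotient[OF z1 r]) (use ne in simp)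
  also have "(z2 u * of_real (cmod (z1 u)) - z1 u * of_real (cmod (z1 u) * Re (z2 u / z1 u))) / (of_real (cmod (z1 u)))\<^sup>2
    = (z2 u / z1 u - of_real (Re (z2 u / z1 u))) * unit_tangent z1 u"
    using ne by (simp add: unit_tangent_def power2_eq_square field_simps)
  also have "z2 u / z1 u - of_real (Re (z2 u / z1 u)) = \<i> * of_real (Im (z2 u / z1 u))"
    by (simp add: complex_eq_iff)
  also have "Im (z2 u / z1 u) = speed z1 u * curvature z1 z2 u"
    using ne by (simp add: speed_def curvature_def)
  finally show ?thesis .
qed

lemma Cn_components:
  fixes z :: "nat \<Rightarrow> real \<Rightarrow> complex"
  assumes d: "\<And>i u. u \<in> {0..1} \<Longrightarrow> (z i has_vector_derivative z (Suc i) u) (at u within {0..1})"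
  shows "Cn n (\<lambda>u. Re (z i u))" "Cn n (\<lambda>u. Im (z i u))"
proof (induction n arbitrary: i)
  case 0
  have "continuous_on {0..1} (z i)" for i
    using d has_vector_derivative_continuous continuous_on_eq_continuous_within by blast
  then show "Cn 0 (\<lambda>u. Re (z i u))" "Cn 0 (\<lambda>u. Im (z i u))" for i by (auto intro: continuous_intros)
next
  case (Suc n)
  show "Cn (Suc n) (\<lambda>u. Re (z i u))" for i
    by (rule Cn_SucI[OF has_real_derivative_Re[OF d] Suc(1)])
  show "Cn (Suc n) (\<lambda>u. Im (z i u))" for i
    by (rule Cn_SucI[OF has_real_derivative_Im[OF d] Suc(2)])
qed

text \<open>The curvature is a polynomial in the components of the derivatives and the reciprocal
  speed, and is therefore of every class C^n. Dividing its parameter derivative by the speed stays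
  in these classes, so the step can be repeated.\<close>

lemma curvature_derivatives_exist:
  fixes z :: "nat \<Rightarrow> real \<Rightarrow> complex"
  assumes d: "\<And>i u. u \<in> {0..1} \<Longrightarrow> (z i has_vector_derivative z (Suc i) u) (at u within {0..1})"
    and ne: "\<And>u. u \<in> {0..1} \<Longrightarrow> z 1 u \<noteq> 0"
  shows "\<exists>ks kss. curvature_derivatives (z 1) (z 2) ks kss"
proof -
  note C = Cn_components[of z, OF d]
  define N where "N = (\<lambda>u. Re (z 1 u) * Re (z 1 u) + Im (z 1 u) * Im (z 1 u))"
  have N: "N u = (speed (z 1) u)\<^sup>2" for u by (simp add: N_def speed_def cmod_power2 flip: power2_eq_square)
  have Npos: "0 < N u" if "u \<in> {0..1}" for u using ne[OF that] by (simp add: N speed_def)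
  have g_eq: "speed (z 1) = (\<lambda>u. sqrt (N u))" by (simp add: N fun_eq_iff speed_def)
  have CN: "Cn n N" for n unfolding N_def by (intro Cn_add Cn_mult C)
  then have Cg: "Cn n (speed (z 1))" for n unfolding g_eq using Npos by (intro Cn_sqrt)
  have gpos: "0 < speed (z 1) u" if "u \<in> {0..1}" for u using ne[OF that] by (simp add: speed_def)
  have Cig: "Cn n (\<lambda>u. inverse (speed (z 1) u))" for n
    by (intro Cn_inverse Cg) (metis gpos less_irrefl)
  have "curvature (z 1) (z 2) = (\<lambda>u. (Re (z 1 u) * Im (z 2 u) + (-1) * (Im (z 1 u) * Re (z 2 u)))
      * (inverse (speed (z 1) u) * (inverse (speed (z 1) u) * inverse (speed (z 1) u))))"
    unfolding fun_eq_iff curvature_def speed_def Im_divide cmod_power2[symmetric]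
    by (simp add: power2_eq_square divide_inverse algebra_simps)
  then have Ck: "Cn n (curvature (z 1) (z 2))" for n
    by (simp only:) (intro Cn_mult Cn_add Cn_const C Cig)
  from Ck[of "Suc (Suc 0)"] obtain k1 where
    k1: "\<forall>u\<in>{0..1}. (curvature (z 1) (z 2) has_real_derivative k1 u) (at u within {0..1})" "Cn (Suc 0) k1"
    by (rule Cn_SucE)
  define ks where "ks = (\<lambda>u. k1 u * inverse (speed (z 1) u))"
  have "Cn (Suc 0) ks" unfolding ks_def by (intro Cn_mult k1 Cig)
  then obtain ks1 where
    ks1: "\<forall>u\<in>{0..1}. (ks has_real_derivative ks1 u) (at u within {0..1})" "Cn 0 ks1"
    by (rule Cn_SucE)
  define kss where "kss = (\<lambda>u. ks1 u * inverse (speed (z 1) u))"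
  have "Cn 0 kss" unfolding kss_def by (intro Cn_mult ks1 Cig)
  then have c: "continuous_on {0..1} kss" unfolding Cn.simps .
  have e: "speed (z 1) u * (x * inverse (speed (z 1) u)) = x" if "u \<in> {0..1}" for u x
    using gpos[OF that] by simp
  have "(curvature (z 1) (z 2) has_real_derivative speed (z 1) u * ks u) (at u within {0..1})"
    "(ks has_real_derivative speed (z 1) u * kss u) (at u within {0..1})" if "u \<in> {0..1}" for u
    using bspec[OF k1(1) that] bspec[OF ks1(1) that] e[OF that] by (simp_all only: ks_def kss_def)
  with c show ?thesis unfolding curvature_derivatives_def by blast
qed

section \<open>Translation between the complex plane and \<open>real \<times> real\<close>\<close>

definition pr :: "complex \<Rightarrow> real \<times> real" where "pr z = (Re z, Im z)"

lemma pr_simps: "pr (z + w) = pr z + pr w" "pr (z - w) = pr z - pr w" "r *\<^sub>R pr z = pr (of_real r * z)"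
    "- pr z = pr (- z)" "norm (pr z) = cmod z" "pr z = pr w \<longleftrightarrow> z = w" "pr z \<bullet> pr w = Re (z * cnj w)"
  by (auto simp: pr_def norm_Pair cmod_def complex_eq_iff)

lemma has_vector_derivative_pr:
  "(f has_vector_derivative f') (at x within S) \<Longrightarrow> ((\<lambda>x. pr (f x)) has_vector_derivative pr f') (at x within S)"
  unfolding pr_def
  by (intro has_vector_derivative_Pair bounded_linear.has_vector_derivative[OF bounded_linear_Re]
      bounded_linear.has_vector_derivative[OF bounded_linear_Im])

text \<open>A normal field has the form i f T with a real function f. Since T_s = i k T,
  differentiating T contributes only a tangential term, which \<open>nabla_s\<close> removes: the
  field becomes i f_s T. Starting from the curvature vector i k T, two applications give i k_ss
  T.\<close>

lemma geometry_of_pr_curve: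
  fixes z :: "nat \<Rightarrow> real \<Rightarrow> complex" and c :: "real \<Rightarrow> real \<times> real"
  assumes d: "\<And>i u. u \<in> {0..1} \<Longrightarrow> (z i has_vector_derivative z (Suc i) u) (at u within {0..1})"
    and ne: "\<And>u. u \<in> {0..1} \<Longrightarrow> z 1 u \<noteq> 0"
    and c: "\<And>u. u \<in> {0..1} \<Longrightarrow> c u = pr (z 0 u)"
    and ks: "curvature_derivatives (z 1) (z 2) ks kss"
    and u: "u \<in> {0..1}"
  shows "norm (d1 {0..1} c u) = speed (z 1) u"
    and "signed_curv {0..1} c u = curvature (z 1) (z 2) u"
    and "curv_vec {0..1} c u = pr (\<i> * of_real (curvature (z 1) (z 2) u) * unit_tangent (z 1) u)"
    and "nabla_s {0..1} c (nabla_s {0..1} c (curv_vec {0..1} c)) u = pr (\<i> * of_real (kss u) * unit_tangent (z 1) u)"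
proof -
  define g where "g = speed (z 1)"
  define k where "k = curvature (z 1) (z 2)"
  define T where "T = unit_tangent (z 1)"
  have gpos: "0 < g u" if "u \<in> {0..1}" for u using ne[OF that] by (simp add: speed_def g_def)
  have gT: "z 1 u = of_real (g u) * T u" if "u \<in> {0..1}" for u
    using ne[OF that] by (simp add: g_def T_def speed_def unit_tangent_def)
  have TT: "T u * cnj (T u) = 1" if "u \<in> {0..1}" for u
    using ne[OF that] by (simp add: T_def unit_tangent_def complex_norm_square[symmetric] flip: of_real_mult power2_eq_square)
  have dT: "(T has_vector_derivative \<i> * of_real (g u * k u) * T u) (at u within {0..1})" if "u \<in> {0..1}" for u
    unfolding T_def g_def k_def using has_vector_derivative_unit_tangent[of "z 1" "z 2", OF _ ne[OF that]] d[OF that, of 1]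
    by (simp add: numeral_2_eq_2)
  have d0: "(z 0 has_vector_derivative z 1 u) (at u within {0..1})" if "u \<in> {0..1}" for u
    using d[OF that, of 0] by simp
  have dc: "(c has_vector_derivative pr (z 1 u)) (at u within {0..1})" if "u \<in> {0..1}" for u
    by (rule has_vector_derivative_transform[OF that c has_vector_derivative_pr[OF d0[OF that]]])
  have dc1: "((\<lambda>u. pr (z 1 u)) has_vector_derivative pr (z 2 u)) (at u within {0..1})" if "u \<in> {0..1}" for u
    using has_vector_derivative_pr[OF d[OF that, of 1]] by (simp add: numeral_2_eq_2)
  have dd: "d1 {0..1} c u = pr (z 1 u)" "d2 {0..1} c u = pr (z 2 u)" if "u \<in> {0..1}" for u
    using d1_d2_eq[of 0 1 c "\<lambda>u. pr (z 1 u)" "\<lambda>u. pr (z 2 u)" u] dc dc1 that by auto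
  have n1: "norm (d1 {0..1} c u) = speed (z 1) u" if "u \<in> {0..1}" for u
    unfolding dd[OF that] by (simp add: pr_simps speed_def)
  then show "norm (d1 {0..1} c u) = speed (z 1) u" using u by simp
  show "signed_curv {0..1} c u = curvature (z 1) (z 2) u"
    using u ne[OF u]
    unfolding signed_curv_def dd[OF u] pr_simps(5) curvature_def speed_def Im_divide cmod_power2[symmetric]
    by (simp add: pr_def power2_eq_square power3_eq_cube field_simps)
  have ds_eq: "ds {0..1} c \<psi> u = pr (\<Psi>' / of_real (g u))"
    if u: "u \<in> {0..1}" and \<psi>: "\<And>v. v \<in> {0..1} \<Longrightarrow> \<psi> v = pr (\<Psi> v)"
      and \<Psi>: "(\<Psi> has_vector_derivative \<Psi>') (at u within {0..1})" for \<psi> \<Psi> \<Psi>' u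
  proof -
    have "(\<psi> has_vector_derivative pr \<Psi>') (at u within {0..1})"
      by (rule has_vector_derivative_transform[OF u \<psi> has_vector_derivative_pr[OF \<Psi>]])
    then have "vector_derivative \<psi> (at u within {0..1}) = pr \<Psi>'"
      by (rule vector_derivative_within_closed_interval[OF zero_less_one u])
    then show ?thesis
      unfolding ds_def n1[OF u] by (simp add: pr_simps g_def)
  qed
  have tan: "tangent {0..1} c u = pr (T u)" if "u \<in> {0..1}" for u
    unfolding tangent_def using ds_eq[OF that c d0[OF that]] gT[OF that] gpos[OF that] by simp
  have cv: "curv_vec {0..1} c u = pr (\<i> * of_real (k u) * T u)" if "u \<in> {0..1}" for u
    unfolding curv_vec_def using ds_eq[OF that tan dT[OF that]] gpos[OF that] by (simp add: field_simps)
  show "curv_vec {0..1} c u = pr (\<i> * of_real (curvature (z 1) (z 2) u) * unit_tangent (z 1) u)"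
    using cv[OF u] by (simp add: k_def T_def)
  have nabla: "nabla_s {0..1} c \<psi> u = pr (\<i> * of_real f' * T u)"
    if u: "u \<in> {0..1}" and \<psi>: "\<And>v. v \<in> {0..1} \<Longrightarrow> \<psi> v = pr (\<i> * of_real (f v) * T v)"
      and f: "(f has_real_derivative g u * f') (at u within {0..1})" for \<psi> f f' u
  proof -
    have f2: "((\<lambda>v. \<i> * of_real (f v)) has_vector_derivative \<i> * of_real (g u * f')) (at u within {0..1})"
      using f unfolding has_real_derivative_iff_has_vector_derivative
      by (intro bounded_linear.has_vector_derivative[OF bounded_linear_mult_right]
          bounded_linear.has_vector_derivative[OF bounded_linear_of_real])
    have "ds {0..1} c \<psi> u = pr ((\<i> * of_real (f u) * (\<i> * of_real (g u * k u) * T u) + \<i> * of_real (g u * f') * T u) / of_real (g u))"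
      by (rule ds_eq[OF u \<psi> has_vector_derivative_mult[OF f2 dT[OF u]]])
    also have "(\<i> * of_real (f u) * (\<i> * of_real (g u * k u) * T u) + \<i> * of_real (g u * f') * T u) / of_real (g u)
        = (\<i> * of_real f' - of_real (f u * k u)) * T u"
      using gpos[OF u] by (simp add: field_simps)
    finally have ds: "ds {0..1} c \<psi> u = pr ((\<i> * of_real f' - of_real (f u * k u)) * T u)" .
    have "ds {0..1} c \<psi> u \<bullet> tangent {0..1} c u = Re ((\<i> * of_real f' - of_real (f u * k u)) * (T u * cnj (T u)))"
      unfolding ds tan[OF u] pr_simps by (simp only: mult.assoc)
    also have "\<dots> = - f u * k u" by (simp only: TT[OF u]) simp
    finally have ip: "ds {0..1} c \<psi> u \<bullet> tangent {0..1} c u = - f u * k u" .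
    have "nabla_s {0..1} c \<psi> u = pr ((\<i> * of_real f' - of_real (f u * k u)) * T u) - (- f u * k u) *\<^sub>R pr (T u)"
      unfolding nabla_s_def ip unfolding ds tan[OF u] ..
    also have "\<dots> = pr ((\<i> * of_real f' - of_real (f u * k u)) * T u - of_real (- f u * k u) * T u)"
      by (simp only: pr_simps)
    also have "(\<i> * of_real f' - of_real (f u * k u)) * T u - of_real (- f u * k u) * T u = \<i> * of_real f' * T u"
      by (simp add: algebra_simps)
    finally show ?thesis .
  qed
  have n1: "nabla_s {0..1} c (curv_vec {0..1} c) v = pr (\<i> * of_real (ks v) * T v)" if "v \<in> {0..1}" for v
    by (rule nabla[OF that cv]) (use ks that in \<open>simp_all add: curvature_derivatives_def k_def g_def\<close>)
  show "nabla_s {0..1} c (nabla_s {0..1} c (curv_vec {0..1} c)) u = pr (\<i> * of_real (kss u) * unit_tangent (z 1) u)"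
    unfolding T_def[symmetric] by (rule nabla[OF u n1]) (use ks u in \<open>simp_all add: curvature_derivatives_def g_def\<close>)
qed

section \<open>Reparametrization to constant speed\<close>

lemma positive_derivative_inverse:
  fixes f f' :: "real \<Rightarrow> real"
  assumes d: "\<And>x. (f has_real_derivative f' x) (at x)" and m: "0 < m" "\<And>x. m \<le> f' x"
  obtains h where "\<And>x. h (f x) = x" "\<And>y. f (h y) = y" "\<And>y. (h has_real_derivative 1 / f' (h y)) (at y)"
proof -
  have diff: "m * (y - x) \<le> f y - f x" if "x \<le> y" for x y
  proof -
    have "((\<lambda>x. m * x) has_real_derivative m) (at x)" for x
      by (auto intro!: derivative_eq_intros)
    from increment_le[OF that this d m(2)] show ?thesis by (simp add: algebra_simps)
  qed
  have mono: "f x < f y" if "x < y" for x y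
  proof -
    have "0 < m * (y - x)" using m(1) that by simp
    then show ?thesis using diff[of x y] that by simp
  qed
  have inj: "f x = f y \<longleftrightarrow> x = y" for x y
    using mono[of x y] mono[of y x] by (cases x y rule: linorder_cases) auto
  have cont: "isCont f x" for x using d DERIV_isCont by blast
  have surj: "\<exists>x. f x = y" for y
  proof -
    define R where "R = \<bar>y - f 0\<bar> / m"
    have R: "0 \<le> R" "m * R = \<bar>y - f 0\<bar>" using m(1) by (auto simp: R_def)
    have "\<exists>x\<ge>- R. x \<le> R \<and> f x = y"
      by (rule IVT) (use R diff[of 0 R] diff[of "- R" 0] cont in auto)
    then show ?thesis by blast
  qed
  define h where "h = inv f"
  have hf: "h (f x) = x" for x unfolding h_def by (rule inv_f_f) (auto simp: inj_def inj)
  have fh: "f (h y) = y" for y using surj[of y] hf by metis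
  have "(h has_real_derivative 1 / f' (h y)) (at y)" for y
  proof -
    have "isCont h (f (h y))"
      by (rule isCont_inverse_function[where d=1]) (auto simp: hf cont)
    then have "isCont h y" by (simp add: fh)
    moreover have "f' (h y) \<noteq> 0" using m(1) m(2)[of "h y"] by auto
    ultimately have "(h has_real_derivative inverse (f' (h y))) (at y)"
      by (intro DERIV_inverse_function[OF d, where a="y-1" and b="y+1"]) (auto simp: fh)
    then show ?thesis by (simp add: divide_inverse)
  qed
  with hf fh show ?thesis by (rule that)
qed

text \<open>\<open>h\<close> is the fraction of arclength covered. The angle is not selected
  pointwise but integrated from the curvature, starting at the principal argument of
  \<open>T 0\<close>: this makes it differentiable and bounds its initial value by pi. The last
  clause turns integrals against arclength into integrals over the unit interval.\<close>

lemma constant_speed_normal_form: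
  fixes z :: "real \<Rightarrow> complex" and T :: "real \<Rightarrow> complex" and g k ks kss :: "real \<Rightarrow> real"
  assumes g: "continuous_on {0..1} g" "\<And>u. u \<in> {0..1} \<Longrightarrow> 0 < g u"
    and z: "\<And>u. u \<in> {0..1} \<Longrightarrow> (z has_vector_derivative of_real (g u) * T u) (at u within {0..1})"
    and T: "\<And>u. u \<in> {0..1} \<Longrightarrow> (T has_vector_derivative \<i> * of_real (g u * k u) * T u) (at u within {0..1})"
    and T1: "\<And>u. u \<in> {0..1} \<Longrightarrow> cmod (T u) = 1"
    and k: "\<And>u. u \<in> {0..1} \<Longrightarrow> (k has_real_derivative g u * ks u) (at u within {0..1})"
    and ks: "\<And>u. u \<in> {0..1} \<Longrightarrow> (ks has_real_derivative g u * kss u) (at u within {0..1})"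
    and kss: "continuous_on {0..1} kss" and z0: "z 0 = 0"
    and L: "L = integral {0..1} g"
  obtains h \<theta> \<kappa> p f where
    "0 < L" "bij_betw h {0..1} {0..1}" "h 0 = 0" "h 1 = 1"
    "\<And>x. x \<in> {0..1} \<Longrightarrow> (\<theta> has_real_derivative L * \<kappa> x) (at x within {0..1})"
    "\<And>x. x \<in> {0..1} \<Longrightarrow> (\<kappa> has_real_derivative L * p x) (at x within {0..1})"
    "\<And>x. x \<in> {0..1} \<Longrightarrow> (p has_real_derivative L * f x) (at x within {0..1})"
    "continuous_on {0..1} f" "\<bar>\<theta> 0\<bar> \<le> pi"
    "\<And>u. u \<in> {0..1} \<Longrightarrow> z u = cis_curve L \<theta> (h u)"
    "\<And>u. u \<in> {0..1} \<Longrightarrow> \<kappa> (h u) = k u" "\<And>u. u \<in> {0..1} \<Longrightarrow> f (h u) = kss u"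
    "\<And>\<phi> :: real \<Rightarrow> real. continuous_on {0..1} \<phi> \<Longrightarrow> integral {0..1} (\<lambda>u. \<phi> (h u) * g u) = L * integral {0..1} \<phi>"
proof -
  \<comment> \<open>Continuing the speed by its end values gives a function on the whole line with a
    positive lower bound. The arclength is then a bijection of the line, and its inverse is
    differentiable also at the end points.\<close>
  define G where "G = (\<lambda>u. g (max 0 (min 1 u)))"
  have G_eq: "G u = g u" if "u \<in> {0..1}" for u using that by (simp add: G_def)
  have G: "continuous_on UNIV G" unfolding G_def
    by (rule continuous_on_compose2[OF g(1)]) (auto intro!: continuous_intros)
  obtain x0 where x0: "x0 \<in> {0..1}" "\<And>y. y \<in> {0..1} \<Longrightarrow> g x0 \<le> g y"
    using continuous_attains_inf[OF compact_Icc _ g(1)] by auto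
  have G_ge: "g x0 \<le> G u" for u unfolding G_def by (rule x0(2)) auto
  have "integral {0..1::real} (\<lambda>_. g x0) \<le> integral {0..1} g"
    using x0 g(1) by (intro integral_le integrable_continuous_real) auto
  then have Lpos: "0 < L" using g(2)[OF x0(1)] by (simp add: L)
  define H where "H = (\<lambda>u. sint0 G u / L)"
  have dH: "(H has_real_derivative G u / L) (at u)" for u
    unfolding H_def by (rule DERIV_cdivide[OF sint0_has_real_derivative[OF G]])
  obtain \<sigma> where \<sigma>: "\<And>x. \<sigma> (H x) = x" "\<And>y. H (\<sigma> y) = y" "\<And>y. (\<sigma> has_real_derivative 1 / (G (\<sigma> y) / L)) (at y)"
  proof (rule positive_derivative_inverse[OF dH])
    show "0 < g x0 / L" using g(2)[OF x0(1)] Lpos by simp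
    show "g x0 / L \<le> G x / L" for x using G_ge Lpos by (simp add: divide_right_mono)
  qed blast
  have H0: "H 0 = 0" by (simp add: H_def sint0_0)
  have "integral {0..1} G = integral {0..1} g" by (rule integral_cong) (rule G_eq)
  then have H1: "H 1 = 1" using Lpos by (simp add: H_def sint0_def L)
  have H_mono: "H x \<le> H y" if "x \<le> y" for x y
  proof (rule DERIV_nonneg_imp_nondecreasing[OF that])
    show "\<exists>d. (H has_real_derivative d) (at u) \<and> 0 \<le> d" for u
      using dH[of u] G_ge[of u] g(2)[OF x0(1)] Lpos by (intro exI[of _ "G u / L"]) auto
  qed
  have H_in: "H u \<in> {0..1}" if "u \<in> {0..1}" for u
    using H_mono[of 0 u] H_mono[of u 1] H0 H1 that by simp
  have \<sigma>_in: "\<sigma> x \<in> {0..1}" if "x \<in> {0..1}" for x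
  proof (rule ccontr)
    assume "\<sigma> x \<notin> {0..1}"
    then consider "\<sigma> x \<le> 0" "\<sigma> x \<noteq> 0" | "1 \<le> \<sigma> x" "\<sigma> x \<noteq> 1" by force
    then show False
    proof cases
      case 1
      then have "x \<le> 0" using H_mono[of "\<sigma> x" 0] H0 \<sigma>(2)[of x] by simp
      with that have "x = H 0" using H0 by simp
      then show False using \<sigma>(1)[of 0] 1 by simp
    next
      case 2
      then have "1 \<le> x" using H_mono[of 1 "\<sigma> x"] H1 \<sigma>(2)[of x] by simp
      with that have "x = H 1" using H1 by simp
      then show False using \<sigma>(1)[of 1] 2 by simp
    qed
  qed
  have bij: "bij_betw H {0..1} {0..1}"
    by (rule bij_betw_byWitness[of _ \<sigma>]) (use \<sigma>(1,2) H_in \<sigma>_in in auto)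
  have img: "\<sigma> ` {0..1} \<subseteq> {0..1}" using \<sigma>_in by blast
  have d\<sigma>: "(\<sigma> has_real_derivative L / g (\<sigma> x)) (at x within {0..1})" if "x \<in> {0..1}" for x
    using \<sigma>(3)[of x] G_eq[OF \<sigma>_in[OF that]] by (simp add: has_field_derivative_at_within)
  have c\<sigma>: "continuous_on {0..1} \<sigma>" using d\<sigma> by (rule DERIV_continuous_on)
  have chain: "((\<lambda>x. F (\<sigma> x)) has_real_derivative L * F' (\<sigma> x)) (at x within {0..1})"
    if F: "\<And>u. u \<in> {0..1} \<Longrightarrow> (F has_real_derivative g u * F' u) (at u within {0..1})" and x: "x \<in> {0..1}" for F F' x
  proof -
    have "(F \<circ> \<sigma> has_real_derivative (g (\<sigma> x) * F' (\<sigma> x)) * (L / g (\<sigma> x))) (at x within {0..1})"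
      by (rule DERIV_image_chain[OF has_field_derivative_subset[OF F[OF \<sigma>_in[OF x]] img] d\<sigma>[OF x]])
    then show ?thesis using g(2)[OF \<sigma>_in[OF x]] by (simp add: o_def mult.commute)
  qed
  have vchain: "((\<lambda>x. F (\<sigma> x)) has_vector_derivative of_real L * F' (\<sigma> x)) (at x within {0..1})"
    if F: "\<And>u. u \<in> {0..1} \<Longrightarrow> (F has_vector_derivative of_real (g u) * F' u) (at u within {0..1})" and x: "x \<in> {0..1}"
    for F F' :: "real \<Rightarrow> complex" and x
  proof -
    have "(F \<circ> \<sigma> has_vector_derivative (L / g (\<sigma> x)) *\<^sub>R (of_real (g (\<sigma> x)) * F' (\<sigma> x))) (at x within {0..1})"
      by (rule vector_diff_chain_within[OF d\<sigma>[OF x, unfolded has_real_derivative_iff_has_vector_derivative]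
            has_vector_derivative_within_subset[OF F[OF \<sigma>_in[OF x]] img]])
    then show ?thesis using g(2)[OF \<sigma>_in[OF x]] by (simp add: o_def scaleR_conv_of_real)
  qed
  define \<kappa> p f where "\<kappa> = (\<lambda>x. k (\<sigma> x))" and "p = (\<lambda>x. ks (\<sigma> x))" and "f = (\<lambda>x. kss (\<sigma> x))"
  define \<theta> where "\<theta> = (\<lambda>x. Arg (T 0) + integral {0..x} (\<lambda>y. L * \<kappa> y))"
  have d\<kappa>: "(\<kappa> has_real_derivative L * p x) (at x within {0..1})" if "x \<in> {0..1}" for x
    unfolding \<kappa>_def p_def by (rule chain[OF k that])
  have dp: "(p has_real_derivative L * f x) (at x within {0..1})" if "x \<in> {0..1}" for x
    unfolding p_def f_def by (rule chain[OF ks that])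
  have cf: "continuous_on {0..1} f"
    unfolding f_def by (rule continuous_on_compose2[OF kss c\<sigma> img])
  have c\<kappa>: "continuous_on {0..1} \<kappa>" using d\<kappa> by (rule DERIV_continuous_on)
  have d\<theta>: "(\<theta> has_real_derivative L * \<kappa> x) (at x within {0..1})" if "x \<in> {0..1}" for x
  proof -
    have "((\<lambda>x. integral {0..x} (\<lambda>y. L * \<kappa> y)) has_real_derivative L * \<kappa> x) (at x within {0..1})"
      using that by (intro integral_has_real_derivative continuous_intros c\<kappa>)
    from DERIV_add[OF DERIV_const this] show ?thesis by (simp add: \<theta>_def)
  qed
  have c\<theta>: "continuous_on {0..1} \<theta>" using d\<theta> by (rule DERIV_continuous_on)
  have \<sigma>0: "\<sigma> 0 = 0" using \<sigma>(1)[of 0] H0 by simp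
  have "T 0 \<noteq> 0" using T1[of 0] by auto
  then have \<theta>0: "cis (\<theta> 0) = T 0"
    using T1[of 0] by (simp add: \<theta>_def cis_Arg sgn_div_norm)
  \<comment> \<open>The two factors turn at the same rate in opposite senses, so the product keeps
    its value at 0, which is 1.\<close>
  have "((\<lambda>x. T (\<sigma> x) * cnj (cis (\<theta> x))) has_vector_derivative 0) (at x within {0..1})" if x: "x \<in> {0..1}" for x
  proof -
    have "((\<lambda>x. T (\<sigma> x)) has_vector_derivative of_real L * (\<i> * of_real (k (\<sigma> x)) * T (\<sigma> x))) (at x within {0..1})"
      by (rule vchain[OF _ x]) (use T in \<open>simp add: mult_ac\<close>)
    from has_vector_derivative_mult[OF this has_vector_derivative_cnj[OF has_vector_derivative_cis[OF d\<theta>[OF x]]]]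
    show ?thesis by (rule has_vector_derivative_eq_rhs) (simp add: \<kappa>_def)
  qed
  then obtain c where c: "T (\<sigma> x) * cnj (cis (\<theta> x)) = c" if "x \<in> {0..1}" for x
    using has_vector_derivative_zero_constant[of "{0..1}" "\<lambda>x. T (\<sigma> x) * cnj (cis (\<theta> x))"] by auto
  have "c = 1" using c[of 0] by (simp add: \<sigma>0 flip: \<theta>0) (simp add: cis_mult cis_cnj)
  have T_eq: "T (\<sigma> x) = cis (\<theta> x)" if "x \<in> {0..1}" for x
  proof -
    have "T (\<sigma> x) * (cnj (cis (\<theta> x)) * cis (\<theta> x)) = cis (\<theta> x)"
      using c[OF that] \<open>c = 1\<close> by (simp flip: mult.assoc)
    then show ?thesis by (simp add: cis_cnj cis_mult)
  qed
  have z_eq: "z (\<sigma> x) = cis_curve L \<theta> x" if x: "x \<in> {0..1}" for x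
  proof -
    have "((\<lambda>y. of_real L * T (\<sigma> y)) has_integral z (\<sigma> x) - z (\<sigma> 0)) {0..x}"
      by (rule has_integral_increment[OF vchain[OF z]]) (use x in auto)
    then have "((\<lambda>y. of_real L * cis (\<theta> y)) has_integral z (\<sigma> x) - z (\<sigma> 0)) {0..x}"
      by (rule has_integral_eq[rotated]) (use x T_eq in auto)
    then show ?thesis by (simp add: cis_curve_def has_integral_iff \<sigma>0 z0)
  qed
  have subst: "integral {0..1} (\<lambda>u. \<phi> (H u) * g u) = L * integral {0..1} \<phi>"
    if \<phi>: "continuous_on {0..1} \<phi>" for \<phi> :: "real \<Rightarrow> real"
  proof -
    have "((\<lambda>u. (g u / L) *\<^sub>R \<phi> (H u)) has_integral integral {H 0..H 1} \<phi>) {0..1}"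
    proof (rule has_integral_substitution[where c=0 and d=1])
      show "(H has_real_derivative g u / L) (at u within {0..1})" if "u \<in> {0..1}" for u
        using dH[of u] G_eq[OF that] by (simp add: has_field_derivative_at_within)
    qed (use H_in H0 H1 \<phi> in auto)
    from has_integral_mult_right[OF this, of L] show ?thesis
      using Lpos by (simp add: H0 H1 has_integral_iff mult.commute)
  qed
  show ?thesis
  proof (rule that[of H \<theta> \<kappa> p f])
    show "\<bar>\<theta> 0\<bar> \<le> pi" using Arg_bounded[of "T 0"] by (simp add: \<theta>_def abs_le_iff)
    show "z u = cis_curve L \<theta> (H u)" if "u \<in> {0..1}" for u
      using z_eq[OF H_in[OF that]] by (simp add: \<sigma>(1))
  qed (use Lpos bij H0 H1 d\<theta> d\<kappa> dp cf subst in \<open>auto simp: \<kappa>_def f_def \<sigma>(1)\<close>)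
qed

section \<open>Energy dissipation\<close>

lemma at_within_atLeast_interior: "0 < t \<Longrightarrow> at t within {0..} = at (t::real)"
  by (rule at_within_interior) simp

text \<open>The plane is identified with \<open>complex\<close>, and \<open>Z i j\<close> is the derivative of the flow of order \<open>i\<close> in space
  and \<open>j\<close> in time.\<close>
locale complex_elastic_flow =
  fixes lam l :: real and Z :: "nat \<Rightarrow> nat \<Rightarrow> real \<Rightarrow> real \<Rightarrow> complex"
  assumes lam: "0 < lam" and l: "0 < l"
    and cont: "\<And>i j. continuous_on ({0..1} \<times> {0..}) (\<lambda>(u, t). Z i j u t)"
    and du: "\<And>i j u t. u \<in> {0..1} \<Longrightarrow> 0 \<le> t \<Longrightarrow> ((\<lambda>v. Z i j v t) has_vector_derivative Z (Suc i) j u t) (at u within {0..1})"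
    and dt: "\<And>i j u t. u \<in> {0..1} \<Longrightarrow> 0 \<le> t \<Longrightarrow> ((\<lambda>\<tau>. Z i j u \<tau>) has_vector_derivative Z i (Suc j) u t) (at t within {0..})"
    and ne: "\<And>u t. u \<in> {0..1} \<Longrightarrow> 0 \<le> t \<Longrightarrow> Z 1 0 u t \<noteq> 0"
    and ends: "\<And>t. 0 < t \<Longrightarrow> Z 0 0 0 t = 0" "\<And>t. 0 < t \<Longrightarrow> Z 0 0 1 t = of_real l"
    and curvature_ends: "\<And>t. 0 < t \<Longrightarrow> curvature (\<lambda>u. Z 1 0 u t) (\<lambda>u. Z 2 0 u t) 0 = 0"
      "\<And>t. 0 < t \<Longrightarrow> curvature (\<lambda>u. Z 1 0 u t) (\<lambda>u. Z 2 0 u t) 1 = 0"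
    and flow: "\<And>t. 0 < t \<Longrightarrow> \<exists>ks kss. curvature_derivatives (\<lambda>u. Z 1 0 u t) (\<lambda>u. Z 2 0 u t) ks kss \<and>
        (\<forall>u\<in>{0..1}. Z 0 1 u t = \<i> * of_real (- 2 * kss u - (curvature (\<lambda>u. Z 1 0 u t) (\<lambda>u. Z 2 0 u t) u) ^ 3
            + lam * curvature (\<lambda>u. Z 1 0 u t) (\<lambda>u. Z 2 0 u t) u) * unit_tangent (\<lambda>u. Z 1 0 u t) u)"
begin

definition g where "g u t = cmod (Z 1 0 u t)"
definition k where "k u t = Im (Z 2 0 u t / Z 1 0 u t) / g u t"
definition T where "T u t = Z 1 0 u t / of_real (g u t)"
text \<open>The normal velocity, read off from the motion instead of from the curvature. It thereby
  has a meaning at t = 0 as well, where the equation of motion is not assumed.\<close>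

definition v where "v u t = Im (Z 0 1 u t / T u t)"
definition energy where "energy t = integral {0..1} (\<lambda>u. (k u t)\<^sup>2 * g u t + lam * g u t)"
definition dissipation where "dissipation t = integral {0..1} (\<lambda>u. (v u t)\<^sup>2 * g u t)"
definition arclength_integral where "arclength_integral F t = integral {0..1} (\<lambda>u. F (Z 0 0 u t) * g u t)" for F :: "complex \<Rightarrow> real"

lemma speed_curvature_tangent_eq:
  "speed (\<lambda>u. Z 1 0 u t) u = g u t" "curvature (\<lambda>u. Z 1 0 u t) (\<lambda>u. Z 2 0 u t) u = k u t"
  "unit_tangent (\<lambda>u. Z 1 0 u t) u = T u t"
  by (simp_all add: speed_def g_def curvature_def k_def unit_tangent_def T_def)

lemma g_pos: "u \<in> {0..1} \<Longrightarrow> 0 \<le> t \<Longrightarrow> 0 < g u t"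
  using ne by (simp add: g_def)

lemma flow_at:
  assumes "0 < t"
  obtains ks kss where
    "\<And>u. u \<in> {0..1} \<Longrightarrow> ((\<lambda>u. k u t) has_real_derivative g u t * ks u) (at u within {0..1})"
    "\<And>u. u \<in> {0..1} \<Longrightarrow> (ks has_real_derivative g u t * kss u) (at u within {0..1})"
    "continuous_on {0..1} kss"
    "\<And>u. u \<in> {0..1} \<Longrightarrow> Z 0 1 u t = \<i> * of_real (v u t) * T u t"
    "\<And>u. u \<in> {0..1} \<Longrightarrow> v u t = - 2 * kss u - k u t ^ 3 + lam * k u t"
proof -
  have k_eta: "curvature (\<lambda>u. Z 1 0 u t) (\<lambda>u. Z 2 0 u t) = (\<lambda>u. k u t)"
    by (rule ext) (rule speed_curvature_tangent_eq)
  obtain ks kss where *: "\<forall>u\<in>{0..1}. ((\<lambda>u. k u t) has_real_derivative g u t * ks u) (at u within {0..1})"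
    "\<forall>u\<in>{0..1}. (ks has_real_derivative g u t * kss u) (at u within {0..1})"
    "continuous_on {0..1} kss"
    "\<forall>u\<in>{0..1}. Z 0 1 u t = \<i> * of_real (- 2 * kss u - k u t ^ 3 + lam * k u t) * T u t"
    using flow[OF assms] unfolding curvature_derivatives_def k_eta speed_curvature_tangent_eq by blast
  have v: "v u t = - 2 * kss u - k u t ^ 3 + lam * k u t" if u: "u \<in> {0..1}" for u
  proof -
    have "T u t \<noteq> 0" using ne[OF u, of t] assms by (simp add: T_def g_def)
    then show ?thesis unfolding v_def bspec[OF *(4) u] by simp
  qed
  show ?thesis
    by (rule that[of ks kss]) (use * v in auto)
qed

text \<open>The Leibniz rule used below expects the differentiated parameter, here time, as the
  first coordinate.\<close>

lemma cont_swap: "continuous_on ({0..} \<times> {0..1}) (\<lambda>x. Z i j (snd x) (fst x))"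
proof -
  have "continuous_on ({0..} \<times> {0..1}) ((\<lambda>(u, t). Z i j u t) \<circ> (\<lambda>x. (snd x, fst x)))"
    by (rule continuous_on_compose) (auto intro!: continuous_intros continuous_on_subset[OF cont])
  then show ?thesis by (simp add: o_def)
qed

lemma cont_slice:
  assumes "0 \<le> t"
  shows "continuous_on {0..1} (\<lambda>u. Z i j u t)"
  using du[OF _ assms] has_vector_derivative_continuous continuous_on_eq_continuous_within by blast

lemma continuous_on_g: "0 \<le> t \<Longrightarrow> continuous_on {0..1} (\<lambda>u. g u t)"
  unfolding g_def by (intro continuous_intros cont_slice)

lemma continuous_on_k: "0 \<le> t \<Longrightarrow> continuous_on {0..1} (\<lambda>u. k u t)"
  unfolding k_def g_def using ne by (intro continuous_intros cont_slice) auto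

lemma continuous_on_v: "0 \<le> t \<Longrightarrow> continuous_on {0..1} (\<lambda>u. v u t)"
  unfolding v_def T_def g_def using ne by (intro continuous_intros cont_slice) auto

section \<open>Evolution of speed, curvature and energy\<close>

definition gt where "gt u t = g u t * Re (Z 1 1 u t / Z 1 0 u t)"
text \<open>The turning rate per unit of the parameter u, that is \<open>k * g\<close>, and not a
  modulus. In terms of it the bending density is q^2 / g.\<close>

definition q where "q u t = Im (Z 2 0 u t / Z 1 0 u t)"
definition qt where "qt u t = Im ((Z 2 1 u t * Z 1 0 u t - Z 2 0 u t * Z 1 1 u t) / (Z 1 0 u t)\<^sup>2)"

lemma dt_g: "u \<in> {0..1} \<Longrightarrow> 0 \<le> t \<Longrightarrow> ((\<lambda>\<tau>. g u \<tau>) has_real_derivative gt u t) (at t within {0..})"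
  unfolding g_def gt_def using has_real_derivative_cmod[OF dt ne] by simp

lemma dt_q: "u \<in> {0..1} \<Longrightarrow> 0 \<le> t \<Longrightarrow> ((\<lambda>\<tau>. q u \<tau>) has_real_derivative qt u t) (at t within {0..})"
  unfolding q_def qt_def
  using has_real_derivative_Im[OF has_vector_derivative_quotient[OF dt dt ne]] by simp

lemma q_eq: "u \<in> {0..1} \<Longrightarrow> 0 \<le> t \<Longrightarrow> q u t = k u t * g u t"
  using g_pos[of u t] by (simp add: q_def k_def)

lemma du_Z00: "u \<in> {0..1} \<Longrightarrow> 0 \<le> t \<Longrightarrow>
  ((\<lambda>u. Z 0 0 u t) has_vector_derivative of_real (g u t) * T u t) (at u within {0..1})"
  using du[of u t 0 0] ne[of u t] by (simp add: T_def g_def)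

lemma du_T:
  assumes "u \<in> {0..1}" "0 \<le> t"
  shows "((\<lambda>u. T u t) has_vector_derivative \<i> * of_real (g u t * k u t) * T u t) (at u within {0..1})"
proof -
  have eta: "unit_tangent (\<lambda>u. Z 1 0 u t) = (\<lambda>u. T u t)" by (rule ext) (rule speed_curvature_tangent_eq)
  have "((\<lambda>u. Z 1 0 u t) has_vector_derivative Z 2 0 u t) (at u within {0..1})"
    using du[OF assms, of 1 0] by (simp add: numeral_2_eq_2)
  from has_vector_derivative_unit_tangent[of "\<lambda>u. Z 1 0 u t" "\<lambda>u. Z 2 0 u t", OF this ne[OF assms]]
  show ?thesis unfolding speed_curvature_tangent_eq eta .
qed

lemma norm_T: "u \<in> {0..1} \<Longrightarrow> 0 \<le> t \<Longrightarrow> cmod (T u t) = 1"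
  using ne by (simp add: T_def g_def norm_divide)

text \<open>With \<open>z = Z 1 0\<close> the \<open>u\<close>-derivative of the curve, \<open>q\<close> is the imaginary part of \<open>z'/z\<close>, and
  mixed partial derivatives commute: \<open>qt\<close> is also the \<open>u\<close>-derivative of the imaginary part of \<open>(Z 1 1)/z\<close>.\<close>
lemma spatial_derivatives:
  assumes t: "0 < t" and u: "u \<in> {0..1}"
  defines "r \<equiv> \<lambda>u. Im (Z 1 1 u t / Z 1 0 u t)"
  shows "((\<lambda>u. v u t) has_real_derivative g u t * r u) (at u within {0..1})"
    and "(r has_real_derivative qt u t) (at u within {0..1})"
    and "gt u t = - k u t * v u t * g u t"
proof -
  have t0: "0 \<le> t" using t by simp
  show "(r has_real_derivative qt u t) (at u within {0..1})"
    using has_real_derivative_Im[OF has_vector_derivative_quotient[OF du[OF u t0, of 1 1] du[OF u t0, of 1 0] ne[OF u t0]]]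
    by (simp add: r_def qt_def numeral_2_eq_2 algebra_simps)
  obtain ks kss where V: "\<And>u. u \<in> {0..1} \<Longrightarrow> Z 0 1 u t = \<i> * of_real (v u t) * T u t"
    using flow_at[OF t] by metis
  have Tne: "T u t \<noteq> 0" using ne[OF u t0] by (simp add: T_def g_def)
  \<comment> \<open>The motion is normal, so this quotient is i v on the whole interval. The
    imaginary part of its derivative gives the derivative of \<open>v\<close>; the real part
    vanishes identically, and its derivative gives the evolution of the speed.\<close>
  have "((\<lambda>u. Z 0 1 u t / T u t) has_vector_derivative
      (Z 1 1 u t * T u t - Z 0 1 u t * (\<i> * of_real (g u t * k u t) * T u t)) / (T u t)\<^sup>2) (at u within {0..1})"
    using has_vector_derivative_quotient[OF du[OF u t0, of 0 1] du_T[OF u t0] Tne] by simp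
  also have "(Z 1 1 u t * T u t - Z 0 1 u t * (\<i> * of_real (g u t * k u t) * T u t)) / (T u t)\<^sup>2
     = Z 1 1 u t / T u t + of_real (g u t * k u t * v u t)"
    unfolding V[OF u] using Tne by (simp add: field_simps power2_eq_square)
  finally have dW: "((\<lambda>u. Z 0 1 u t / T u t) has_vector_derivative
      Z 1 1 u t / T u t + of_real (g u t * k u t * v u t)) (at u within {0..1})" .
  have quo: "Z 1 1 u t / T u t = of_real (g u t) * (Z 1 1 u t / Z 1 0 u t)"
    using g_pos[OF u t0] by (simp add: T_def)
  have re_im: "Im (of_real x * w) = x * Im w" "Re (of_real x * w) = x * Re w" for x w by simp_all
  show "((\<lambda>u. v u t) has_real_derivative g u t * r u) (at u within {0..1})"
  proof -
    have "Im (Z 1 1 u t / T u t + of_real (g u t * k u t * v u t)) = g u t * r u"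
      unfolding quo plus_complex.sel re_im r_def by simp
    then show ?thesis using has_real_derivative_Im[OF dW] unfolding v_def by simp
  qed
  have "((\<lambda>u. Re (Z 0 1 u t / T u t)) has_real_derivative
      Re (Z 1 1 u t / T u t + of_real (g u t * k u t * v u t))) (at u within {0..1})"
    by (rule has_real_derivative_Re[OF dW])
  moreover have "((\<lambda>u. Re (Z 0 1 u t / T u t)) has_vector_derivative 0) (at u within {0..1})"
  proof (rule has_vector_derivative_transform[OF u])
    show "Re (Z 0 1 x t / T x t) = 0" if "x \<in> {0..1}" for x
      unfolding V[OF that] using ne[OF that t0] by (simp add: T_def g_def)
  qed simp
  ultimately have "Re (Z 1 1 u t / T u t + of_real (g u t * k u t * v u t)) = 0"
    unfolding has_real_derivative_iff_has_vector_derivative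
    using vector_derivative_within_closed_interval[OF zero_less_one u] by metis
  then show "gt u t = - k u t * v u t * g u t"
    unfolding quo plus_complex.sel re_im gt_def by (simp add: mult_ac)
qed

lemma v_ends:
  assumes t: "0 < t"
  shows "v 0 t = 0" "v 1 t = 0"
proof -
  have const: "Z 0 1 u t = 0" if u: "u \<in> {0..1}" and c: "\<And>t. 0 < t \<Longrightarrow> Z 0 0 u t = c" for u c
  proof -
    have "((\<lambda>\<tau>. Z 0 0 u \<tau>) has_vector_derivative Z 0 1 u t) (at t)"
      using dt[OF u, of t 0 0] t by (simp add: at_within_atLeast_interior)
    moreover have "((\<lambda>\<tau>. Z 0 0 u \<tau>) has_vector_derivative 0) (at t)"
      by (rule has_vector_derivative_transform_within_open[OF has_vector_derivative_const[of c], where S="{0<..}"])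
        (use t c in auto)
    ultimately show ?thesis by (rule vector_derivative_unique_at)
  qed
  show "v 0 t = 0" "v 1 t = 0"
    using const[of 0 0] const[of 1 "of_real l"] ends by (simp_all add: v_def)
qed

text \<open>\<open>H\<close> collects the boundary terms of both integrations by parts of the first
  variation. Each of its two products contains k or v, and both vanish at the ends. What remains is
  (2 k_ss + k^3 - lam k) v against arclength, and the bracket is -v.\<close>

lemma energy_derivative_integrand:
  assumes t: "0 < t"
  shows "integral {0..1} (\<lambda>u. 2 * q u t * qt u t / g u t - (q u t)\<^sup>2 * gt u t / (g u t)\<^sup>2 + lam * gt u t) = - dissipation t"
proof -
  have t0: "0 \<le> t" using t by simp
  obtain ks kss where
    k: "\<And>u. u \<in> {0..1} \<Longrightarrow> ((\<lambda>u. k u t) has_real_derivative g u t * ks u) (at u within {0..1})"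
    and ks: "\<And>u. u \<in> {0..1} \<Longrightarrow> (ks has_real_derivative g u t * kss u) (at u within {0..1})"
    and v: "\<And>u. u \<in> {0..1} \<Longrightarrow> v u t = - 2 * kss u - k u t ^ 3 + lam * k u t"
    using flow_at[OF t] by metis
  define r where "r = (\<lambda>u. Im (Z 1 1 u t / Z 1 0 u t))"
  note sd = spatial_derivatives[OF t, folded r_def]
  define H where "H = (\<lambda>u. 2 * (k u t * r u - ks u * v u t))"
  have dH: "(H has_real_derivative 2 * k u t * qt u t - 2 * kss u * g u t * v u t) (at u within {0..1})"
    if u: "u \<in> {0..1}" for u
    unfolding H_def
    by (rule DERIV_cong[OF DERIV_cmult[OF DERIV_diff[OF DERIV_mult[OF k[OF u] sd(2)[OF u]] DERIV_mult[OF ks[OF u] sd(1)[OF u]]]]])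
      (simp add: r_def algebra_simps)
  have i1: "((\<lambda>u. 2 * k u t * qt u t - 2 * kss u * g u t * v u t) has_integral H 1 - H 0) {0..1}"
    by (rule fundamental_theorem_of_calculus)
      (use dH in \<open>auto simp: has_real_derivative_iff_has_vector_derivative[symmetric]\<close>)
  have H01: "H 1 = 0" "H 0 = 0"
    using curvature_ends[OF t] v_ends[OF t] by (simp_all add: H_def speed_curvature_tangent_eq del: One_nat_def)
  have i2: "((\<lambda>u. (v u t)\<^sup>2 * g u t) has_integral dissipation t) {0..1}"
    unfolding dissipation_def
    by (intro integrable_integral integrable_continuous_real continuous_intros continuous_on_g[OF t0] continuous_on_v[OF t0])
  from has_integral_diff[OF i1 i2]
  have "((\<lambda>u. (2 * k u t * qt u t - 2 * kss u * g u t * v u t) - (v u t)\<^sup>2 * g u t) has_integral - dissipation t) {0..1}"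
    by (simp add: H01)
  moreover have "(2 * k u t * qt u t - 2 * kss u * g u t * v u t) - (v u t)\<^sup>2 * g u t
      = 2 * q u t * qt u t / g u t - (q u t)\<^sup>2 * gt u t / (g u t)\<^sup>2 + lam * gt u t" if u: "u \<in> {0..1}" for u
  proof -
    have "(q u t)\<^sup>2 * gt u t / (g u t)\<^sup>2 = (k u t)\<^sup>2 * gt u t"
      using g_pos[OF u t0] by (simp add: q_eq[OF u t0] power_mult_distrib)
    moreover have "2 * q u t * qt u t / g u t = 2 * k u t * qt u t"
      using g_pos[OF u t0] by (simp add: q_eq[OF u t0])
    moreover have "(v u t)\<^sup>2 * g u t = (- 2 * kss u - k u t ^ 3 + lam * k u t) * (v u t * g u t)"
      using v[OF u] by (simp add: power2_eq_square)
    ultimately show ?thesis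
      unfolding sd(3)[OF u] by (simp add: power2_eq_square power3_eq_cube algebra_simps)
  qed
  ultimately have "((\<lambda>u. 2 * q u t * qt u t / g u t - (q u t)\<^sup>2 * gt u t / (g u t)\<^sup>2 + lam * gt u t) has_integral - dissipation t) {0..1}"
    by (subst has_integral_cong[symmetric]) auto
  then show ?thesis by (rule integral_unique)
qed

lemma energy_eq: "0 \<le> t \<Longrightarrow> energy t = integral {0..1} (\<lambda>u. (q u t)\<^sup>2 / g u t + lam * g u t)"
  unfolding energy_def
proof (rule integral_cong)
  fix u :: real assume "0 \<le> t" "u \<in> {0..1}"
  then show "(k u t)\<^sup>2 * g u t + lam * g u t = (q u t)\<^sup>2 / g u t + lam * g u t"
    using g_pos[of u t] by (simp add: q_eq power_mult_distrib power2_eq_square)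
qed

text \<open>The differentiation is valid up to t = 0, although the equation of motion holds only for
  t > 0. This supplies the continuity of the energy at the initial time, needed to compare later
  energies with that of the initial curve.\<close>

lemma energy_has_derivative_within:
  assumes "0 \<le> t"
  shows "(energy has_real_derivative
    integral {0..1} (\<lambda>u. 2 * q u t * qt u t / g u t - (q u t)\<^sup>2 * gt u t / (g u t)\<^sup>2 + lam * gt u t)) (at t within {0..})"
proof -
  have "((\<lambda>t. integral (cbox 0 1) (\<lambda>u. (q u t)\<^sup>2 / g u t + lam * g u t)) has_vector_derivative
      integral (cbox 0 1) (\<lambda>u. 2 * q u t * qt u t / g u t - (q u t)\<^sup>2 * gt u t / (g u t)\<^sup>2 + lam * gt u t)) (at t within {0..})"
  proof (rule leibniz_rule_vector_derivative)
    fix \<tau> u :: real assume \<tau>: "\<tau> \<in> {0..}" and u: "u \<in> cbox 0 1"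
    then have g0: "g u \<tau> \<noteq> 0" using g_pos[of u \<tau>] by auto
    have "((\<lambda>\<tau>. (q u \<tau>)\<^sup>2 / g u \<tau> + lam * g u \<tau>) has_real_derivative
       (2 * q u \<tau> * qt u \<tau> * g u \<tau> - (q u \<tau>)\<^sup>2 * gt u \<tau>) / (g u \<tau> * g u \<tau>) + lam * gt u \<tau>) (at \<tau> within {0..})"
      using \<tau> u g0 by (intro DERIV_add DERIV_divide DERIV_cmult dt_g DERIV_cong[OF DERIV_power[OF dt_q, where n=2]]) auto
    also have "(2 * q u \<tau> * qt u \<tau> * g u \<tau> - (q u \<tau>)\<^sup>2 * gt u \<tau>) / (g u \<tau> * g u \<tau>) + lam * gt u \<tau>
      = 2 * q u \<tau> * qt u \<tau> / g u \<tau> - (q u \<tau>)\<^sup>2 * gt u \<tau> / (g u \<tau>)\<^sup>2 + lam * gt u \<tau>"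
      using g0 by (simp add: power2_eq_square diff_divide_distrib)
    finally show "((\<lambda>\<tau>. (q u \<tau>)\<^sup>2 / g u \<tau> + lam * g u \<tau>) has_vector_derivative
       2 * q u \<tau> * qt u \<tau> / g u \<tau> - (q u \<tau>)\<^sup>2 * gt u \<tau> / (g u \<tau>)\<^sup>2 + lam * gt u \<tau>) (at \<tau> within {0..})"
      by (simp add: has_real_derivative_iff_has_vector_derivative)
  next
    fix \<tau> :: real assume \<tau>: "\<tau> \<in> {0..}"
    then show "(\<lambda>u. (q u \<tau>)\<^sup>2 / g u \<tau> + lam * g u \<tau>) integrable_on cbox 0 1"
      unfolding q_def g_def using ne
      by (auto simp: box_real intro!: integrable_continuous_real continuous_intros cont_slice)
  next
    show "continuous_on ({0..} \<times> cbox 0 1) (\<lambda>(t, u). 2 * q u t * qt u t / g u t - (q u t)\<^sup>2 * gt u t / (g u t)\<^sup>2 + lam * gt u t)"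
      unfolding q_def g_def qt_def gt_def case_prod_beta box_real using ne
      by (intro continuous_intros cont_swap) auto
  qed (use assms in auto)
  then have "((\<lambda>t. integral {0..1} (\<lambda>u. (q u t)\<^sup>2 / g u t + lam * g u t)) has_vector_derivative
      integral {0..1} (\<lambda>u. 2 * q u t * qt u t / g u t - (q u t)\<^sup>2 * gt u t / (g u t)\<^sup>2 + lam * gt u t)) (at t within {0..})"
    by (simp add: box_real)
  then show ?thesis
    unfolding has_real_derivative_iff_has_vector_derivative
    by (rule has_vector_derivative_transform[rotated 2]) (use assms energy_eq in auto)
qed

lemma energy_derivative: "0 < t \<Longrightarrow> (energy has_real_derivative - dissipation t) (at t)"
  using energy_has_derivative_within[of t] energy_derivative_integrand[of t]
  by (simp add: at_within_atLeast_interior)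

lemma continuous_on_energy: "continuous_on {0..} energy"
  using energy_has_derivative_within by (auto intro!: DERIV_continuous_on)

lemma dissipation_nonneg: "0 \<le> t \<Longrightarrow> 0 \<le> dissipation t"
  unfolding dissipation_def using g_pos less_imp_le
  by (intro integral_nonneg_continuous continuous_intros continuous_on_g continuous_on_v) (auto intro!: mult_nonneg_nonneg)

lemma energy_antimono:
  assumes "0 \<le> s" "s \<le> t"
  shows "energy t \<le> energy s"
proof (rule DERIV_nonpos_imp_decreasing_open[OF assms(2)])
  show "\<exists>d. (energy has_real_derivative d) (at x) \<and> d \<le> 0" if "s < x" for x
    using energy_derivative[of x] dissipation_nonneg[of x] that assms by (intro exI[of _ "- dissipation x"]) auto
qed (use assms in \<open>auto intro: continuous_on_subset[OF continuous_on_energy]\<close>)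

lemma length_and_bending_le_energy:
  assumes "0 \<le> t"
  shows "lam * integral {0..1} (\<lambda>u. g u t) \<le> energy t" "integral {0..1} (\<lambda>u. (k u t)\<^sup>2 * g u t) \<le> energy t"
    "energy t = integral {0..1} (\<lambda>u. (k u t)\<^sup>2 * g u t) + lam * integral {0..1} (\<lambda>u. g u t)"
proof -
  have i: "(\<lambda>u. (k u t)\<^sup>2 * g u t) integrable_on {0..1}" "(\<lambda>u. g u t) integrable_on {0..1}"
    "(\<lambda>u. lam * g u t) integrable_on {0..1}"
    by (intro integrable_continuous_real continuous_intros continuous_on_g continuous_on_k assms)+
  then show e: "energy t = integral {0..1} (\<lambda>u. (k u t)\<^sup>2 * g u t) + lam * integral {0..1} (\<lambda>u. g u t)"
    unfolding energy_def by (subst integral_add) auto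
  have "0 \<le> integral {0..1} (\<lambda>u. (k u t)\<^sup>2 * g u t)" "0 \<le> integral {0..1} (\<lambda>u. g u t)"
    using less_imp_le[OF g_pos[OF _ assms]]
    by (auto intro!: Henstock_Kurzweil_Integration.integral_nonneg[OF i(1)] Henstock_Kurzweil_Integration.integral_nonneg[OF i(2)])
  then show "lam * integral {0..1} (\<lambda>u. g u t) \<le> energy t" "integral {0..1} (\<lambda>u. (k u t)\<^sup>2 * g u t) \<le> energy t"
    using lam by (auto simp: e)
qed

end

section \<open>Test functions and their integrals against arclength\<close>

text \<open>\<open>G\<close> is the gradient of \<open>F\<close>, and \<open>C\<close> bounds both.\<close>
definition test_function :: "(complex \<Rightarrow> real) \<Rightarrow> (complex \<Rightarrow> complex) \<Rightarrow> real \<Rightarrow> bool" where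
  "test_function F G C \<longleftrightarrow> continuous_on UNIV G \<and> (\<forall>z. \<bar>F z\<bar> \<le> C) \<and> (\<forall>z. cmod (G z) \<le> C) \<and>
    (\<forall>c c' x S. (c has_vector_derivative c') (at x within S) \<longrightarrow>
      ((\<lambda>x. F (c x)) has_real_derivative Re (cnj (G (c x)) * c')) (at x within S))"

lemma test_function_const: "test_function (\<lambda>_. 1) (\<lambda>_. 0) 1"
  by (simp add: test_function_def)

lemma test_function_lipschitz:
  assumes "test_function F G C"
  shows "\<bar>F a - F b\<bar> \<le> C * cmod (a - b)"
proof -
  have "((\<lambda>x. b + of_real x * (a - b)) has_vector_derivative (a - b)) (at x within {0..1})" for x
  proof -
    have "((\<lambda>x. of_real x * (a - b)) has_vector_derivative of_real 1 * (a - b)) (at x within {0..1})"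
      by (intro has_vector_derivative_mult_left bounded_linear.has_vector_derivative[OF bounded_linear_of_real])
        (simp add: has_vector_derivative_id)
    from has_vector_derivative_add[OF has_vector_derivative_const this] show ?thesis by simp
  qed
  then have "((\<lambda>x. F (b + of_real x * (a - b))) has_real_derivative
      Re (cnj (G (b + of_real x * (a - b))) * (a - b))) (at x within {0..1})" for x
    using assms unfolding test_function_def by blast
  then have "\<bar>F (b + of_real 1 * (a - b)) - F (b + of_real 0 * (a - b))\<bar> \<le> integral {0..1::real} (\<lambda>_. C * cmod (a - b))"
  proof (rule increment_bound_total[where F="\<lambda>x. F (b + of_real x * (a - b))"])
    have "continuous_on UNIV G" using assms by (simp add: test_function_def)
    then have "continuous_on {0..1} (\<lambda>x. G (b + complex_of_real x * (a - b)))"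
      by (rule continuous_on_compose2) (auto intro!: continuous_intros)
    then show "continuous_on {0..1} (\<lambda>x. Re (cnj (G (b + complex_of_real x * (a - b))) * (a - b)))"
      by (intro continuous_intros)
    show "\<bar>Re (cnj (G (b + complex_of_real x * (a - b))) * (a - b))\<bar> \<le> C * cmod (a - b)" for x
    proof -
      have "\<bar>Re (cnj (G (b + complex_of_real x * (a - b))) * (a - b))\<bar> \<le> cmod (G (b + complex_of_real x * (a - b))) * cmod (a - b)"
        using abs_Re_le_cmod[of "cnj (G (b + complex_of_real x * (a - b))) * (a - b)"] by (simp add: norm_mult)
      also have "\<dots> \<le> C * cmod (a - b)"
        using assms by (intro mult_right_mono) (auto simp: test_function_def)
      finally show ?thesis .
    qed
  qed auto
  then show ?thesis by simp
qed

lemma test_function_continuous: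
  assumes F: "test_function F G C"
  shows "continuous_on UNIV F"
proof (rule lipschitz_on_continuous_on[of C], rule lipschitz_onI)
  show "dist (F x) (F y) \<le> C * dist x y" for x y
    using test_function_lipschitz[OF F, of x y] by (simp add: dist_norm)
  have "\<bar>F 0\<bar> \<le> C" using F by (simp add: test_function_def)
  then show "0 \<le> C" by simp
qed

lemma has_real_derivative_max0_square: "((\<lambda>s. (max 0 s)\<^sup>2) has_real_derivative 2 * max 0 s) (at (s::real))"
proof -
  consider "0 < s" | "s < 0" | "s = 0" by linarith
  then show ?thesis
  proof cases
    case 1
    have "((\<lambda>s::real. s\<^sup>2) has_real_derivative 2 * s) (at s)" by (auto intro!: derivative_eq_intros)
    then have "((\<lambda>s. (max 0 s)\<^sup>2) has_real_derivative 2 * s) (at s)"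
      by (rule has_field_derivative_transform_within_open[where S="{0<..}"]) (use 1 in auto)
    then show ?thesis using 1 by simp
  next
    case 2
    have "((\<lambda>s::real. 0) has_real_derivative (0::real)) (at s)" by simp
    then have "((\<lambda>s. (max 0 s)\<^sup>2) has_real_derivative 0) (at s)"
      by (rule has_field_derivative_transform_within_open[where S="{..<0}"]) (use 2 in auto)
    then show ?thesis using 2 by simp
  next
    case 3
    have "(\<lambda>h::real. (max 0 h)\<^sup>2 / h) \<midarrow>0\<rightarrow> 0"
    proof (rule Lim_null_comparison)
      show "\<forall>\<^sub>F h in at 0. norm ((max 0 h)\<^sup>2 / h) \<le> \<bar>h\<bar>"
        by (rule always_eventually) (auto simp: max_def power2_eq_square)
      show "(\<lambda>h::real. \<bar>h\<bar>) \<midarrow>0\<rightarrow> 0" by (rule tendsto_rabs_zero) (rule tendsto_ident_at)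
    qed
    then show ?thesis using 3 by (simp add: DERIV_def)
  qed
qed

text \<open>A C^1 bump that is positive exactly on the open disc of radius \<open>r\<close> about
  \<open>p\<close>; the square smooths the truncation at the boundary circle. It detects whether a
  curve enters the disc.\<close>

lemma test_function_bump:
  assumes r: "0 < r"
  shows "\<exists>C. test_function (\<lambda>z. (max 0 (r\<^sup>2 - (cmod (z - p))\<^sup>2))\<^sup>2)
    (\<lambda>z. of_real (- 4 * max 0 (r\<^sup>2 - (cmod (z - p))\<^sup>2)) * (z - p)) C"
proof -
  define m where "m = (\<lambda>z. max 0 (r\<^sup>2 - (cmod (z - p))\<^sup>2))"
  have m: "0 \<le> m z" "m z \<le> r\<^sup>2" for z by (auto simp: m_def)
  have 1: "\<bar>(m z)\<^sup>2\<bar> \<le> (r\<^sup>2)\<^sup>2" for z using power_mono[OF m(2) m(1), where n=2] by simp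
  have 2: "cmod (of_real (- 4 * m z) * (z - p)) \<le> 4 * r\<^sup>2 * r" for z
  proof (cases "cmod (z - p) \<le> r")
    case True
    then have "4 * m z * cmod (z - p) \<le> 4 * r\<^sup>2 * r" using m by (intro mult_mono) auto
    then show ?thesis using m by (simp add: norm_mult)
  next
    case False
    then have "r\<^sup>2 \<le> (cmod (z - p))\<^sup>2" using r by (intro power_mono) auto
    then have "m z = 0" by (simp add: m_def)
    then show ?thesis using r by simp
  qed
  have 3: "((\<lambda>x. (m (c x))\<^sup>2) has_real_derivative Re (cnj (of_real (- 4 * m (c x)) * (c x - p)) * c')) (at x within S)"
    if c: "(c has_vector_derivative c') (at x within S)" for c c' x S
  proof -
    have "((\<lambda>x. c x - p) has_vector_derivative c') (at x within S)"
      using has_vector_derivative_diff[OF c has_vector_derivative_const] by simp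
    note a = has_real_derivative_Re[OF this] and b = has_real_derivative_Im[OF this]
    have "((\<lambda>x. r\<^sup>2 - ((Re (c x - p))\<^sup>2 + (Im (c x - p))\<^sup>2)) has_real_derivative
       0 - (2 * Re (c x - p) * Re c' + 2 * Im (c x - p) * Im c')) (at x within S)"
      using DERIV_diff[OF DERIV_const[of "r\<^sup>2"] DERIV_add[OF DERIV_power[OF a, of 2] DERIV_power[OF b, of 2]]] by (simp add: mult_ac)
    then have "((\<lambda>x. r\<^sup>2 - (cmod (c x - p))\<^sup>2) has_real_derivative
       0 - (2 * Re (c x - p) * Re c' + 2 * Im (c x - p) * Im c')) (at x within S)"
      by (simp only: cmod_power2)
    from DERIV_chain2[OF has_real_derivative_max0_square this]
    show ?thesis unfolding m_def by (rule DERIV_cong) (simp add: algebra_simps)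
  qed
  have "continuous_on UNIV (\<lambda>z. of_real (- 4 * m z) * (z - p))"
    unfolding m_def by (intro continuous_intros)
  then have "test_function (\<lambda>z. (m z)\<^sup>2) (\<lambda>z. of_real (- 4 * m z) * (z - p)) (max ((r\<^sup>2)\<^sup>2) (4 * r\<^sup>2 * r))"
    unfolding test_function_def
  proof (intro conjI allI impI)
    show "\<bar>(m z)\<^sup>2\<bar> \<le> max ((r\<^sup>2)\<^sup>2) (4 * r\<^sup>2 * r)" for z
      by (rule max.coboundedI1[OF 1])
    show "cmod (of_real (- 4 * m z) * (z - p)) \<le> max ((r\<^sup>2)\<^sup>2) (4 * r\<^sup>2 * r)" for z
      by (rule max.coboundedI2[OF 2])
  qed (assumption, rule 3)
  then show ?thesis unfolding m_def by (rule exI)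
qed

context complex_elastic_flow
begin

lemma arclength_integral_derivative:
  assumes F: "test_function F G C" and t: "0 < t"
  shows "(arclength_integral F has_real_derivative
    integral {0..1} (\<lambda>u. Re (cnj (G (Z 0 0 u t)) * Z 0 1 u t) * g u t + F (Z 0 0 u t) * gt u t)) (at t)"
proof -
  have G: "continuous_on UNIV G" using F by (simp add: test_function_def)
  have cF: "continuous_on UNIV F" by (rule test_function_continuous[OF F])
  have dF: "((\<lambda>x. F (c x)) has_real_derivative Re (cnj (G (c x)) * c')) (at x within S)"
    if "(c has_vector_derivative c') (at x within S)" for c c' x S
    using F that by (simp add: test_function_def)
  have "((\<lambda>t. integral (cbox 0 1) (\<lambda>u. F (Z 0 0 u t) * g u t)) has_vector_derivative
      integral (cbox 0 1) (\<lambda>u. Re (cnj (G (Z 0 0 u t)) * Z 0 1 u t) * g u t + F (Z 0 0 u t) * gt u t)) (at t within {0..})"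
  proof (rule leibniz_rule_vector_derivative)
    fix \<tau> u :: real assume \<tau>: "\<tau> \<in> {0..}" and u: "u \<in> cbox 0 1"
    have "((\<lambda>\<tau>. F (Z 0 0 u \<tau>)) has_real_derivative Re (cnj (G (Z 0 0 u \<tau>)) * Z 0 1 u \<tau>)) (at \<tau> within {0..})"
      using dF[OF dt[of u \<tau> 0 0]] \<tau> u by simp
    moreover have "((\<lambda>\<tau>. g u \<tau>) has_real_derivative gt u \<tau>) (at \<tau> within {0..})"
      using dt_g[of u \<tau>] \<tau> u by simp
    ultimately have "((\<lambda>\<tau>. F (Z 0 0 u \<tau>) * g u \<tau>) has_real_derivative
       Re (cnj (G (Z 0 0 u \<tau>)) * Z 0 1 u \<tau>) * g u \<tau> + gt u \<tau> * F (Z 0 0 u \<tau>)) (at \<tau> within {0..})"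
      by (rule DERIV_mult)
    then show "((\<lambda>\<tau>. F (Z 0 0 u \<tau>) * g u \<tau>) has_vector_derivative
       Re (cnj (G (Z 0 0 u \<tau>)) * Z 0 1 u \<tau>) * g u \<tau> + F (Z 0 0 u \<tau>) * gt u \<tau>) (at \<tau> within {0..})"
      by (simp add: has_real_derivative_iff_has_vector_derivative mult.commute)
  next
    fix \<tau> :: real assume "\<tau> \<in> {0..}"
    then show "(\<lambda>u. F (Z 0 0 u \<tau>) * g u \<tau>) integrable_on cbox 0 1"
      using continuous_on_compose2[OF cF cont_slice[of \<tau> 0 0]]
      by (auto simp: box_real intro!: integrable_continuous_real continuous_intros continuous_on_g)
  next
    have "continuous_on ({0..} \<times> {0..1}) (\<lambda>x. F (Z 0 0 (snd x) (fst x)))"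
      "continuous_on ({0..} \<times> {0..1}) (\<lambda>x. G (Z 0 0 (snd x) (fst x)))"
      by (rule continuous_on_compose2[OF cF cont_swap] continuous_on_compose2[OF G cont_swap]; simp)+
    then show "continuous_on ({0..} \<times> cbox 0 1) (\<lambda>(t, u). Re (cnj (G (Z 0 0 u t)) * Z 0 1 u t) * g u t + F (Z 0 0 u t) * gt u t)"
      unfolding g_def gt_def case_prod_beta box_real using ne
      by (intro continuous_intros cont_swap) auto
  qed (use t in auto)
  then show ?thesis
    using t by (simp add: arclength_integral_def[abs_def] has_real_derivative_iff_has_vector_derivative
        at_within_atLeast_interior box_real)
qed

text \<open>In absolute value the integrand is at most C (1 + |k|) |v| g. A weighted
  arithmetic-geometric mean separates |v| from the rest: v^2 g integrates to the dissipation, and g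
  and k^2 g have integrals bounded by the initial energy.\<close>

lemma arclength_integral_derivative_bound:
  assumes F: "test_function F G C" and t: "0 < t" and \<delta>: "0 < \<delta>"
  shows "\<bar>integral {0..1} (\<lambda>u. Re (cnj (G (Z 0 0 u t)) * Z 0 1 u t) * g u t + F (Z 0 0 u t) * gt u t)\<bar>
    \<le> dissipation t / \<delta> + \<delta> * C\<^sup>2 * (energy 0 / lam + energy 0)"
proof -
  have t0: "0 \<le> t" using t by simp
  obtain ks kss where V: "\<And>u. u \<in> {0..1} \<Longrightarrow> Z 0 1 u t = \<i> * of_real (v u t) * T u t"
    using flow_at[OF t] by metis
  have C: "\<And>z. \<bar>F z\<bar> \<le> C" "\<And>z. cmod (G z) \<le> C" and G: "continuous_on UNIV G"
    using F by (auto simp: test_function_def)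
  have cF: "continuous_on UNIV F" by (rule test_function_continuous[OF F])
  have C0: "0 \<le> C" using C(1)[of 0] by simp
  have ig: "(\<lambda>u. g u t) integrable_on {0..1}" and ik: "(\<lambda>u. (k u t)\<^sup>2 * g u t) integrable_on {0..1}"
    and iv: "(\<lambda>u. (v u t)\<^sup>2 * g u t) integrable_on {0..1}"
    by (intro integrable_continuous_real continuous_intros continuous_on_g continuous_on_k continuous_on_v t0)+
  have amgm: "C * a * b \<le> b\<^sup>2 / (2 * \<delta>) + \<delta> * C\<^sup>2 * a\<^sup>2 / 2" for a b
  proof -
    have "0 \<le> (b - \<delta> * C * a)\<^sup>2" by simp
    then have "2 * \<delta> * (C * a * b) \<le> b\<^sup>2 + \<delta>\<^sup>2 * C\<^sup>2 * a\<^sup>2"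
      by (simp add: power2_diff power_mult_distrib algebra_simps)
    then have "C * a * b \<le> (b\<^sup>2 + \<delta>\<^sup>2 * C\<^sup>2 * a\<^sup>2) / (2 * \<delta>)"
      using \<delta> by (simp add: pos_le_divide_eq mult.commute)
    also have "\<dots> = b\<^sup>2 / (2 * \<delta>) + \<delta> * C\<^sup>2 * a\<^sup>2 / 2"
      using \<delta> by (simp add: add_divide_distrib power2_eq_square)
    finally show ?thesis .
  qed
  have "norm (integral {0..1} (\<lambda>u. Re (cnj (G (Z 0 0 u t)) * Z 0 1 u t) * g u t + F (Z 0 0 u t) * gt u t))
    \<le> integral {0..1} (\<lambda>u. (1 / \<delta>) * ((v u t)\<^sup>2 * g u t) + \<delta> * C\<^sup>2 * (g u t + (k u t)\<^sup>2 * g u t))"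
  proof (rule integral_norm_bound_integral)
    show "(\<lambda>u. Re (cnj (G (Z 0 0 u t)) * Z 0 1 u t) * g u t + F (Z 0 0 u t) * gt u t) integrable_on {0..1}"
      unfolding gt_def using ne[OF _ t0] continuous_on_compose2[OF cF cont_slice[OF t0, of 0 0]]
        continuous_on_compose2[OF G cont_slice[OF t0, of 0 0]]
      by (auto intro!: integrable_continuous_real continuous_intros continuous_on_g t0 cont_slice)
    show "(\<lambda>u. (1 / \<delta>) * ((v u t)\<^sup>2 * g u t) + \<delta> * C\<^sup>2 * (g u t + (k u t)\<^sup>2 * g u t)) integrable_on {0..1}"
      by (intro integrable_continuous_real continuous_intros continuous_on_g continuous_on_k continuous_on_v t0)
    fix u :: real assume u: "u \<in> {0..1}"
    have Zv: "cmod (Z 0 1 u t) = \<bar>v u t\<bar>"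
      unfolding V[OF u] norm_mult norm_T[OF u t0] norm_of_real norm_ii mult_1_left mult_1_right ..
    have g: "0 < g u t" by (rule g_pos[OF u t0])
    have "\<bar>Re (cnj (G (Z 0 0 u t)) * Z 0 1 u t)\<bar> \<le> cmod (G (Z 0 0 u t)) * \<bar>v u t\<bar>"
      using abs_Re_le_cmod[of "cnj (G (Z 0 0 u t)) * Z 0 1 u t"]
      unfolding norm_mult complex_mod_cnj Zv .
    also have "\<dots> \<le> C * \<bar>v u t\<bar>" by (intro mult_right_mono C) auto
    finally have 1: "\<bar>Re (cnj (G (Z 0 0 u t)) * Z 0 1 u t)\<bar> \<le> C * \<bar>v u t\<bar>" .
    have "\<bar>F (Z 0 0 u t)\<bar> * (\<bar>k u t\<bar> * \<bar>v u t\<bar>) \<le> C * (\<bar>k u t\<bar> * \<bar>v u t\<bar>)" by (intro mult_right_mono C) auto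
    then have 2: "\<bar>F (Z 0 0 u t) * (- k u t * v u t)\<bar> \<le> C * \<bar>k u t\<bar> * \<bar>v u t\<bar>" by (simp add: abs_mult mult.assoc)
    have "\<bar>Re (cnj (G (Z 0 0 u t)) * Z 0 1 u t) + F (Z 0 0 u t) * (- k u t * v u t)\<bar>
      \<le> C * 1 * \<bar>v u t\<bar> + C * \<bar>k u t\<bar> * \<bar>v u t\<bar>" using 1 2 by linarith
    also have "\<dots> \<le> (1 / \<delta>) * (v u t)\<^sup>2 + \<delta> * C\<^sup>2 * (1 + (k u t)\<^sup>2) / 2"
    proof -
      have "1 / \<delta> * (v u t)\<^sup>2 = (v u t)\<^sup>2 / (2 * \<delta>) + (v u t)\<^sup>2 / (2 * \<delta>)" using \<delta> by simp
      then show ?thesis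
        using amgm[of 1 "\<bar>v u t\<bar>"] amgm[of "\<bar>k u t\<bar>" "\<bar>v u t\<bar>"] by (simp add: distrib_left add_divide_distrib)
    qed
    also have "\<dots> \<le> (1 / \<delta>) * (v u t)\<^sup>2 + \<delta> * C\<^sup>2 * (1 + (k u t)\<^sup>2)"
    proof -
      have "0 \<le> \<delta> * C\<^sup>2 * (1 + (k u t)\<^sup>2)" using \<delta> by (intro mult_nonneg_nonneg) auto
      then show ?thesis by linarith
    qed
    finally have "\<bar>Re (cnj (G (Z 0 0 u t)) * Z 0 1 u t) + F (Z 0 0 u t) * (- k u t * v u t)\<bar> * g u t
      \<le> ((1 / \<delta>) * (v u t)\<^sup>2 + \<delta> * C\<^sup>2 * (1 + (k u t)\<^sup>2)) * g u t"
      using g by (intro mult_right_mono) auto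
    moreover have "\<bar>Re (cnj (G (Z 0 0 u t)) * Z 0 1 u t) + F (Z 0 0 u t) * (- k u t * v u t)\<bar> * g u t
      = \<bar>Re (cnj (G (Z 0 0 u t)) * Z 0 1 u t) * g u t + F (Z 0 0 u t) * gt u t\<bar>"
    proof -
      have "Re (cnj (G (Z 0 0 u t)) * Z 0 1 u t) * g u t + F (Z 0 0 u t) * gt u t
        = (Re (cnj (G (Z 0 0 u t)) * Z 0 1 u t) + F (Z 0 0 u t) * (- k u t * v u t)) * g u t"
        unfolding spatial_derivatives(3)[OF t u] by (simp only: distrib_right mult.assoc)
      then show ?thesis using g by (simp only: abs_mult abs_of_pos)
    qed
    ultimately show "norm (Re (cnj (G (Z 0 0 u t)) * Z 0 1 u t) * g u t + F (Z 0 0 u t) * gt u t)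
      \<le> (1 / \<delta>) * ((v u t)\<^sup>2 * g u t) + \<delta> * C\<^sup>2 * (g u t + (k u t)\<^sup>2 * g u t)"
      by (simp add: algebra_simps)
  qed
  also have "\<dots> = (1 / \<delta>) * dissipation t + \<delta> * C\<^sup>2 * (integral {0..1} (\<lambda>u. g u t) + integral {0..1} (\<lambda>u. (k u t)\<^sup>2 * g u t))"
  proof -
    have "((\<lambda>u. (1 / \<delta>) * ((v u t)\<^sup>2 * g u t) + \<delta> * C\<^sup>2 * (g u t + (k u t)\<^sup>2 * g u t)) has_integral
      (1 / \<delta>) * dissipation t + \<delta> * C\<^sup>2 * (integral {0..1} (\<lambda>u. g u t) + integral {0..1} (\<lambda>u. (k u t)\<^sup>2 * g u t))) {0..1}"
      unfolding dissipation_def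
      by (intro has_integral_add has_integral_mult_right integrable_integral ig ik iv)
    then show ?thesis by (rule integral_unique)
  qed
  also have "\<dots> \<le> (1 / \<delta>) * dissipation t + \<delta> * C\<^sup>2 * (energy 0 / lam + energy 0)"
  proof -
    have E: "energy t \<le> energy 0" by (rule energy_antimono) (use t in auto)
    have "integral {0..1} (\<lambda>u. g u t) \<le> energy 0 / lam"
      using length_and_bending_le_energy(1)[OF t0] E lam by (simp add: pos_le_divide_eq mult.commute)
    then have "integral {0..1} (\<lambda>u. g u t) + integral {0..1} (\<lambda>u. (k u t)\<^sup>2 * g u t) \<le> energy 0 / lam + energy 0"
      using length_and_bending_le_energy(2)[OF t0] E by linarith
    then show ?thesis using \<delta> by (intro add_left_mono mult_left_mono) auto
  qed
  finally show ?thesis by simp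
qed

text \<open>The dissipation is minus the derivative of the energy. So plus or minus the integral,
  increased by \<open>energy / \<delta>\<close> and decreased by a linear function of time, is
  nonincreasing; no time integral of the dissipation is formed.\<close>

lemma arclength_integral_increment:
  assumes F: "test_function F G C" and st: "0 < s" "s \<le> t" and \<delta>: "0 < \<delta>"
  shows "\<bar>arclength_integral F t - arclength_integral F s\<bar>
    \<le> (energy s - energy t) / \<delta> + \<delta> * C\<^sup>2 * (energy 0 / lam + energy 0) * (t - s)"
proof -
  define Q where "Q = \<delta> * C\<^sup>2 * (energy 0 / lam + energy 0)"
  have "a * arclength_integral F t + energy t / \<delta> - Q * t \<le> a * arclength_integral F s + energy s / \<delta> - Q * s"
    if a: "\<bar>a\<bar> = 1" for a
  proof (rule DERIV_nonpos_imp_nonincreasing[OF st(2)])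
    fix x assume x: "s \<le> x" "x \<le> t"
    define d where "d = integral {0..1} (\<lambda>u. Re (cnj (G (Z 0 0 u x)) * Z 0 1 u x) * g u x + F (Z 0 0 u x) * gt u x)"
    have x0: "0 < x" using x st by simp
    have "((\<lambda>x. a * arclength_integral F x + energy x / \<delta> - Q * x) has_real_derivative a * d + - dissipation x / \<delta> - Q * 1) (at x)"
      unfolding d_def
      by (intro DERIV_diff DERIV_add DERIV_cmult DERIV_cdivide DERIV_ident
          arclength_integral_derivative[OF F x0] energy_derivative[OF x0])
    moreover have "\<bar>a * d\<bar> \<le> dissipation x / \<delta> + Q"
      using arclength_integral_derivative_bound[OF F x0 \<delta>] a by (simp add: abs_mult d_def Q_def)
    ultimately show "\<exists>y. ((\<lambda>x. a * arclength_integral F x + energy x / \<delta> - Q * x) has_real_derivative y) (at x) \<and> y \<le> 0"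
      by (intro exI[of _ "a * d + - dissipation x / \<delta> - Q * 1"]) auto
  qed
  from this[of 1] this[of "-1"]
  have "\<bar>arclength_integral F t - arclength_integral F s\<bar> \<le> energy s / \<delta> - energy t / \<delta> + Q * t - Q * s"
    by (auto simp: abs_le_iff)
  then show ?thesis by (simp add: Q_def diff_divide_distrib algebra_simps)
qed

lemma energy_eventually_flat:
  assumes "0 < \<epsilon>"
  obtains S where "0 < S" "\<And>s t. S \<le> s \<Longrightarrow> s \<le> t \<Longrightarrow> energy s - energy t < \<epsilon>"
proof -
  have nonneg: "0 \<le> energy t" if "0 \<le> t" for t
  proof -
    have "0 \<le> integral {0..1} (\<lambda>u. g u t)"
      by (rule integral_nonneg_continuous[OF continuous_on_g[OF that]])
        (rule less_imp_le[OF g_pos[OF _ that]])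
    then have "0 \<le> lam * integral {0..1} (\<lambda>u. g u t)" using lam by simp
    then show ?thesis using length_and_bending_le_energy(1)[OF that] by (rule order_trans)
  qed
  define I where "I = Inf (energy ` {0<..})"
  have bdd: "bdd_below (energy ` {0<..})"
  proof (rule bdd_belowI)
    show "0 \<le> y" if "y \<in> energy ` {0<..}" for y
    proof -
      from that obtain t where "0 < t" "y = energy t" by blast
      then show ?thesis using nonneg[of t] by simp
    qed
  qed
  have "energy ` {0<..} \<noteq> {}" by simp
  moreover have "I < I + \<epsilon>" using assms by simp
  ultimately obtain y where "y \<in> energy ` {0<..}" "y < I + \<epsilon>"
    unfolding I_def by (rule cInf_lessD[THEN bexE])
  then obtain S where S: "0 < S" "energy S < I + \<epsilon>" by blast
  show ?thesis
  proof (rule that[OF S(1)])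
    fix s t assume st: "S \<le> s" "s \<le> t"
    have "energy s \<le> energy S" using S st by (intro energy_antimono) auto
    moreover have "I \<le> energy t" unfolding I_def using S st by (intro cInf_lower bdd) auto
    ultimately show "energy s - energy t < \<epsilon>" using S by linarith
  qed
qed

lemma arclength_integral_eventually_flat:
  assumes F: "test_function F G C" and \<epsilon>: "0 < \<epsilon>"
  obtains S where "0 < S" "\<And>s t. S \<le> s \<Longrightarrow> s \<le> t \<Longrightarrow> t \<le> s + 1 \<Longrightarrow>
    \<bar>arclength_integral F t - arclength_integral F s\<bar> < \<epsilon>"
proof -
  define Q where "Q = C\<^sup>2 * (energy 0 / lam + energy 0)"
  \<comment> \<open>This weight makes the linear term at most \<epsilon>/2 over one unit of time.
    Requiring an energy drop below \<delta> \<epsilon>/2 makes the other term less than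
    \<epsilon>/2.\<close>
  define \<delta> where "\<delta> = \<epsilon> / (2 * (\<bar>Q\<bar> + 1))"
  have \<delta>: "0 < \<delta>" using \<epsilon> by (simp add: \<delta>_def add_nonneg_pos)
  obtain S where S: "0 < S" "\<And>s t. S \<le> s \<Longrightarrow> s \<le> t \<Longrightarrow> energy s - energy t < \<delta> * (\<epsilon> / 2)"
    using energy_eventually_flat[of "\<delta> * (\<epsilon> / 2)"] \<delta> \<epsilon> by auto
  show ?thesis
  proof (rule that[OF S(1)])
    fix s t assume st: "S \<le> s" "s \<le> t" "t \<le> s + 1"
    have "\<bar>arclength_integral F t - arclength_integral F s\<bar> \<le> (energy s - energy t) / \<delta> + \<delta> * Q * (t - s)"
      using arclength_integral_increment[OF F _ st(2) \<delta>] S(1) st by (simp add: Q_def mult.assoc)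
    moreover have "(energy s - energy t) / \<delta> < \<epsilon> / 2"
      using S(2)[OF st(1,2)] \<delta> by (simp add: pos_divide_less_eq mult.commute)
    moreover have "\<delta> * Q * (t - s) \<le> \<epsilon> / 2"
    proof -
      have "\<delta> * Q * (t - s) \<le> \<delta> * (\<bar>Q\<bar> + 1) * (t - s)"
        using \<delta> st by (intro mult_right_mono mult_left_mono) auto
      also have "\<dots> \<le> \<delta> * (\<bar>Q\<bar> + 1) * 1"
        using \<delta> st by (intro mult_left_mono) auto
      also have "\<dots> = \<epsilon> / 2"
      proof -
        have "\<bar>Q\<bar> + 1 \<noteq> 0" by linarith
        moreover have "e / (2 * X) * X * 1 = e / 2" if "X \<noteq> 0" for e X :: real using that by simp
        ultimately show ?thesis unfolding \<delta>_def by blast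
      qed
      finally show ?thesis .
    qed
    ultimately show "\<bar>arclength_integral F t - arclength_integral F s\<bar> < \<epsilon>" by linarith
  qed
qed

end

section \<open>Eventual embeddedness\<close>

context complex_elastic_flow
begin

text \<open>\<open>normal_form t L h \<theta> \<kappa> p f\<close>: the curve at time \<open>t\<close> is \<open>cis_curve L \<theta> \<circ> h\<close> with
  curvature \<open>\<kappa>\<close>, whose first two arclength derivatives are \<open>p\<close> and \<open>f\<close>.\<close>
definition normal_form ::
  "real \<Rightarrow> real \<Rightarrow> (real \<Rightarrow> real) \<Rightarrow> (real \<Rightarrow> real) \<Rightarrow> (real \<Rightarrow> real) \<Rightarrow> (real \<Rightarrow> real) \<Rightarrow> (real \<Rightarrow> real) \<Rightarrow> bool" where
  "normal_form t L h \<theta> \<kappa> p f \<longleftrightarrow>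
    bij_betw h {0..1} {0..1} \<and> (\<forall>u\<in>{0..1}. Z 0 0 u t = cis_curve L \<theta> (h u)) \<and>
    (\<forall>x\<in>{0..1}. (\<theta> has_real_derivative L * \<kappa> x) (at x within {0..1})) \<and>
    (\<forall>x\<in>{0..1}. (\<kappa> has_real_derivative L * p x) (at x within {0..1})) \<and>
    (\<forall>x\<in>{0..1}. (p has_real_derivative L * f x) (at x within {0..1})) \<and>
    continuous_on {0..1} f \<and> \<bar>\<theta> 0\<bar> \<le> pi \<and> \<kappa> 0 = 0 \<and> \<kappa> 1 = 0 \<and>
    0 < L \<and> l \<le> L \<and> L \<le> energy 0 / lam \<and> integral {0..1} (\<lambda>x. (\<kappa> x)\<^sup>2) \<le> energy 0 / l \<and>
    L * integral {0..1} (\<lambda>x. (\<kappa> x)\<^sup>2) + lam * L \<le> energy 0 \<and>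
    integral {0..1} (\<lambda>x. (lam * \<kappa> x - \<kappa> x ^ 3 - 2 * f x)\<^sup>2) \<le> dissipation t / l \<and>
    cis_curve L \<theta> 1 = of_real l \<and>
    (\<forall>F. continuous_on UNIV F \<longrightarrow> arclength_integral F t = L * integral {0..1} (\<lambda>x. F (cis_curve L \<theta> x)))"

lemma normal_form_exists:
  assumes t: "0 < t"
  shows "\<exists>L h \<theta> \<kappa> p f. normal_form t L h \<theta> \<kappa> p f"
proof -
  have t0: "0 \<le> t" using t by simp
  obtain ks kss where
    k: "\<And>u. u \<in> {0..1} \<Longrightarrow> ((\<lambda>u. k u t) has_real_derivative g u t * ks u) (at u within {0..1})"
    and ks: "\<And>u. u \<in> {0..1} \<Longrightarrow> (ks has_real_derivative g u t * kss u) (at u within {0..1})"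
    and kss: "continuous_on {0..1} kss"
    and v: "\<And>u. u \<in> {0..1} \<Longrightarrow> v u t = - 2 * kss u - k u t ^ 3 + lam * k u t"
    using flow_at[OF t] by metis
  define L where "L = integral {0..1} (\<lambda>u. g u t)"
  obtain h \<theta> \<kappa> p f where nf:
    "0 < L" "bij_betw h {0..1} {0..1}" "h 0 = 0" "h 1 = 1"
    "\<And>x. x \<in> {0..1} \<Longrightarrow> (\<theta> has_real_derivative L * \<kappa> x) (at x within {0..1})"
    "\<And>x. x \<in> {0..1} \<Longrightarrow> (\<kappa> has_real_derivative L * p x) (at x within {0..1})"
    "\<And>x. x \<in> {0..1} \<Longrightarrow> (p has_real_derivative L * f x) (at x within {0..1})"
    "continuous_on {0..1} f" "\<bar>\<theta> 0\<bar> \<le> pi"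
    and z: "\<And>u. u \<in> {0..1} \<Longrightarrow> Z 0 0 u t = cis_curve L \<theta> (h u)"
    and hk: "\<And>u. u \<in> {0..1} \<Longrightarrow> \<kappa> (h u) = k u t" "\<And>u. u \<in> {0..1} \<Longrightarrow> f (h u) = kss u"
    and subst: "\<And>\<phi> :: real \<Rightarrow> real. continuous_on {0..1} \<phi> \<Longrightarrow>
      integral {0..1} (\<lambda>u. \<phi> (h u) * g u t) = L * integral {0..1} \<phi>"
    using constant_speed_normal_form[OF continuous_on_g[OF t0] g_pos[OF _ t0] du_Z00[OF _ t0] du_T[OF _ t0] norm_T[OF _ t0] k ks kss ends(1)[OF t] L_def]
    by blast
  have c\<theta>: "continuous_on {0..1} \<theta>" using nf(5) by (rule DERIV_continuous_on)
  have c\<kappa>: "continuous_on {0..1} \<kappa>" using nf(6) by (rule DERIV_continuous_on)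
  have E: "energy t \<le> energy 0" by (rule energy_antimono) (use t in auto)
  have bend: "integral {0..1} (\<lambda>u. (k u t)\<^sup>2 * g u t) = L * integral {0..1} (\<lambda>x. (\<kappa> x)\<^sup>2)"
  proof -
    have "integral {0..1} (\<lambda>u. (k u t)\<^sup>2 * g u t) = integral {0..1} (\<lambda>u. (\<kappa> (h u))\<^sup>2 * g u t)"
      by (rule integral_cong) (simp add: hk)
    then show ?thesis using subst[of "\<lambda>x. (\<kappa> x)\<^sup>2"] c\<kappa> by (simp add: continuous_on_power)
  qed
  have diss: "dissipation t = L * integral {0..1} (\<lambda>x. (lam * \<kappa> x - \<kappa> x ^ 3 - 2 * f x)\<^sup>2)"
  proof -
    have "dissipation t = integral {0..1} (\<lambda>u. (lam * \<kappa> (h u) - \<kappa> (h u) ^ 3 - 2 * f (h u))\<^sup>2 * g u t)"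
      unfolding dissipation_def
    proof (rule integral_cong)
      fix u :: real assume u: "u \<in> {0..1}"
      have "v u t = lam * \<kappa> (h u) - \<kappa> (h u) ^ 3 - 2 * f (h u)" using v[OF u] by (simp add: hk[OF u])
      then show "(v u t)\<^sup>2 * g u t = (lam * \<kappa> (h u) - \<kappa> (h u) ^ 3 - 2 * f (h u))\<^sup>2 * g u t" by simp
    qed
    also have "\<dots> = L * integral {0..1} (\<lambda>x. (lam * \<kappa> x - \<kappa> x ^ 3 - 2 * f x)\<^sup>2)"
      by (rule subst) (intro continuous_intros c\<kappa> nf)
    finally show ?thesis .
  qed
  have end1: "cis_curve L \<theta> 1 = of_real l" using z[of 1] ends(2)[OF t] nf(4) by simp
  \<comment> \<open>The ends are at distance \<open>l\<close>, so no curve is shorter than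
    \<open>l\<close>. This replaces the varying length by a constant in the bounds below and keeps
    the length of the limit positive.\<close>
  have "cmod (cis_curve L \<theta> 1 - cis_curve L \<theta> 0) \<le> L * \<bar>1 - 0\<bar>"
    by (rule cis_curve_lipschitz[OF c\<theta> nf(1)]) auto
  then have lL: "l \<le> L" using l unfolding end1 by (simp add: cis_curve_def)
  have LE: "L \<le> energy 0 / lam"
    using length_and_bending_le_energy(1)[OF t0] E lam by (simp add: L_def pos_le_divide_eq mult.commute)
  have nonneg: "0 \<le> integral {0..1} (\<lambda>x. (\<kappa> x)\<^sup>2)" "0 \<le> integral {0..1} (\<lambda>x. (lam * \<kappa> x - \<kappa> x ^ 3 - 2 * f x)\<^sup>2)"
    by (rule integral_nonneg_continuous, intro continuous_intros c\<kappa> nf, simp)+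
  have "l * integral {0..1} (\<lambda>x. (\<kappa> x)\<^sup>2) \<le> L * integral {0..1} (\<lambda>x. (\<kappa> x)\<^sup>2)"
    by (rule mult_right_mono[OF lL nonneg(1)])
  also have "\<dots> \<le> energy 0" using length_and_bending_le_energy(2)[OF t0] E by (simp add: bend)
  finally have M: "integral {0..1} (\<lambda>x. (\<kappa> x)\<^sup>2) \<le> energy 0 / l"
    using l by (simp add: pos_le_divide_eq mult.commute)
  have "l * integral {0..1} (\<lambda>x. (lam * \<kappa> x - \<kappa> x ^ 3 - 2 * f x)\<^sup>2) \<le> dissipation t"
    unfolding diss by (rule mult_right_mono[OF lL nonneg(2)])
  then have D: "integral {0..1} (\<lambda>x. (lam * \<kappa> x - \<kappa> x ^ 3 - 2 * f x)\<^sup>2) \<le> dissipation t / l"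
    using l by (simp add: pos_le_divide_eq mult.commute)
  have EE: "L * integral {0..1} (\<lambda>x. (\<kappa> x)\<^sup>2) + lam * L \<le> energy 0"
    using length_and_bending_le_energy(3)[OF t0] E by (simp add: bend L_def)
  have AI: "arclength_integral F t = L * integral {0..1} (\<lambda>x. F (cis_curve L \<theta> x))" if F: "continuous_on UNIV F" for F
  proof -
    have "arclength_integral F t = integral {0..1} (\<lambda>u. F (cis_curve L \<theta> (h u)) * g u t)"
      unfolding arclength_integral_def by (rule integral_cong) (simp add: z)
    also have "\<dots> = L * integral {0..1} (\<lambda>x. F (cis_curve L \<theta> x))"
      by (rule subst) (rule continuous_on_compose2[OF F continuous_on_cis_curve[OF c\<theta>]], simp)
    finally show ?thesis .
  qed
  have "\<kappa> 0 = 0" "\<kappa> 1 = 0"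
    using hk(1)[of 0] hk(1)[of 1] nf(3,4) curvature_ends[OF t] unfolding speed_curvature_tangent_eq by simp_all
  then show ?thesis
    unfolding normal_form_def using nf(1,2,5-9) z lL LE M D EE end1 AI by blast
qed

text \<open>The mean value theorem for the energy on [t, t + 1] selects the good time. The drop on
  the right tends to zero as t grows.\<close>

lemma small_dissipation_nearby:
  assumes "0 \<le> t"
  shows "\<exists>s. t < s \<and> s < t + 1 \<and> dissipation s = energy t - energy (t + 1)"
proof -
  have "\<exists>d s. t < s \<and> s < t + 1 \<and> (energy has_real_derivative d) (at s) \<and> energy (t + 1) - energy t = (t + 1 - t) * d"
  proof (rule MVT)
    show "continuous_on {t..t + 1} energy" using assms by (auto intro: continuous_on_subset[OF continuous_on_energy])
    show "energy differentiable (at x)" if "t < x" for x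
      using energy_derivative[of x] that assms by (auto simp: real_differentiable_def)
  qed simp
  then obtain d s where s: "t < s" "s < t + 1" "(energy has_real_derivative d) (at s)" "energy (t + 1) - energy t = d"
    by auto
  have "d = - dissipation s" using DERIV_unique[OF s(3) energy_derivative[of s]] s(1) assms by simp
  then show ?thesis using s by (intro exI[of _ s]) auto
qed

lemma eventually_embedded:
  assumes E: "energy 0 < elastic_energy lam 0 (loop_len lam l) (gamma_loop lam l)"
  shows "\<exists>t0>0. \<forall>t\<ge>t0. inj_on (\<lambda>u. Z 0 0 u t) {0..1}"
proof (rule ccontr)
  assume "\<not> (\<exists>t0>0. \<forall>t\<ge>t0. inj_on (\<lambda>u. Z 0 0 u t) {0..1})"
  then have "\<forall>n::nat. \<exists>t. t \<ge> real n + 1 \<and> \<not> inj_on (\<lambda>u. Z 0 0 u t) {0..1}"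
    by (metis add_nonneg_pos of_nat_0_le_iff zero_less_one)
  then obtain tn where tn: "\<And>n. real n + 1 \<le> tn n" "\<And>n. \<not> inj_on (\<lambda>u. Z 0 0 u (tn n)) {0..1}"
    by metis
  have tn0: "0 < tn n" for n using tn(1)[of n] by linarith
  have "\<forall>n. \<exists>s. tn n < s \<and> s < tn n + 1 \<and> dissipation s = energy (tn n) - energy (tn n + 1)"
    using small_dissipation_nearby less_imp_le[OF tn0] by blast
  then obtain sn where sn: "\<And>n. tn n < sn n" "\<And>n. sn n < tn n + 1"
    "\<And>n. dissipation (sn n) = energy (tn n) - energy (tn n + 1)" by metis
  have sn0: "0 < sn n" for n using sn(1)[of n] tn0[of n] by linarith
  have ev: "\<forall>\<^sub>F n in sequentially. S \<le> tn n" for S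
  proof -
    obtain N :: nat where "S \<le> real N" using real_arch_simple by blast
    then have "S \<le> tn n" if "N \<le> n" for n using tn(1)[of n] that by linarith
    then show ?thesis unfolding eventually_sequentially by blast
  qed
  have diss0: "(\<lambda>n. dissipation (sn n)) \<longlonglongrightarrow> 0"
  proof (rule LIMSEQ_I)
    fix e :: real assume "0 < e"
    then obtain S where S: "\<And>s t. S \<le> s \<Longrightarrow> s \<le> t \<Longrightarrow> energy s - energy t < e"
      using energy_eventually_flat by metis
    obtain N where "\<And>n. N \<le> n \<Longrightarrow> S \<le> tn n" using ev[of S] unfolding eventually_sequentially by blast
    then have "dissipation (sn n) < e" if "N \<le> n" for n
      unfolding sn(3) using S[of "tn n" "tn n + 1"] that by simp
    then show "\<exists>N. \<forall>n\<ge>N. norm (dissipation (sn n) - 0) < e"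
      using dissipation_nonneg[OF less_imp_le[OF sn0]] by (intro exI[of _ N]) auto
  qed
  have flat: "(\<lambda>n. arclength_integral F (sn n) - arclength_integral F (tn n)) \<longlonglongrightarrow> 0" if F: "test_function F G C" for F G C
  proof (rule LIMSEQ_I)
    fix e :: real assume "0 < e"
    then obtain S where S: "\<And>s t. S \<le> s \<Longrightarrow> s \<le> t \<Longrightarrow> t \<le> s + 1 \<Longrightarrow>
        \<bar>arclength_integral F t - arclength_integral F s\<bar> < e"
      using arclength_integral_eventually_flat[OF F] by metis
    obtain N where "\<And>n. N \<le> n \<Longrightarrow> S \<le> tn n" using ev[of S] unfolding eventually_sequentially by blast
    then have "\<bar>arclength_integral F (sn n) - arclength_integral F (tn n)\<bar> < e" if "N \<le> n" for n
      using S[of "tn n" "sn n"] that less_imp_le[OF sn(1)] less_imp_le[OF sn(2)] by blast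
    then show "\<exists>N. \<forall>n\<ge>N. norm (arclength_integral F (sn n) - arclength_integral F (tn n) - 0) < e"
      by (intro exI[of _ N]) auto
  qed
  have "\<forall>n. \<exists>L h \<theta> \<kappa> p f. normal_form (sn n) L h \<theta> \<kappa> p f" using normal_form_exists[OF sn0] by blast
  then obtain L1 h1 \<theta>1 \<kappa>1 p1 f1 where nf1: "\<And>n. normal_form (sn n) (L1 n) (h1 n) (\<theta>1 n) (\<kappa>1 n) (p1 n) (f1 n)"
    by metis
  have "\<forall>n. \<exists>L h \<theta> \<kappa> p f. normal_form (tn n) L h \<theta> \<kappa> p f" using normal_form_exists[OF tn0] by blast
  then obtain L2 h2 \<theta>2 \<kappa>2 p2 f2 where nf2: "\<And>n. normal_form (tn n) (L2 n) (h2 n) (\<theta>2 n) (\<kappa>2 n) (p2 n) (f2 n)"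
    by metis
  note nf1 = nf1[unfolded normal_form_def] and nf2 = nf2[unfolded normal_form_def]
  have 1: "\<And>n. 0 < L1 n" "\<And>n. L1 n \<le> energy 0 / lam" "\<And>n. l \<le> L1 n"
    "\<And>n x. x \<in> {0..1} \<Longrightarrow> (\<theta>1 n has_real_derivative L1 n * \<kappa>1 n x) (at x within {0..1})"
    "\<And>n x. x \<in> {0..1} \<Longrightarrow> (\<kappa>1 n has_real_derivative L1 n * p1 n x) (at x within {0..1})"
    "\<And>n x. x \<in> {0..1} \<Longrightarrow> (p1 n has_real_derivative L1 n * f1 n x) (at x within {0..1})"
    "\<And>n. continuous_on {0..1} (f1 n)" "\<And>n. \<kappa>1 n 0 = 0" "\<And>n. \<kappa>1 n 1 = 0"
    "\<And>n. integral {0..1} (\<lambda>x. (\<kappa>1 n x)\<^sup>2) \<le> energy 0 / l" "\<And>n. \<bar>\<theta>1 n 0\<bar> \<le> pi"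
    "\<And>n. integral {0..1} (\<lambda>x. (lam * \<kappa>1 n x - \<kappa>1 n x ^ 3 - 2 * f1 n x)\<^sup>2) \<le> dissipation (sn n) / l"
    "\<And>n. L1 n * integral {0..1} (\<lambda>x. (\<kappa>1 n x)\<^sup>2) + lam * L1 n \<le> energy 0"
    "\<And>n. cis_curve (L1 n) (\<theta>1 n) 1 = of_real l"
    "\<And>n F. continuous_on UNIV F \<Longrightarrow> arclength_integral F (sn n) = L1 n * integral {0..1} (\<lambda>x. F (cis_curve (L1 n) (\<theta>1 n) x))"
    using nf1 by blast+
  have 2: "\<And>n. 0 < L2 n" "\<And>n. L2 n \<le> energy 0 / lam"
    "\<And>n x. x \<in> {0..1} \<Longrightarrow> (\<theta>2 n has_real_derivative L2 n * \<kappa>2 n x) (at x within {0..1})"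
    "\<And>n x. x \<in> {0..1} \<Longrightarrow> (\<kappa>2 n has_real_derivative L2 n * p2 n x) (at x within {0..1})"
    "\<And>n. integral {0..1} (\<lambda>x. (\<kappa>2 n x)\<^sup>2) \<le> energy 0 / l" "\<And>n. \<bar>\<theta>2 n 0\<bar> \<le> pi"
    "\<And>n. cis_curve (L2 n) (\<theta>2 n) 1 = of_real l" "\<And>n. bij_betw (h2 n) {0..1} {0..1}"
    "\<And>n u. u \<in> {0..1} \<Longrightarrow> Z 0 0 u (tn n) = cis_curve (L2 n) (\<theta>2 n) (h2 n u)"
    "\<And>n F. continuous_on UNIV F \<Longrightarrow> arclength_integral F (tn n) = L2 n * integral {0..1} (\<lambda>x. F (cis_curve (L2 n) (\<theta>2 n) x))"
    using nf2 by blast+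
  have c\<theta>1: "continuous_on {0..1} (\<theta>1 n)" for n using 1(4) by (rule DERIV_continuous_on)
  have c\<kappa>1: "continuous_on {0..1} (\<kappa>1 n)" for n using 1(5) by (rule DERIV_continuous_on)
  have c\<theta>2: "continuous_on {0..1} (\<theta>2 n)" for n using 2(3) by (rule DERIV_continuous_on)
  have c\<kappa>2: "continuous_on {0..1} (\<kappa>2 n)" for n using 2(4) by (rule DERIV_continuous_on)
  have w: "(\<lambda>n. integral {0..1} (\<lambda>x. (lam * \<kappa>1 n x - \<kappa>1 n x ^ 3 - 2 * f1 n x)\<^sup>2)) \<longlonglongrightarrow> 0"
  proof (rule tendsto_sandwich[OF always_eventually always_eventually])
    show "\<forall>n. 0 \<le> integral {0..1} (\<lambda>x. (lam * \<kappa>1 n x - \<kappa>1 n x ^ 3 - 2 * f1 n x)\<^sup>2)"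
      by (rule allI, rule integral_nonneg_continuous, intro continuous_intros c\<kappa>1 1(7), simp)
    show "\<forall>n. integral {0..1} (\<lambda>x. (lam * \<kappa>1 n x - \<kappa>1 n x ^ 3 - 2 * f1 n x)\<^sup>2) \<le> dissipation (sn n) / l"
      using 1(12) by blast
    show "(\<lambda>n. dissipation (sn n) / l) \<longlonglongrightarrow> 0" using tendsto_divide[OF diss0 tendsto_const[of l]] l by simp
  qed (rule tendsto_const)
  obtain r1 L \<theta> k' p' where r1: "strict_mono (r1 :: nat \<Rightarrow> nat)" and L: "(\<lambda>n. L1 (r1 n)) \<longlonglongrightarrow> L"
    and u\<theta>: "uniform_limit {0..1} (\<lambda>n. \<theta>1 (r1 n)) \<theta> sequentially"
    and uk: "uniform_limit {0..1} (\<lambda>n. \<kappa>1 (r1 n)) k' sequentially"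
    and d\<theta>: "\<And>x. x \<in> {0..1} \<Longrightarrow> (\<theta> has_real_derivative L * k' x) (at x within {0..1})"
    and dk': "\<And>x. x \<in> {0..1} \<Longrightarrow> (k' has_real_derivative L * p' x) (at x within {0..1})"
    and dp': "\<And>x. x \<in> {0..1} \<Longrightarrow> (p' has_real_derivative L * ((lam * k' x - k' x ^ 3) / 2)) (at x within {0..1})"
    and k'01: "k' 0 = 0" "k' 1 = 0"
    using elastica_compactness[OF lam 1(1,2,4,5,6,7,8,9,10,11) w] by metis
  have c\<theta>: "continuous_on {0..1} \<theta>" using d\<theta> by (rule DERIV_continuous_on)
  have ck': "continuous_on {0..1} k'" using dk' by (rule DERIV_continuous_on)
  have "l \<le> L" by (rule LIMSEQ_le_const[OF L]) (use 1(3) in blast)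
  then have L0: "0 < L" using l by simp
  have u\<eta>: "uniform_limit {0..1} (\<lambda>n. cis_curve (L1 (r1 n)) (\<theta>1 (r1 n))) (cis_curve L \<theta>) sequentially"
    by (rule uniform_limit_cis_curve[OF L u\<theta> c\<theta>1 c\<theta>])
  have end\<eta>: "cis_curve L \<theta> 1 = of_real l"
    using LIMSEQ_unique[OF tendsto_uniform_limitI[OF u\<eta>, of 1], of "of_real l"] 1(14) by simp
  have inj: "inj_on (cis_curve L \<theta>) {0..1}"
    unfolding cis_curve_def[abs_def]
  proof (rule elastica_embedded[OF L0 lam l d\<theta> dk' dp' k'01])
    show "integral {0..1} (\<lambda>x. of_real L * cis (\<theta> x)) = of_real l" using end\<eta> by (simp add: cis_curve_def)
    have "uniform_limit {0..1} (\<lambda>n x. integral {0..x} (\<lambda>y. \<kappa>1 (r1 n) y * \<kappa>1 (r1 n) y)) (\<lambda>x. integral {0..x} (\<lambda>y. k' y * k' y)) sequentially"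
      by (intro uniform_limit_integral_lower uniform_limit_mult_continuous uk continuous_intros ck' c\<kappa>1)
    from tendsto_uniform_limitI[OF this, of 1]
    have "(\<lambda>n. integral {0..1} (\<lambda>x. (\<kappa>1 (r1 n) x)\<^sup>2)) \<longlonglongrightarrow> integral {0..1} (\<lambda>x. (k' x)\<^sup>2)"
      by (simp add: power2_eq_square)
    then have "(\<lambda>n. L1 (r1 n) * integral {0..1} (\<lambda>x. (\<kappa>1 (r1 n) x)\<^sup>2) + lam * L1 (r1 n)) \<longlonglongrightarrow>
        L * integral {0..1} (\<lambda>x. (k' x)\<^sup>2) + lam * L"
      by (intro tendsto_intros L)
    \<comment> \<open>The strict inequality concerns the initial energy, a fixed number, so it
      survives the passage to the limit.\<close>
    then have "L * integral {0..1} (\<lambda>x. (k' x)\<^sup>2) + lam * L \<le> energy 0"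
      by (rule LIMSEQ_le_const2) (use 1(13) in blast)
    then show "L * integral {0..1} (\<lambda>x. (k' x)\<^sup>2) + lam * L < elastic_energy lam 0 (loop_len lam l) (gamma_loop lam l)"
      using E by simp
  qed
  \<comment> \<open>At the times \<open>tn\<close> the dissipation is not controlled, so of the
    curvature only the L2 bound is available: lengths and angles converge, along a further
    subsequence of \<open>r1\<close>, but no limit equation results.\<close>
  obtain r2 L'' \<theta>'' where r2: "strict_mono (r2 :: nat \<Rightarrow> nat)" and L'': "(\<lambda>n. L2 (r1 (r2 n))) \<longlonglongrightarrow> L''"
    and c\<theta>'': "continuous_on {0..1} \<theta>''" and u\<theta>'': "uniform_limit {0..1} (\<lambda>n. \<theta>2 (r1 (r2 n))) \<theta>'' sequentially"
    using angle_compactness[of "\<lambda>n. L2 (r1 n)" "energy 0 / lam" "\<lambda>n. \<theta>2 (r1 n)" "\<lambda>n. \<kappa>2 (r1 n)" "energy 0 / l",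
        OF 2(1,2,3) c\<kappa>2 2(5,6)] by metis
  define \<rho> where "\<rho> = (\<lambda>n. r1 (r2 n))"
  have \<rho>: "strict_mono \<rho>" unfolding \<rho>_def using strict_mono_o[OF r1 r2] by (simp add: o_def)
  have L1\<rho>: "(\<lambda>n. L1 (\<rho> n)) \<longlonglongrightarrow> L"
    using LIMSEQ_subseq_LIMSEQ[OF L r2] by (simp add: o_def \<rho>_def)
  have u\<theta>1\<rho>: "uniform_limit {0..1} (\<lambda>n. \<theta>1 (\<rho> n)) \<theta> sequentially"
    using filterlim_compose[OF u\<theta> filterlim_subseq[OF r2]] by (simp add: o_def \<rho>_def)
  have L2\<rho>: "(\<lambda>n. L2 (\<rho> n)) \<longlonglongrightarrow> L''" using L'' by (simp add: \<rho>_def)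
  have u\<theta>2\<rho>: "uniform_limit {0..1} (\<lambda>n. \<theta>2 (\<rho> n)) \<theta>'' sequentially" using u\<theta>'' by (simp add: \<rho>_def)
  have flat\<rho>: "(\<lambda>n. arclength_integral F (sn (\<rho> n)) - arclength_integral F (tn (\<rho> n))) \<longlonglongrightarrow> 0" if "test_function F G C" for F G C
    using LIMSEQ_subseq_LIMSEQ[OF flat[OF that] \<rho>] by (simp add: o_def)
  have conv: "(\<lambda>n. Ln n * integral {0..1} (\<lambda>x. F (cis_curve (Ln n) (\<theta>n n) x))) \<longlonglongrightarrow> L0 * integral {0..1} (\<lambda>x. F (cis_curve L0 \<theta>0 x))"
    if F: "test_function F G C" and Ln: "Ln \<longlonglongrightarrow> L0" and u: "uniform_limit {0..1} \<theta>n \<theta>0 sequentially"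
      and c: "\<And>n. continuous_on {0..1} (\<theta>n n)" "continuous_on {0..1} \<theta>0"
    for F G C and Ln :: "nat \<Rightarrow> real" and \<theta>n L0 \<theta>0
  proof -
    have cF: "continuous_on UNIV F" by (rule test_function_continuous[OF F])
    have "uniform_limit {0..1} (\<lambda>n x. F (cis_curve (Ln n) (\<theta>n n) x)) (\<lambda>x. F (cis_curve L0 \<theta>0 x)) sequentially"
    proof (rule uniform_limitI)
      fix e :: real assume e: "0 < e"
      have C: "0 \<le> C" using F abs_ge_zero order_trans unfolding test_function_def by blast
      have "0 < e / (C + 1)" using e C by simp
      from uniform_limitD[OF uniform_limit_cis_curve[OF Ln u c] this]
      show "\<forall>\<^sub>F n in sequentially. \<forall>x\<in>{0..1}. dist (F (cis_curve (Ln n) (\<theta>n n) x)) (F (cis_curve L0 \<theta>0 x)) < e"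
      proof eventually_elim
        case (elim n)
        show ?case
        proof
          fix x :: real assume "x \<in> {0..1}"
          then have d: "dist (cis_curve (Ln n) (\<theta>n n) x) (cis_curve L0 \<theta>0 x) < e / (C + 1)" using elim by blast
          have "dist (F (cis_curve (Ln n) (\<theta>n n) x)) (F (cis_curve L0 \<theta>0 x)) \<le> C * dist (cis_curve (Ln n) (\<theta>n n) x) (cis_curve L0 \<theta>0 x)"
            using test_function_lipschitz[OF F] by (simp add: dist_norm)
          also have "\<dots> \<le> (C + 1) * dist (cis_curve (Ln n) (\<theta>n n) x) (cis_curve L0 \<theta>0 x)"
            by (intro mult_right_mono) auto
          also have "\<dots> < (C + 1) * (e / (C + 1))" using d C by (intro mult_strict_left_mono) auto
          also have "\<dots> = e" using C by simp
          finally show "dist (F (cis_curve (Ln n) (\<theta>n n) x)) (F (cis_curve L0 \<theta>0 x)) < e" .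
        qed
      qed
    qed
    from tendsto_uniform_limitI[OF uniform_limit_integral_lower[OF this], of 1]
    have "(\<lambda>n. integral {0..1} (\<lambda>x. F (cis_curve (Ln n) (\<theta>n n) x))) \<longlonglongrightarrow> integral {0..1} (\<lambda>x. F (cis_curve L0 \<theta>0 x))"
      using continuous_on_compose2[OF cF continuous_on_cis_curve] c by simp
    then show ?thesis by (intro tendsto_mult Ln)
  qed
  have same: "L * integral {0..1} (\<lambda>x. F (cis_curve L \<theta> x)) = L'' * integral {0..1} (\<lambda>x. F (cis_curve L'' \<theta>'' x))"
    if F: "test_function F G C" for F G C
  proof -
    have cF: "continuous_on UNIV F" by (rule test_function_continuous[OF F])
    have "(\<lambda>n. arclength_integral F (sn (\<rho> n)) - arclength_integral F (tn (\<rho> n))) \<longlonglongrightarrow>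
        L * integral {0..1} (\<lambda>x. F (cis_curve L \<theta> x)) - L'' * integral {0..1} (\<lambda>x. F (cis_curve L'' \<theta>'' x))"
      unfolding 1(15)[OF cF] 2(10)[OF cF]
      by (intro tendsto_diff conv[OF F] L1\<rho> u\<theta>1\<rho> c\<theta>1 c\<theta> c\<theta>2 c\<theta>'' L2\<rho> u\<theta>2\<rho>)
    with flat\<rho>[OF F] have "L * integral {0..1} (\<lambda>x. F (cis_curve L \<theta> x)) - L'' * integral {0..1} (\<lambda>x. F (cis_curve L'' \<theta>'' x)) = 0"
      using LIMSEQ_unique by blast
    then show ?thesis by simp
  qed
  \<comment> \<open>Tested with the constant 1, the arclength integral is the length.\<close>
  have L''_eq: "L'' = L" using same[OF test_function_const] by simp
  define c where "c = cis_curve L \<theta>''"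
  have c\<eta>: "continuous_on {0..1} (cis_curve L \<theta>)" and cc: "continuous_on {0..1} c"
    unfolding c_def by (intro continuous_on_cis_curve c\<theta> c\<theta>'')+
  have img: "c ` {0..1} \<subseteq> cis_curve L \<theta> ` {0..1}"
  proof (rule image_subsetI, rule ccontr)
    fix u :: real assume u: "u \<in> {0..1}" and nin: "c u \<notin> cis_curve L \<theta> ` {0..1}"
    define P where "P = c u"
    have "closed (cis_curve L \<theta> ` {0..1})"
      by (intro compact_imp_closed compact_continuous_image c\<eta> compact_Icc)
    then have "open (- (cis_curve L \<theta> ` {0..1}))" by (rule open_Compl)
    then obtain r where r: "0 < r" "ball P r \<subseteq> - (cis_curve L \<theta> ` {0..1})"
      using nin unfolding P_def open_contains_ball by blast
    \<comment> \<open>The disc around the stray point misses the arc, so this bump integrates to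
      zero along the arc, and by \<open>same\<close> also along the second limit. Being continuous
      and nonnegative it would vanish at \<open>c u\<close>, where its value is r^4.\<close>
    define F where "F = (\<lambda>z. (max 0 (r\<^sup>2 - (cmod (z - P))\<^sup>2))\<^sup>2)"
    obtain C where F: "test_function F (\<lambda>z. of_real (- 4 * max 0 (r\<^sup>2 - (cmod (z - P))\<^sup>2)) * (z - P)) C"
      using test_function_bump[OF r(1), of P] unfolding F_def by blast
    have "F (cis_curve L \<theta> x) = 0" if "x \<in> {0..1}" for x
    proof -
      have "cis_curve L \<theta> x \<notin> ball P r" using r(2) that by blast
      then have "r \<le> cmod (cis_curve L \<theta> x - P)" by (simp add: dist_norm norm_minus_commute)
      then have "r\<^sup>2 \<le> (cmod (cis_curve L \<theta> x - P))\<^sup>2" using r(1) by (intro power_mono) auto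
      then show ?thesis by (simp add: F_def)
    qed
    then have "integral {0..1} (\<lambda>x. F (cis_curve L \<theta> x)) = integral {0..1::real} (\<lambda>x. 0)"
      by (intro integral_cong) simp
    then have I0: "integral {0..1} (\<lambda>x. F (c x)) = 0"
      using same[OF F] L0 by (simp add: L''_eq c_def)
    have cFc: "continuous_on {0..1} (\<lambda>x. F (c x))"
      by (rule continuous_on_compose2[OF test_function_continuous[OF F] cc]) simp
    have "F (c u) = 0"
      using integral_eq_0_iff[OF cFc zero_less_one] I0 u by (simp add: F_def)
    then show False using r(1) by (simp add: F_def P_def)
  qed
  have c_eq: "c u = cis_curve L \<theta> u" if "u \<in> {0..1}" for u
  proof (rule curve_inside_embedded_arc_eq[OF c\<theta> L0 inj _ img _ _ that])
    show "cmod (c u - c w) \<le> L * \<bar>u - w\<bar>" if "u \<in> {0..1}" "w \<in> {0..1}" for u w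
      unfolding c_def by (rule cis_curve_lipschitz[OF c\<theta>'' L0 that(2,1)])
    show "c 0 = cis_curve L \<theta> 0" by (simp add: c_def cis_curve_def)
    have "uniform_limit {0..1} (\<lambda>n. cis_curve (L2 (r1 (r2 n))) (\<theta>2 (r1 (r2 n)))) (cis_curve L'' \<theta>'') sequentially"
      by (rule uniform_limit_cis_curve[OF L'' u\<theta>'' c\<theta>2 c\<theta>''])
    from tendsto_uniform_limitI[OF this, of 1] have "cis_curve L'' \<theta>'' 1 = of_real l"
      using LIMSEQ_unique[of "\<lambda>_. of_real l"] by (simp add: 2(7) LIMSEQ_const_iff)
    then show "c 1 = cis_curve L \<theta> 1" by (simp add: c_def end\<eta> L''_eq)
  qed
  have "inj_on (cis_curve L \<theta>'') {0..1}"
    using inj c_eq unfolding c_def inj_on_def by metis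
  then have "\<forall>\<^sub>F n in sequentially. inj_on (cis_curve (L2 (r1 (r2 n))) (\<theta>2 (r1 (r2 n)))) {0..1}"
    by (intro eventually_inj_cis_curve[OF L''[unfolded L''_eq] L0 u\<theta>'' c\<theta>2 c\<theta>''])
  then obtain n where n: "inj_on (cis_curve (L2 (\<rho> n)) (\<theta>2 (\<rho> n))) {0..1}"
    unfolding \<rho>_def eventually_sequentially by blast
  have "inj_on (\<lambda>u. Z 0 0 u (tn (\<rho> n))) {0..1}"
  proof (rule inj_onI)
    fix x y :: real assume xy: "x \<in> {0..1}" "y \<in> {0..1}" "Z 0 0 x (tn (\<rho> n)) = Z 0 0 y (tn (\<rho> n))"
    have h: "h2 (\<rho> n) x \<in> {0..1}" "h2 (\<rho> n) y \<in> {0..1}"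
      using bij_betwE[OF 2(8)] xy by blast+
    have "h2 (\<rho> n) x = h2 (\<rho> n) y"
      using xy(3) unfolding 2(9)[OF xy(1)] 2(9)[OF xy(2)] by (rule inj_onD[OF n _ h])
    then show "x = y" by (rule inj_onD[OF bij_betw_imp_inj_on[OF 2(8)] _ xy(1,2)])
  qed
  then show False using tn(2) by blast
qed

end

section \<open>Transfer of the flow to the complex plane\<close>

lemma bounded_linear_Complex_fst_snd: "bounded_linear (\<lambda>p. Complex (fst p) (snd p))"
  unfolding Complex_eq
  by (intro bounded_linear_add bounded_linear_compose[OF bounded_linear_of_real]
      bounded_linear_compose[OF bounded_linear_mult_right, OF bounded_linear_compose[OF bounded_linear_of_real]]
      bounded_linear_fst bounded_linear_snd)

lemma pr_Complex: "pr (Complex (fst p) (snd p)) = p"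
  by (simp add: pr_def)

text \<open>The family is smooth up to t = 0, so curvature and its derivatives exist at every time t
  \<ge> 0, whereas the equation of motion is translated only for t > 0. The slice t = 0 coincides
  with \<open>\<gamma>0\<close> and gives the initial energy.\<close>

lemma elastic_flow_complex:
  assumes lam: "0 < lam" and l: "0 < l" and flow: "elastic_flow lam l \<gamma>0 \<gamma>"
  obtains Z where "complex_elastic_flow lam l Z"
    "\<And>u t. u \<in> {0..1} \<Longrightarrow> 0 \<le> t \<Longrightarrow> \<gamma> u t = pr (Z 0 0 u t)"
    "elastic_energy lam 0 1 \<gamma>0 = complex_elastic_flow.energy lam Z 0"
proof -
  define S :: "(real \<times> real) set" where "S = {0..1} \<times> {0..}"
  have "smooth_family_on S \<gamma>" using flow by (simp add: elastic_flow_def S_def)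
  then obtain D where D: "\<forall>(u, t)\<in>S. D 0 0 u t = \<gamma> u t"
    and cD: "\<forall>i j. continuous_on S (\<lambda>(u, t). D i j u t)"
    and dD: "\<forall>i j. \<forall>(u, t)\<in>S.
       ((\<lambda>v. D i j v t) has_vector_derivative D (Suc i) j u t) (at u within {v. (v, t) \<in> S}) \<and>
       ((\<lambda>\<tau>. D i j u \<tau>) has_vector_derivative D i (Suc j) u t) (at t within {\<tau>. (u, \<tau>) \<in> S})"
    unfolding smooth_family_on_def by blast
  have D0: "D 0 0 u t = \<gamma> u t" if "(u, t) \<in> S" for u t using D that by blast
  have dD: "((\<lambda>v. D i j v t) has_vector_derivative D (Suc i) j u t) (at u within {v. (v, t) \<in> S})"
    "((\<lambda>\<tau>. D i j u \<tau>) has_vector_derivative D i (Suc j) u t) (at t within {\<tau>. (u, \<tau>) \<in> S})"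
    if "(u, t) \<in> S" for i j u t using dD that by blast+
  define Z where "Z = (\<lambda>i j u t. Complex (fst (D i j u t)) (snd (D i j u t)))"
  have \<gamma>: "\<gamma> u t = pr (Z 0 0 u t)" if "u \<in> {0..1}" "0 \<le> t" for u t
    using D0[of u t] that by (simp add: Z_def pr_Complex S_def)
  have cont: "continuous_on ({0..1} \<times> {0..}) (\<lambda>(u, t). Z i j u t)" for i j
    using bounded_linear.continuous_on[OF bounded_linear_Complex_fst_snd cD[rule_format, of i j]]
    by (simp add: Z_def S_def case_prod_beta)
  have du: "((\<lambda>v. Z i j v t) has_vector_derivative Z (Suc i) j u t) (at u within {0..1})"
    if "u \<in> {0..1}" "0 \<le> t" for i j u t
  proof -
    have "{v. (v, t) \<in> S} = {0..1}" using that by (auto simp: S_def)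
    then show ?thesis
      using bounded_linear.has_vector_derivative[OF bounded_linear_Complex_fst_snd dD(1)[of u t i j]] that
      by (simp add: Z_def S_def)
  qed
  have dt: "((\<lambda>\<tau>. Z i j u \<tau>) has_vector_derivative Z i (Suc j) u t) (at t within {0..})"
    if "u \<in> {0..1}" "0 \<le> t" for i j u t
  proof -
    have "{\<tau>. (u, \<tau>) \<in> S} = {0..}" using that by (auto simp: S_def)
    then show ?thesis
      using bounded_linear.has_vector_derivative[OF bounded_linear_Complex_fst_snd dD(2)[of u t i j]] that
      by (simp add: Z_def S_def)
  qed
  have ne: "Z 1 0 u t \<noteq> 0" if u: "u \<in> {0..1}" and t: "0 \<le> t" for u t
  proof
    assume 0: "Z 1 0 u t = 0"
    have "((\<lambda>v. \<gamma> v t) has_vector_derivative pr (Z 1 0 u t)) (at u within {0..1})"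
    proof (rule has_vector_derivative_transform[OF u])
      show "((\<lambda>v. pr (Z 0 0 v t)) has_vector_derivative pr (Z 1 0 u t)) (at u within {0..1})"
        using has_vector_derivative_pr[OF du[OF u t, of 0 0]] by simp
    qed (use \<gamma> t in auto)
    then have "d1 {0..1} (\<lambda>v. \<gamma> v t) u = pr (Z 1 0 u t)"
      unfolding d1_def by (rule vector_derivative_within_closed_interval[OF zero_less_one u])
    moreover have "d1 {0..1} (\<lambda>v. \<gamma> v t) u \<noteq> 0" using flow u t by (simp add: elastic_flow_def)
    ultimately show False using 0 by (simp add: pr_def zero_prod_def)
  qed
  have ks: "\<exists>ks kss. curvature_derivatives (\<lambda>u. Z 1 0 u t) (\<lambda>u. Z 2 0 u t) ks kss" if t: "0 \<le> t" for t
    by (rule curvature_derivatives_exist[of "\<lambda>i u. Z i 0 u t", OF du[OF _ t] ne[OF _ t]])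
  have loc: "complex_elastic_flow lam l Z"
  proof (rule complex_elastic_flow.intro[OF lam l cont du dt ne])
    fix t :: real assume t: "0 < t"
    then have t0: "0 \<le> t" by simp
    obtain ks kss where k: "curvature_derivatives (\<lambda>u. Z 1 0 u t) (\<lambda>u. Z 2 0 u t) ks kss"
      using ks[OF t0] by blast
    have bc: "\<gamma> 0 t = (0, 0)" "\<gamma> 1 t = (l, 0)" "curv_vec {0..1} (\<lambda>v. \<gamma> v t) 0 = 0" "curv_vec {0..1} (\<lambda>v. \<gamma> v t) 1 = 0"
      using flow t by (auto simp: elastic_flow_def)
    note geo_t = geometry_of_pr_curve[of "\<lambda>i u. Z i 0 u t" "\<lambda>v. \<gamma> v t" ks kss,
        OF du[OF _ t0] ne[OF _ t0] \<gamma>[OF _ t0] k]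
    show "Z 0 0 0 t = 0" "Z 0 0 1 t = of_real l"
      using \<gamma>[of 0 t] \<gamma>[of 1 t] bc t0 by (auto simp: pr_def complex_eq_iff)
    have T0: "unit_tangent (\<lambda>u. Z 1 0 u t) u \<noteq> 0" if "u \<in> {0..1}" for u
      using ne[OF that t0] by (simp add: unit_tangent_def)
    have zero: "curvature (\<lambda>u. Z 1 0 u t) (\<lambda>u. Z 2 0 u t) u = 0"
      if u: "u \<in> {0..1}" and cv: "curv_vec {0..1} (\<lambda>v. \<gamma> v t) u = 0" for u
    proof -
      have "pr (\<i> * of_real (curvature (\<lambda>u. Z 1 0 u t) (\<lambda>u. Z 2 0 u t) u) * unit_tangent (\<lambda>u. Z 1 0 u t) u) = pr 0"
        using geo_t(3)[OF _ _ _ u] cv by (simp add: pr_def zero_prod_def)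
      then show ?thesis unfolding pr_simps(6) using T0[OF u] by simp
    qed
    show "curvature (\<lambda>u. Z 1 0 u t) (\<lambda>u. Z 2 0 u t) 0 = 0" "curvature (\<lambda>u. Z 1 0 u t) (\<lambda>u. Z 2 0 u t) 1 = 0"
      by (rule zero; simp add: bc)+
    have "Z 0 1 u t = \<i> * of_real (- 2 * kss u - (curvature (\<lambda>u. Z 1 0 u t) (\<lambda>u. Z 2 0 u t) u) ^ 3
            + lam * curvature (\<lambda>u. Z 1 0 u t) (\<lambda>u. Z 2 0 u t) u) * unit_tangent (\<lambda>u. Z 1 0 u t) u"
      if u: "u \<in> {0..1}" for u
    proof -
      define K where "K = curvature (\<lambda>u. Z 1 0 u t) (\<lambda>u. Z 2 0 u t) u"
      define T where "T = unit_tangent (\<lambda>u. Z 1 0 u t) u"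
      have cv: "curv_vec {0..1} (\<lambda>v. \<gamma> v t) u = pr (\<i> * of_real K * T)"
        using geo_t(3)[OF _ _ _ u] by (simp add: K_def T_def)
      have nn: "nabla_s {0..1} (\<lambda>v. \<gamma> v t) (nabla_s {0..1} (\<lambda>v. \<gamma> v t) (curv_vec {0..1} (\<lambda>v. \<gamma> v t))) u
          = pr (\<i> * of_real (kss u) * T)"
        using geo_t(4)[OF _ _ _ u] by (simp add: T_def)
      have T1: "cmod T = 1" using ne[OF u t0] by (simp add: T_def unit_tangent_def norm_divide)
      have nK: "(norm (pr (\<i> * of_real K * T)))\<^sup>2 = K\<^sup>2"
        unfolding pr_simps norm_mult T1 by simp
      have "((\<lambda>\<tau>. \<gamma> u \<tau>) has_vector_derivative
             (- 2 *\<^sub>R pr (\<i> * of_real (kss u) * T) - K\<^sup>2 *\<^sub>R pr (\<i> * of_real K * T) + lam *\<^sub>R pr (\<i> * of_real K * T))) (at t)"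
        using flow u t unfolding elastic_flow_def Let_def by (metis cv nn nK)
      moreover have "((\<lambda>\<tau>. \<gamma> u \<tau>) has_vector_derivative pr (Z 0 1 u t)) (at t)"
      proof (rule has_vector_derivative_transform_within_open[where S="{0<..}" and f="\<lambda>\<tau>. pr (Z 0 0 u \<tau>)"])
        show "((\<lambda>\<tau>. pr (Z 0 0 u \<tau>)) has_vector_derivative pr (Z 0 1 u t)) (at t)"
          using has_vector_derivative_pr[OF dt[OF u t0, of 0 0]] by (simp add: at_within_atLeast_interior[OF t])
      qed (use t \<gamma>[OF u] in auto)
      \<comment> \<open>The time derivative from the smooth family and the one prescribed by the
        flow are derivatives of the same function, hence equal. Read in the complex plane, this is
        the scalar equation for the normal velocity.\<close>
      ultimately have "pr (Z 0 1 u t) =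
          - 2 *\<^sub>R pr (\<i> * of_real (kss u) * T) - K\<^sup>2 *\<^sub>R pr (\<i> * of_real K * T) + lam *\<^sub>R pr (\<i> * of_real K * T)"
        using vector_derivative_unique_at by blast
      also have "\<dots> = pr (of_real (- 2) * (\<i> * of_real (kss u) * T) - of_real (K\<^sup>2) * (\<i> * of_real K * T) + of_real lam * (\<i> * of_real K * T))"
        by (simp only: pr_simps)
      finally have "Z 0 1 u t = of_real (- 2) * (\<i> * of_real (kss u) * T) - of_real (K\<^sup>2) * (\<i> * of_real K * T) + of_real lam * (\<i> * of_real K * T)"
        unfolding pr_simps(6) .
      then show ?thesis
        unfolding K_def[symmetric] T_def[symmetric]
        by (simp add: power2_eq_square power3_eq_cube algebra_simps)
    qed
    with k show "\<exists>ks kss. curvature_derivatives (\<lambda>u. Z 1 0 u t) (\<lambda>u. Z 2 0 u t) ks kss \<and>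
        (\<forall>u\<in>{0..1}. Z 0 1 u t = \<i> * of_real (- 2 * kss u - (curvature (\<lambda>u. Z 1 0 u t) (\<lambda>u. Z 2 0 u t) u) ^ 3
            + lam * curvature (\<lambda>u. Z 1 0 u t) (\<lambda>u. Z 2 0 u t) u) * unit_tangent (\<lambda>u. Z 1 0 u t) u)"
      by blast
  qed
  have init: "\<gamma> u 0 = \<gamma>0 u" if "u \<in> {0..1}" for u using flow that by (simp add: elastic_flow_def)
  interpret complex_elastic_flow lam l Z by (rule loc)
  have "elastic_energy lam 0 1 \<gamma>0 = energy 0"
  proof -
    obtain ks kss where k: "curvature_derivatives (\<lambda>u. Z 1 0 u 0) (\<lambda>u. Z 2 0 u 0) ks kss"
      using ks[OF order_refl] by blast
    have \<gamma>0: "\<gamma>0 u = pr (Z 0 0 u 0)" if "u \<in> {0..1}" for u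
      using \<gamma>[OF that order_refl] init[OF that] by simp
    note geo_0 = geometry_of_pr_curve[of "\<lambda>i u. Z i 0 u 0" \<gamma>0 ks kss,
        OF du[OF _ order_refl] ne[OF _ order_refl] \<gamma>0 k]
    have n: "norm (d1 {0..1} \<gamma>0 u) = g u 0" and c: "signed_curv {0..1} \<gamma>0 u = k u 0" if u: "u \<in> {0..1}" for u
      using geo_0(1,2)[OF _ _ _ u] by (simp_all add: speed_curvature_tangent_eq[symmetric])
    have "integral {0..1} (\<lambda>u. (signed_curv {0..1} \<gamma>0 u)\<^sup>2 * norm (d1 {0..1} \<gamma>0 u)) = integral {0..1} (\<lambda>u. (k u 0)\<^sup>2 * g u 0)"
      "integral {0..1} (\<lambda>u. norm (d1 {0..1} \<gamma>0 u)) = integral {0..1} (\<lambda>u. g u 0)"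
      by (rule integral_cong, simp only: n c)+
    then show ?thesis
      unfolding elastic_energy_def curve_length_def length_and_bending_le_energy(3)[OF order_refl] by simp
  qed
  with loc \<gamma> show ?thesis by (rule that)
qed

theorem theorem1p4:
  fixes lam l :: real and \<gamma>0 :: "real \<Rightarrow> real \<times> real"
    and \<gamma> :: "real \<Rightarrow> real \<Rightarrow> real \<times> real"
  assumes "lam > 0" and "l > 0"
    and "smooth_curve_on 0 1 \<gamma>0" and "in_A l \<gamma>0"
    and "curv_vec {0..1} \<gamma>0 0 = 0" and "curv_vec {0..1} \<gamma>0 1 = 0"
    and "elastic_energy lam 0 1 \<gamma>0
           < elastic_energy lam 0 (loop_len lam l) (gamma_loop lam l)"
    and "elastic_flow lam l \<gamma>0 \<gamma>"
  shows "\<exists>t0>0. \<forall>t\<ge>t0. inj_on (\<lambda>u. \<gamma> u t) {0..1}"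
proof -
  obtain Z where Z: "complex_elastic_flow lam l Z"
    and \<gamma>: "\<And>u t. u \<in> {0..1} \<Longrightarrow> 0 \<le> t \<Longrightarrow> \<gamma> u t = pr (Z 0 0 u t)"
    and E: "elastic_energy lam 0 1 \<gamma>0 = complex_elastic_flow.energy lam Z 0"
    using elastic_flow_complex[OF assms(1,2,8)] by metis
  obtain t0 where t0: "0 < t0" "\<And>t. t0 \<le> t \<Longrightarrow> inj_on (\<lambda>u. Z 0 0 u t) {0..1}"
    using complex_elastic_flow.eventually_embedded[OF Z assms(7)[unfolded E]] by blast
  have "inj_on (\<lambda>u. \<gamma> u t) {0..1}" if t: "t0 \<le> t" for t
  proof (rule inj_onI)
    fix x y :: real assume xy: "x \<in> {0..1}" "y \<in> {0..1}" "\<gamma> x t = \<gamma> y t"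
    have "0 \<le> t" using t t0(1) by simp
    then have "Z 0 0 x t = Z 0 0 y t" using xy by (simp add: \<gamma> pr_simps(6))
    then show "x = y" by (rule inj_onD[OF t0(2)[OF t] _ xy(1,2)])
  qed
  with t0(1) show ?thesis by blast
qed

end
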